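(* Let $d\ge 2$ and $n\ge 1$ be integers, and let $X=(X_1,\dots,X_n)$ be a vector of independent random variables taking values in a measurable space $\mathcal{X}$. Let $Y$ be a centered $d$-dimensional Gaussian vector with covariance matrix $C=(C_{ij})_{d\times d}$ (not necessarily positive definite). Let $F=(F_1,\dots,F_d)$ be an $\mathbb{R}^d$-valued random vector, each $F_i=F_i(X_1,\dots,X_n)$ being a measurable real-valued function of $X$, such that $E[F_i]=0$ and $\sigma_{ij}:=E[F_iF_j]<\infty$ for all $1\le i,j\le d$. Then, for any $\alpha\in[0,1]$ and any $g\in\mathcal{C}^3(\mathbb{R}^d)$ with $\|g''\|_\infty+\|g'''\|_\infty<\infty$, $$|E[g(F)]-E[g(Y)]|\le B_3\sum_{i,j=1}^d E|C_{ij}-Z^{(\alpha)}_{ij}|+B_4\sum_{i=1}^d\sum_{k=1}^n E|\mathfrak{D}_kF_i|^3$$ $$\le B_3\sum_{i,j=1}^d|C_{ij}-\sigma_{ij}|+B_3\sum_{i,j=1}^d\sqrt{\mathrm{Var}(Z^{(\alpha)}_{ij})}+B_4\sum_{i=1}^d\sum_{k=1}^n E|\mathfrak{D}_kF_i|^3,$$ where $B_3:=\frac{\|g''\|_\infty}{2}$, $B_4:=\frac{\|g'''\|_\infty d^2}{3}$, and $$Z^{(\alpha)}_{ij}:=\sum_{k=1}^n \mathfrak{D}_kF_i\,\mathfrak{D}^{(\alpha)}_kF_j,\qquad 1\le i,j\le d.$$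
   Context: For an integrable random variable $U=U(X_1,\dots,X_n)$, $E_i[U]$ denotes the expectation with respect to $X_i$ only, i.e. $E_i[U]=E[U\mid\sigma(X_k,k\ne i)]$, and $\mathfrak{D}_iU:=U-E_i[U]$, $1\le i\le n$. Let $\mathcal{F}_i:=\sigma(X_k,k\le i)$ and $\mathcal{G}_i:=\sigma(X_k,k\ge i)$ for $1\le i\le n$. For $\alpha\in[0,1]$, $\mathfrak{D}^{(\alpha)}_iU:=\alpha E[\mathfrak{D}_iU\mid\mathcal{F}_i]+(1-\alpha)E[\mathfrak{D}_iU\mid\mathcal{G}_i]$. $\mathcal{C}^k(\mathbb{R}^d)$ is the space of $k$-times continuously differentiable real-valued functions, and for $g\in\mathcal{C}^k(\mathbb{R}^d)$, $\|g^{(k)}\|_\infty:=\max_{1\le i_1\le\dots\le i_k\le d}\sup_{x\in\mathbb{R}^d}\big|\frac{\partial^k g}{\partial x_{i_1}\cdots\partial x_{i_k}}(x)\big|$; $g''=g^{(2)}$, $g'''=g^{(3)}$. Convention: the right-hand sides take values in $[0,\infty]$ (with the variance of a non-square-integrable variable equal to $+\infty$); a bound is considered to hold trivially when its right-hand side is not finite. *)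

theory Defs
  imports "HOL-Probability.Probability"
begin

definition partial_deriv :: "'d::finite \<Rightarrow> (real ^ 'd \<Rightarrow> real) \<Rightarrow> real ^ 'd \<Rightarrow> real" where
  "partial_deriv i g x = deriv (\<lambda>t. g (x + t *\<^sub>R axis i 1)) 0"

primrec Ck :: "nat \<Rightarrow> (real ^ 'd::finite \<Rightarrow> real) \<Rightarrow> bool" where
  "Ck 0 g \<longleftrightarrow> continuous_on UNIV g"
| "Ck (Suc k) g \<longleftrightarrow> g differentiable_on UNIV \<and> (\<forall>i. Ck k (partial_deriv i g))"

text \<open>Sup norm of the \<open>k\<close>-th derivative, with values in \<open>[0,\<infinity>]\<close>. A sorted list \<open>[i\<^sub>1, \<dots>, i\<^sub>k]\<close>
  is a multi-index \<open>i\<^sub>1 \<le> \<dots> \<le> i\<^sub>k\<close>; this is why the coordinates are indexed by an ordered type.\<close>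

definition deriv_sup_norm :: "nat \<Rightarrow> (real ^ 'd::{finite,linorder} \<Rightarrow> real) \<Rightarrow> ennreal" where
  "deriv_sup_norm k g =
    Max ((\<lambda>is. SUP x. ennreal \<bar>foldr partial_deriv is g x\<bar>) ` {is. length is = k \<and> sorted is})"

text \<open>Gaussian vectors may be degenerate: every linear functional is normal or almost surely constant.\<close>

definition gaussian_vector :: "'b measure \<Rightarrow> ('b \<Rightarrow> real ^ 'd::finite) \<Rightarrow> bool" where
  "gaussian_vector N Y \<longleftrightarrow> Y \<in> borel_measurable N \<and>
    (\<forall>u. (\<exists>m. AE \<omega> in N. u \<bullet> Y \<omega> = m) \<or>
         (\<exists>m s. s > 0 \<and> distributed N lborel (\<lambda>\<omega>. u \<bullet> Y \<omega>) (\<lambda>x. ennreal (normal_density m s x))))"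

definition centered_gaussian_vector ::
    "'b measure \<Rightarrow> ('b \<Rightarrow> real ^ 'd::finite) \<Rightarrow> real ^ 'd ^ 'd \<Rightarrow> bool" where
  "centered_gaussian_vector N Y C \<longleftrightarrow> gaussian_vector N Y \<and>
    (\<forall>i. (\<integral>\<omega>. Y \<omega> $ i \<partial>N) = 0) \<and>
    (\<forall>i j. (\<integral>\<omega>. Y \<omega> $ i * Y \<omega> $ j \<partial>N) = C $ i $ j)"

definition rv_sigma :: "'o measure \<Rightarrow> 'a measure \<Rightarrow> (nat \<Rightarrow> 'o \<Rightarrow> 'a) \<Rightarrow> nat set \<Rightarrow> 'o measure" where
  "rv_sigma M S X K = sigma (space M) (\<Union>k\<in>K. sets (vimage_algebra (space M) (X k) S))"

definition diff_op ::
    "'o measure \<Rightarrow> 'a measure \<Rightarrow> (nat \<Rightarrow> 'o \<Rightarrow> 'a) \<Rightarrow> nat \<Rightarrow> nat \<Rightarrow> ('o \<Rightarrow> real) \<Rightarrow> 'o \<Rightarrow> real" where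
  "diff_op M S X n k U = (\<lambda>\<omega>. U \<omega> - real_cond_exp M (rv_sigma M S X ({1..n} - {k})) U \<omega>)"

definition diff_op_mix ::
    "'o measure \<Rightarrow> 'a measure \<Rightarrow> (nat \<Rightarrow> 'o \<Rightarrow> 'a) \<Rightarrow> nat \<Rightarrow> real \<Rightarrow> nat \<Rightarrow> ('o \<Rightarrow> real) \<Rightarrow> 'o \<Rightarrow> real" where
  "diff_op_mix M S X n \<alpha> k U = (\<lambda>\<omega>.
      \<alpha> * real_cond_exp M (rv_sigma M S X {1..k}) (diff_op M S X n k U) \<omega>
    + (1 - \<alpha>) * real_cond_exp M (rv_sigma M S X {k..n}) (diff_op M S X n k U) \<omega>)"

definition Z_mix ::
    "'o measure \<Rightarrow> 'a measure \<Rightarrow> (nat \<Rightarrow> 'o \<Rightarrow> 'a) \<Rightarrow> nat \<Rightarrow> real \<Rightarrow>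
      ('o \<Rightarrow> real ^ 'd::finite) \<Rightarrow> 'd \<Rightarrow> 'd \<Rightarrow> 'o \<Rightarrow> real" where
  "Z_mix M S X n \<alpha> F i j = (\<lambda>\<omega>. \<Sum>k=1..n.
      diff_op M S X n k (\<lambda>\<omega>. F \<omega> $ i) \<omega> * diff_op_mix M S X n \<alpha> k (\<lambda>\<omega>. F \<omega> $ j) \<omega>)"

text \<open>For integrable \<open>V\<close>, the value is \<open>\<infinity>\<close> exactly when \<open>V\<close> is not square-integrable.\<close>

definition nn_variance :: "'o measure \<Rightarrow> ('o \<Rightarrow> real) \<Rightarrow> ennreal" where
  "nn_variance M V = (\<integral>\<^sup>+\<omega>. ennreal ((V \<omega> - (\<integral>\<omega>'. V \<omega>' \<partial>M))\<^sup>2) \<partial>M)"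

definition sqrt_ennreal :: "ennreal \<Rightarrow> ennreal" where
  "sqrt_ennreal v = (if v = \<infinity> then \<infinity> else ennreal (sqrt (enn2real v)))"

end

theory Submission
  imports Defs
begin

text \<open>
  Along \<open>\<Psi> \<theta> = E (g (sin \<theta> F + cos \<theta> Y))\<close>, with \<open>F\<close> and \<open>Y\<close> independent, the derivative splits into
  a term with \<open>F\<close> and a term with \<open>Y\<close>. Gaussian integration by parts turns the latter into
  \<open>\<Sum> C\<^sub>i\<^sub>j E \<partial>\<^sub>i\<partial>\<^sub>j g\<close>. For the former write \<open>F\<^sub>i = \<Sum>\<^sub>k a\<^sub>k\<close>, where \<open>a\<^sub>k\<close> is the mixed difference at \<open>k\<close>: since
  \<open>a\<^sub>k\<close> is orthogonal to all functions of \<open>(X\<^sub>j)\<^sub>j\<^sub>\<noteq>\<^sub>k\<close>, one may subtract from \<open>\<partial>\<^sub>i g\<close> its value with \<open>F\<close>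
  replaced by the conditional expectation given those variables, and a first-order Taylor expansion produces
  \<open>\<Sum> E (Z\<^sub>i\<^sub>j \<partial>\<^sub>i\<partial>\<^sub>j g)\<close> with a remainder of third order in the differences. Integrating the bound on
  \<open>\<Psi>'\<close> over \<open>[0, \<pi>/2]\<close> gives the first inequality; the second one follows from \<open>E Z\<^sub>i\<^sub>j = \<sigma>\<^sub>i\<^sub>j\<close>.
  Gaussian integration by parts itself uses only the laws of the linear functionals of \<open>Y\<close>: they
  determine the characteristic function, hence the law, of the vector.
\<close>

subsection \<open>Partial derivatives\<close>

text \<open>Only second moments of \<open>F\<close> are available, and \<open>C\<close> may be
  singular. Integrability in the real-valued computations therefore comes from square integrability
  together with the bound on the second derivatives. Third moments live in [0,\<infinity>] and enter
  only through the final estimate of the remainder. There the relevant condition is finiteness of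
  the product of the third-derivative norm and the moment sum, because 0 * \<infinity> = 0 leaves a
  nontrivial claim. A singular \<open>C\<close> leaves \<open>Y\<close> without a joint density, so
  integration by parts is reduced by regression to a single coordinate of positive variance.
  Constants: sin \<theta> cos \<theta> integrates to 1/2 over [0, \<pi>/2], which gives B3. The
  remainder collects 1/2 from Taylor, 1/3 from bounding a product of three numbers by their cubes,
  the count 3 d^2 of these cubes, and 1/3 from integrating sin^2 \<theta> cos \<theta>. The result
  is d^2/6, half of the coefficient claimed in B4.\<close>

lemma has_derivative_partial_deriv:
  fixes \<phi> :: "real ^ 'd::finite \<Rightarrow> real"
  assumes "\<phi> differentiable_on UNIV"
  shows "(\<phi> has_derivative (\<lambda>v. \<Sum>i\<in>UNIV. v $ i * partial_deriv i \<phi> x)) (at x)"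
proof -
  obtain D where D: "(\<phi> has_derivative D) (at x)"
    using assms by (auto simp: differentiable_on_def differentiable_def)
  then have lin: "linear D" by (rule has_derivative_linear)
  have pd: "partial_deriv i \<phi> x = D (axis i 1)" for i
  proof -
    have "((\<lambda>t. x + t *\<^sub>R axis i 1) has_derivative (\<lambda>t. t *\<^sub>R axis i 1)) (at (0::real))"
      by (auto intro!: derivative_eq_intros)
    then have "((\<lambda>t. \<phi> (x + t *\<^sub>R axis i 1)) has_derivative (\<lambda>t. D (t *\<^sub>R axis i 1))) (at (0::real))"
      using has_derivative_compose[of "\<lambda>t. x + t *\<^sub>R axis i 1" "\<lambda>t. t *\<^sub>R axis i 1" "0::real" UNIV \<phi> D] D
      by simp
    also have "(\<lambda>t. D (t *\<^sub>R axis i 1)) = (*) (D (axis i 1))"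
      using lin by (simp add: fun_eq_iff linear_scale)
    finally show ?thesis
      unfolding partial_deriv_def by (intro DERIV_imp_deriv) (simp add: has_field_derivative_def)
  qed
  have "D v = (\<Sum>i\<in>UNIV. v $ i * partial_deriv i \<phi> x)" for v
  proof -
    have "D v = D (\<Sum>i\<in>UNIV. (v $ i) *\<^sub>R axis i 1)"
      by (simp add: basis_expansion[of v, unfolded scalar_mult_eq_scaleR])
    also have "\<dots> = (\<Sum>i\<in>UNIV. v $ i * partial_deriv i \<phi> x)"
      using lin by (simp add: linear_sum linear_scale pd)
    finally show ?thesis .
  qed
  then have "D = (\<lambda>v. \<Sum>i\<in>UNIV. v $ i * partial_deriv i \<phi> x)" by (rule ext)
  with D show ?thesis by simp
qed

lemma Ck_imp_continuous: "Ck k \<phi> \<Longrightarrow> continuous_on UNIV \<phi>"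
  by (cases k) (auto intro: differentiable_imp_continuous_on)

lemma Ck_Suc_imp: "Ck (Suc k) \<phi> \<Longrightarrow> Ck k \<phi>"
proof (induction k arbitrary: \<phi>)
  case 0
  then show ?case by (simp add: differentiable_imp_continuous_on)
next
  case (Suc k)
  then show ?case by (metis Ck.simps(2))
qed

lemma Ck_borel_measurable: "Ck k \<phi> \<Longrightarrow> \<phi> \<in> borel_measurable borel"
  by (intro borel_measurable_continuous_onI Ck_imp_continuous)

lemma Ck_has_derivative:
  assumes "Ck (Suc k) \<phi>"
  shows "(\<phi> has_derivative (\<lambda>v. \<Sum>i\<in>UNIV. v $ i * partial_deriv i \<phi> x)) (at x)"
  using assms by (intro has_derivative_partial_deriv) simp

lemma Ck_has_real_derivative_compose:
  fixes \<phi> :: "real ^ 'd::finite \<Rightarrow> real"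
  assumes "Ck (Suc k) \<phi>" and "(\<gamma> has_vector_derivative v) (at t)"
  shows "((\<lambda>t. \<phi> (\<gamma> t)) has_real_derivative (\<Sum>i\<in>UNIV. v $ i * partial_deriv i \<phi> (\<gamma> t))) (at t)"
proof -
  have "((\<lambda>t. \<phi> (\<gamma> t)) has_derivative
      (\<lambda>h. \<Sum>i\<in>UNIV. (h *\<^sub>R v) $ i * partial_deriv i \<phi> (\<gamma> t))) (at t)"
    by (rule has_derivative_compose[OF assms(2)[unfolded has_vector_derivative_def] Ck_has_derivative[OF assms(1)]])
  also have "(\<lambda>h. \<Sum>i\<in>UNIV. (h *\<^sub>R v) $ i * partial_deriv i \<phi> (\<gamma> t)) =
      (*) (\<Sum>i\<in>UNIV. v $ i * partial_deriv i \<phi> (\<gamma> t))"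
    by (simp add: fun_eq_iff sum_distrib_left mult_ac)
  finally show ?thesis
    by (simp add: has_field_derivative_def)
qed

lemma Ck_line:
  fixes \<phi> :: "real ^ 'd::finite \<Rightarrow> real"
  assumes "Ck (Suc k) \<phi>"
  shows "((\<lambda>t. \<phi> (x + t *\<^sub>R v)) has_real_derivative (\<Sum>i\<in>UNIV. v $ i * partial_deriv i \<phi> (x + t *\<^sub>R v))) (at t)"
  by (rule Ck_has_real_derivative_compose[OF assms]) (auto intro!: derivative_eq_intros simp: has_vector_derivative_def)

lemma Ck_axis:
  fixes \<phi> :: "real ^ 'd::finite \<Rightarrow> real"
  assumes "Ck (Suc k) \<phi>"
  shows "((\<lambda>t. \<phi> (x + t *\<^sub>R axis i 1)) has_real_derivative partial_deriv i \<phi> (x + t *\<^sub>R axis i 1)) (at t)"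
  using Ck_line[OF assms, of x "axis i 1" t]
  by (simp add: axis_def if_distrib[of "\<lambda>c. c * _"] cong: if_cong)

lemma partial_deriv_commute:
  fixes \<phi> :: "real ^ 'd::finite \<Rightarrow> real"
  assumes C: "Ck (Suc (Suc k)) \<phi>"
  shows "partial_deriv i (partial_deriv j \<phi>) = partial_deriv j (partial_deriv i \<phi>)"
proof (rule ext)
  fix x :: "real ^ 'd"
  \<comment> \<open>Apply the mean value theorem twice to the mixed second difference, in either order.\<close>
  define \<Delta> where "\<Delta> a b t = \<phi> (x + t *\<^sub>R a + t *\<^sub>R b) - \<phi> (x + t *\<^sub>R a) - \<phi> (x + t *\<^sub>R b) + \<phi> x" for a b t
  have C1: "Ck (Suc k) (partial_deriv l \<phi>)" for l using C by simp
  have key: "\<exists>s r. 0 < s \<and> s < t \<and> 0 < r \<and> r < t \<and>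
      \<Delta> (axis a 1) (axis b 1) t = t * t * partial_deriv b (partial_deriv a \<phi>) (x + s *\<^sub>R axis a 1 + r *\<^sub>R axis b 1)"
    if t: "0 < t" for a b and t :: real
  proof -
    let ?p = "\<lambda>s. \<phi> ((x + t *\<^sub>R axis b 1) + s *\<^sub>R axis a 1) - \<phi> (x + s *\<^sub>R axis a 1)"
    let ?p' = "\<lambda>s. partial_deriv a \<phi> ((x + t *\<^sub>R axis b 1) + s *\<^sub>R axis a 1) - partial_deriv a \<phi> (x + s *\<^sub>R axis a 1)"
    have "\<And>s. (?p has_real_derivative ?p' s) (at s)"
      by (intro DERIV_diff Ck_axis[OF C])
    from MVT2[OF t, of ?p ?p', OF this] obtain s where s: "0 < s" "s < t" "?p t - ?p 0 = (t - 0) * ?p' s"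
      by blast
    let ?q = "\<lambda>r. partial_deriv a \<phi> ((x + s *\<^sub>R axis a 1) + r *\<^sub>R axis b 1)"
    let ?q' = "\<lambda>r. partial_deriv b (partial_deriv a \<phi>) ((x + s *\<^sub>R axis a 1) + r *\<^sub>R axis b 1)"
    have "\<And>r. (?q has_real_derivative ?q' r) (at r)"
      by (intro Ck_axis[OF C1])
    from MVT2[OF t, of ?q ?q', OF this] obtain r where r: "0 < r" "r < t" "?q t - ?q 0 = (t - 0) * ?q' r"
      by blast
    have "\<Delta> (axis a 1) (axis b 1) t = ?p t - ?p 0"
      by (simp add: \<Delta>_def algebra_simps)
    also have "\<dots> = t * (?q t - ?q 0)"
      using s(3) by (simp add: algebra_simps)
    also have "\<dots> = t * (t * ?q' r)"
      using r(3) by simp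
    finally show ?thesis using s r by (intro exI[of _ s] exI[of _ r]) simp
  qed
  have \<Delta>_sym: "\<Delta> a b t = \<Delta> b a t" for a b t
    by (simp add: \<Delta>_def algebra_simps)
  have lim: "((\<lambda>t. \<Delta> (axis a 1) (axis b 1) t / (t * t)) \<longlongrightarrow> partial_deriv b (partial_deriv a \<phi>) x) (at_right 0)" for a b
  proof -
    let ?f = "partial_deriv b (partial_deriv a \<phi>)"
    have cont: "isCont ?f x"
      using Ck_imp_continuous[of k ?f] C1[of a] by (simp add: continuous_on_eq_continuous_at)
    show ?thesis
    proof (rule tendstoI)
      fix e :: real assume "0 < e"
      with cont obtain d where d: "0 < d" "\<And>y. dist y x < d \<Longrightarrow> dist (?f y) (?f x) < e"
        unfolding continuous_at_eps_delta by blast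
      have "dist (\<Delta> (axis a 1) (axis b 1) t / (t * t)) (?f x) < e" if t: "0 < t" "t < d / 2" for t
      proof -
        obtain s r where sr: "0 < s" "s < t" "0 < r" "r < t"
          "\<Delta> (axis a 1) (axis b 1) t = t * t * ?f (x + s *\<^sub>R axis a 1 + r *\<^sub>R axis b 1)"
          using key[OF t(1), of a b] by auto
        have "dist (x + s *\<^sub>R axis a 1 + r *\<^sub>R axis b 1) x = norm (s *\<^sub>R axis a 1 + r *\<^sub>R axis b (1::real))"
          by (simp add: dist_norm)
        also have "\<dots> \<le> s + r"
          using sr by (intro order_trans[OF norm_triangle_ineq]) (simp add: norm_axis_1)
        finally have "dist (x + s *\<^sub>R axis a 1 + r *\<^sub>R axis b 1) x < d"
          using sr t by linarith
        from d(2)[OF this] show ?thesis using sr(5) t by simp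
      qed
      then show "\<forall>\<^sub>F t in at_right 0. dist (\<Delta> (axis a 1) (axis b 1) t / (t * t)) (?f x) < e"
        using d(1) by (auto simp: eventually_at_right_field intro!: exI[of _ "d / 2"])
    qed
  qed
  show "partial_deriv i (partial_deriv j \<phi>) x = partial_deriv j (partial_deriv i \<phi>) x"
    using tendsto_unique[OF _ lim[of i j]] lim[of j i] by (simp add: \<Delta>_sym[of "axis j 1" "axis i 1"])
qed

lemma Ck_foldr_partial_deriv: "Ck (length is + k) \<phi> \<Longrightarrow> Ck k (foldr partial_deriv is \<phi>)"
proof (induction "is" arbitrary: k)
  case (Cons i "is")
  from Cons.IH[of "Suc k"] Cons.prems show ?case by simp
qed simp

text \<open>\<open>insort\<close> moves \<open>i\<close> past smaller indices by exchanging adjacent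
  partial derivatives. The tail behind the exchanged pair uses up the other derivatives and leaves
  order two, which the exchange requires.\<close>

lemma foldr_partial_deriv_insort:
  fixes \<phi> :: "real ^ 'd::{finite,linorder} \<Rightarrow> real"
  assumes "Ck (Suc (length is)) \<phi>"
  shows "foldr partial_deriv (insort i is) \<phi> = foldr partial_deriv (i # is) \<phi>"
  using assms
proof (induction "is")
  case (Cons j "is")
  have "Ck (Suc (Suc 0)) (foldr partial_deriv is \<phi>)"
    using Cons.prems by (intro Ck_foldr_partial_deriv) simp
  moreover have "Ck (Suc (length is)) \<phi>"
    using Ck_Suc_imp[OF Cons.prems] by simp
  ultimately show ?case
    using Cons.IH partial_deriv_commute[of 0 "foldr partial_deriv is \<phi>" i j] by simp
qed simp

lemma foldr_partial_deriv_sort: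
  fixes \<phi> :: "real ^ 'd::{finite,linorder} \<Rightarrow> real"
  assumes "Ck (length is) \<phi>"
  shows "foldr partial_deriv (sort is) \<phi> = foldr partial_deriv is \<phi>"
  using assms
proof (induction "is")
  case (Cons j "is")
  then show ?case
    using Ck_Suc_imp[of "length is" \<phi>] foldr_partial_deriv_insort[of "sort is" \<phi> j] by simp
qed simp

text \<open>The norm ranges over sorted multi-indices only, whereas the Taylor estimates meet
  derivatives in every order; sorting the list bridges the two.\<close>

lemma partial_deriv_le_deriv_sup_norm:
  fixes \<phi> :: "real ^ 'd::{finite,linorder} \<Rightarrow> real"
  assumes "Ck (length is) \<phi>"
  shows "ennreal \<bar>foldr partial_deriv is \<phi> x\<bar> \<le> deriv_sup_norm (length is) \<phi>"
proof -
  let ?L = "{js :: 'd list. length js = length is \<and> sorted js}"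
  have "finite ?L"
    by (rule finite_subset[OF _ finite_lists_length_eq[of UNIV "length is"]]) auto
  moreover have "sort is \<in> ?L" by simp
  ultimately have "(SUP x. ennreal \<bar>foldr partial_deriv (sort is) \<phi> x\<bar>) \<le> deriv_sup_norm (length is) \<phi>"
    unfolding deriv_sup_norm_def by (intro Max_ge) auto
  moreover have "ennreal \<bar>foldr partial_deriv is \<phi> x\<bar> \<le> (SUP x. ennreal \<bar>foldr partial_deriv (sort is) \<phi> x\<bar>)"
    unfolding foldr_partial_deriv_sort[OF assms] by (rule SUP_upper) simp
  ultimately show ?thesis by (rule order_trans[rotated])
qed

section \<open>Mean value and Taylor estimates\<close>

lemma abs_increment_le:
  fixes \<phi> :: "real ^ 'd::finite \<Rightarrow> real"
  assumes C: "Ck (Suc k) \<phi>" and L: "\<And>i x. \<bar>partial_deriv i \<phi> x\<bar> \<le> L"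
  shows "\<bar>\<phi> x - \<phi> y\<bar> \<le> L * (\<Sum>i\<in>UNIV. \<bar>x $ i - y $ i\<bar>)"
proof -
  obtain t where t: "\<phi> (y + 1 *\<^sub>R (x - y)) - \<phi> (y + 0 *\<^sub>R (x - y)) =
      (1 - 0) * (\<Sum>i\<in>UNIV. (x - y) $ i * partial_deriv i \<phi> (y + t *\<^sub>R (x - y)))"
    using MVT2[OF zero_less_one, of "\<lambda>t. \<phi> (y + t *\<^sub>R (x - y))", OF Ck_line[OF C]] by blast
  have "\<bar>\<phi> x - \<phi> y\<bar> = \<bar>\<Sum>i\<in>UNIV. (x - y) $ i * partial_deriv i \<phi> (y + t *\<^sub>R (x - y))\<bar>"
    using t by simp
  also have "\<dots> \<le> (\<Sum>i\<in>UNIV. \<bar>x $ i - y $ i\<bar> * L)"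
    by (intro order_trans[OF sum_abs] sum_mono) (simp add: abs_mult mult_left_mono L)
  finally show ?thesis by (simp add: sum_distrib_left mult.commute)
qed

text \<open>The expansion point is \<open>x\<close> and the displacement is \<open>- v\<close>
  because later \<open>x\<close> contains \<open>F\<close> and \<open>x - v\<close> contains its
  conditional expectation: the second derivatives that multiply \<open>Z\<close> have to be taken at
  \<open>F\<close>.\<close>

lemma first_order_Taylor_bound:
  fixes \<phi> :: "real ^ 'd::finite \<Rightarrow> real"
  assumes C: "Ck (Suc (Suc k)) \<phi>" and L: "\<And>i j x. \<bar>partial_deriv i (partial_deriv j \<phi>) x\<bar> \<le> L"
  shows "\<bar>\<phi> (x - v) - \<phi> x + (\<Sum>i\<in>UNIV. v $ i * partial_deriv i \<phi> x)\<bar>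
    \<le> L / 2 * (\<Sum>i\<in>UNIV. \<Sum>j\<in>UNIV. \<bar>v $ i\<bar> * \<bar>v $ j\<bar>)"
proof -
  define p where "p t = \<phi> (x + t *\<^sub>R (- v))" for t
  define p' where "p' t = (\<Sum>i\<in>UNIV. (- v) $ i * partial_deriv i \<phi> (x + t *\<^sub>R (- v)))" for t
  define p'' where "p'' t = (\<Sum>i\<in>UNIV. (- v) $ i * (\<Sum>j\<in>UNIV. (- v) $ j * partial_deriv j (partial_deriv i \<phi>) (x + t *\<^sub>R (- v))))" for t
  have C1: "Ck (Suc k) (partial_deriv i \<phi>)" for i using C by simp
  have p: "(p has_real_derivative p' t) (at t)" for t
    unfolding p_def p'_def by (rule Ck_line[OF C])
  have p': "(p' has_real_derivative p'' t) (at t)" for t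
    unfolding p'_def p''_def by (intro DERIV_sum DERIV_cmult Ck_line[OF C1])
  \<comment> \<open>\<open>Maclaurin\<close> takes all derivatives as one sequence; orders 0 to 2
    are the ones that occur.\<close>
  define D where "D m = (if m = 0 then p else if m = Suc 0 then p' else p'')" for m :: nat
  have "\<forall>m t. m < 2 \<and> 0 \<le> t \<and> t \<le> 1 \<longrightarrow> (D m has_real_derivative D (Suc m) t) (at t)"
    using p p' by (auto simp: D_def less_Suc_eq numeral_2_eq_2)
  then obtain t where "p 1 = (\<Sum>m<2. D m 0 / fact m * 1 ^ m) + D 2 t / fact 2 * 1 ^ 2"
    using Maclaurin[of 1 2 D p] by (auto simp: D_def)
  then have "p 1 - p 0 - p' 0 = p'' t / 2"
    by (simp add: D_def numeral_2_eq_2)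
  moreover have "p 1 - p 0 - p' 0 = \<phi> (x - v) - \<phi> x + (\<Sum>i\<in>UNIV. v $ i * partial_deriv i \<phi> x)"
    by (simp add: p_def p'_def sum_negf)
  moreover have "\<bar>p'' t\<bar> \<le> L * (\<Sum>i\<in>UNIV. \<Sum>j\<in>UNIV. \<bar>v $ i\<bar> * \<bar>v $ j\<bar>)"
    unfolding p''_def sum_distrib_left
    by (intro order_trans[OF sum_abs] sum_mono)
       (simp add: abs_mult mult.commute[of L] mult.assoc mult_left_mono L)
  ultimately show ?thesis by linarith
qed

subsection \<open>Uniqueness of multivariate characteristic functions\<close>

text \<open>Dividing a weight by its total mass makes it a probability density, and the hypothesis
  becomes equality of two characteristic functions on the line. A weight of mass zero cannot be
  normalised, but then it vanishes almost surely.\<close>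

lemma weighted_Levy_uniqueness:
  fixes X :: "'a \<Rightarrow> real" and X' :: "'b \<Rightarrow> real"
  assumes "prob_space M" "prob_space N"
    and X [measurable]: "X \<in> borel_measurable M" "X' \<in> borel_measurable N"
    and w [measurable]: "w \<in> borel_measurable M" "w' \<in> borel_measurable N"
    and w_nonneg: "\<And>x. 0 \<le> w x" "\<And>x. 0 \<le> w' x" and w_le: "\<And>x. w x \<le> K" "\<And>x. w' x \<le> K"
    and eq: "\<And>s. (CLINT x|M. complex_of_real (w x) * iexp (s * X x)) = (CLINT x|N. complex_of_real (w' x) * iexp (s * X' x))"
    and B [measurable]: "B \<in> sets borel"
  shows "(\<integral>x. w x * indicator B (X x) \<partial>M) = (\<integral>x. w' x * indicator B (X' x) \<partial>N)"
proof -
  define c where "c = (\<integral>x. w x \<partial>M)"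
  have wint: "integrable M w" if "prob_space M" "w \<in> borel_measurable M" "\<And>x. 0 \<le> w x" "\<And>x. w x \<le> K"
    for M :: "'c measure" and w :: "'c \<Rightarrow> real"
  proof -
    interpret prob_space M by fact
    show ?thesis using that by (intro integrable_const_bound[where B=K]) auto
  qed
  have i: "integrable M w" "integrable N w'"
    using wint assms by blast+
  \<comment> \<open>At \<open>s = 0\<close> the transforms are the total masses, so both weights
    share one normalising constant.\<close>
  have c': "c = (\<integral>x. w' x \<partial>N)"
    using eq[of 0] by (simp add: c_def)
  have null: "(\<integral>x. w x * indicator B (X x) \<partial>M) = 0"
    if "integrable M w" "\<And>x. 0 \<le> w x" "(\<integral>x. w x \<partial>M) = 0" for M :: "'c measure" and w X :: "'c \<Rightarrow> real"
  proof -
    have "AE x in M. w x = 0"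
      using that integral_nonneg_eq_0_iff_AE[of M w] by simp
    then show ?thesis by (intro integral_eq_zero_AE) auto
  qed
  show ?thesis
  proof (cases "c = 0")
    case True
    then show ?thesis
      using null[OF i(1) w_nonneg(1)] null[OF i(2) w_nonneg(2)] c' c_def by metis
  next
    case False
    then have c: "0 < c"
      unfolding c_def using Bochner_Integration.integral_nonneg[of M w] w_nonneg by (simp add: less_le)
    have gen: "real_distribution (distr (density M (\<lambda>x. ennreal (w x / c))) borel X) \<and>
        char (distr (density M (\<lambda>x. ennreal (w x / c))) borel X) s = (CLINT x|M. complex_of_real (w x) * iexp (s * X x)) / complex_of_real c \<and>
        measure (distr (density M (\<lambda>x. ennreal (w x / c))) borel X) B = (\<integral>x. w x * indicator B (X x) \<partial>M) / c"
      if "prob_space M" and [measurable]: "X \<in> borel_measurable M" "w \<in> borel_measurable M"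
        and "\<And>x. 0 \<le> w x" "integrable M w" "(\<integral>x. w x \<partial>M) = c"
      for M :: "'c measure" and w X :: "'c \<Rightarrow> real" and s
    proof (intro conjI)
      let ?D = "density M (\<lambda>x. ennreal (w x / c))"
      have nn: "0 \<le> w x / c" for x using that(4) c by simp
      have "emeasure ?D (space ?D) = (\<integral>\<^sup>+x. ennreal (w x / c) \<partial>M)"
        by (simp add: emeasure_density cong: nn_integral_cong)
      also have "\<dots> = ennreal (\<integral>x. w x / c \<partial>M)"
        using that(5) nn by (intro nn_integral_eq_integral) auto
      also have "\<dots> = 1" using that(6) c by simp
      finally interpret D: prob_space ?D by (rule prob_spaceI)
      interpret E: prob_space "distr ?D borel X" by (rule D.prob_space_distr) simp
      show "real_distribution (distr ?D borel X)"
        by unfold_locales auto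
      have "char (distr ?D borel X) s = (CLINT x|?D. iexp (s * X x))"
        unfolding char_def by (subst integral_distr) auto
      also have "\<dots> = (CLINT x|M. (w x / c) *\<^sub>R iexp (s * X x))"
        using nn by (subst integral_density) auto
      also have "\<dots> = (CLINT x|M. complex_of_real (w x) * iexp (s * X x) / complex_of_real c)"
        by (intro Bochner_Integration.integral_cong) (auto simp: scaleR_conv_of_real)
      finally show "char (distr ?D borel X) s = (CLINT x|M. complex_of_real (w x) * iexp (s * X x)) / complex_of_real c"
        by simp
      have "measure (distr ?D borel X) B = (\<integral>x. indicator B x \<partial>distr ?D borel X)"
        by simp
      also have "\<dots> = (\<integral>x. indicator B (X x) \<partial>?D)"
        by (subst integral_distr) auto
      also have "\<dots> = (\<integral>x. (w x / c) *\<^sub>R indicator B (X x) \<partial>M)"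
        using nn by (subst integral_density) auto
      also have "\<dots> = (\<integral>x. w x * indicator B (X x) / c \<partial>M)"
        by simp
      finally show "measure (distr ?D borel X) B = (\<integral>x. w x * indicator B (X x) \<partial>M) / c"
        by simp
    qed
    note gM = gen[OF assms(1) X(1) w(1) w_nonneg(1) i(1) c_def[symmetric]]
    note gN = gen[OF assms(2) X(2) w(2) w_nonneg(2) i(2) c'[symmetric]]
    have "distr (density M (\<lambda>x. ennreal (w x / c))) borel X = distr (density N (\<lambda>x. ennreal (w' x / c))) borel X'"
      using gM gN eq by (intro Levy_uniqueness) (auto simp: fun_eq_iff)
    then show ?thesis using gM gN c by simp
  qed
qed

text \<open>Weighting by \<open>1 + cos (u \<bullet> V + b) \<ge> 0\<close> turns the complex exponential into a density, so that
  the one-dimensional uniqueness theorem can be applied one coordinate at a time.\<close>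

lemma char_unique_boxes:
  fixes V :: "'a \<Rightarrow> real ^ 'd::finite" and W :: "'b \<Rightarrow> real ^ 'd"
  assumes "prob_space M" "prob_space N"
    and V [measurable]: "V \<in> borel_measurable M" and W [measurable]: "W \<in> borel_measurable N"
    and eq: "\<And>u. (CLINT \<omega>|M. iexp (u \<bullet> V \<omega>)) = (CLINT \<omega>|N. iexp (u \<bullet> W \<omega>))"
    and A [measurable]: "\<And>i. A i \<in> sets borel" and "finite I"
  shows "(CLINT \<omega>|M. complex_of_real (\<Prod>i\<in>I. indicator (A i) (V \<omega> $ i)) * iexp (u \<bullet> V \<omega>)) =
    (CLINT \<omega>|N. complex_of_real (\<Prod>i\<in>I. indicator (A i) (W \<omega> $ i)) * iexp (u \<bullet> W \<omega>))"
  using \<open>finite I\<close>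
proof (induction I arbitrary: u)
  case empty
  then show ?case using eq by simp
next
  case (insert j I)
  interpret M: prob_space M by fact
  interpret N: prob_space N by fact
  define q :: "real ^ 'd \<Rightarrow> real" where "q v = (\<Prod>i\<in>I. indicator (A i) (v $ i))" for v
  have [measurable]: "(\<lambda>\<omega>. V \<omega> $ i) \<in> borel_measurable M" "(\<lambda>\<omega>. W \<omega> $ i) \<in> borel_measurable N" for i
    by (rule measurable_compose[OF V borel_measurable_nth], rule measurable_compose[OF W borel_measurable_nth])
  have [measurable]: "q \<in> borel_measurable borel" unfolding q_def by measurable
  have q: "0 \<le> q v" "q v \<le> 1" for v
    unfolding q_def by (auto intro!: prod_nonneg prod_le_1)
  have qe: "norm (complex_of_real (q v) * iexp a) \<le> 1" for v a
    using q by (simp add: norm_mult)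
  have IH: "(CLINT \<omega>|M. complex_of_real (q (V \<omega>)) * iexp (u \<bullet> V \<omega>)) = (CLINT \<omega>|N. complex_of_real (q (W \<omega>)) * iexp (u \<bullet> W \<omega>))" for u
    using insert.IH by (simp add: q_def)
  \<comment> \<open>Writing the cosine as half a sum of exponentials makes the weighted transform a
    combination of three unweighted ones, at the frequencies s e_j, s e_j + u and s e_j - u. The
    induction hypothesis holds at every frequency and covers all three.\<close>
  have expand: "complex_of_real (q v * (1 + cos (u \<bullet> v + b))) * iexp (s * v $ j) =
      complex_of_real (q v) * iexp ((s *\<^sub>R axis j 1) \<bullet> v)
      + iexp b / 2 * (complex_of_real (q v) * iexp ((s *\<^sub>R axis j 1 + u) \<bullet> v))
      + iexp (- b) / 2 * (complex_of_real (q v) * iexp ((s *\<^sub>R axis j 1 - u) \<bullet> v))" for v u b s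
  proof -
    have "complex_of_real (cos (u \<bullet> v + b)) = (iexp (u \<bullet> v + b) + iexp (- (u \<bullet> v + b))) / 2"
      unfolding cos_of_real[symmetric] cos_exp_eq by (simp add: algebra_simps)
    moreover have "iexp (u \<bullet> v + b) = iexp b * iexp (u \<bullet> v)" "iexp (- (u \<bullet> v + b)) = iexp (- b) * iexp (- (u \<bullet> v))"
      unfolding exp_add[symmetric] by (rule arg_cong[of _ _ exp], simp add: algebra_simps)+
    ultimately have "complex_of_real (cos (u \<bullet> v + b)) = iexp b * iexp (u \<bullet> v) / 2 + iexp (- b) * iexp (- (u \<bullet> v)) / 2"
      by (simp only: add_divide_distrib)
    moreover have "iexp ((s *\<^sub>R axis j 1 + u) \<bullet> v) = iexp (s * v $ j) * iexp (u \<bullet> v)"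
      "iexp ((s *\<^sub>R axis j 1 - u) \<bullet> v) = iexp (s * v $ j) * iexp (- (u \<bullet> v))"
      "iexp ((s *\<^sub>R axis j 1) \<bullet> v) = iexp (s * v $ j)"
      by (simp_all add: inner_axis' inner_add_left inner_diff_left exp_add[symmetric] algebra_simps)
    ultimately show ?thesis
      by (simp only: of_real_mult of_real_add of_real_1) (simp add: algebra_simps)
  qed
  have intq: "integrable M (\<lambda>\<omega>. complex_of_real (q (V \<omega>)) * iexp (u \<bullet> V \<omega>))"
    "integrable N (\<lambda>\<omega>. complex_of_real (q (W \<omega>)) * iexp (u \<bullet> W \<omega>))" for u
    by (intro M.integrable_const_bound[where B=1] N.integrable_const_bound[where B=1]; use qe in simp)+
  have wt: "(CLINT \<omega>|M. complex_of_real (q (V \<omega>) * (1 + cos (u \<bullet> V \<omega> + b))) * iexp (s * V \<omega> $ j)) =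
     (CLINT \<omega>|N. complex_of_real (q (W \<omega>) * (1 + cos (u \<bullet> W \<omega> + b))) * iexp (s * W \<omega> $ j))" for b s
  proof -
    define e where "e u v = complex_of_real (q v) * iexp (u \<bullet> v)" for u v
    show ?thesis
      unfolding expand e_def[symmetric]
      using intq[folded e_def] IH[folded e_def] by simp
  qed
  have w: "(\<integral>\<omega>. q (V \<omega>) * (1 + cos (u \<bullet> V \<omega> + b)) * indicator (A j) (V \<omega> $ j) \<partial>M) =
     (\<integral>\<omega>. q (W \<omega>) * (1 + cos (u \<bullet> W \<omega> + b)) * indicator (A j) (W \<omega> $ j) \<partial>N)" for b
  proof (rule weighted_Levy_uniqueness[OF assms(1,2) _ _ _ _ _ _ _ _ wt, where K=2])
    have bnd: "0 \<le> q v * (1 + cos a)" "q v * (1 + cos a) \<le> 2" for v a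
    proof -
      have "0 \<le> 1 + cos a" "1 + cos a \<le> 2"
        using cos_ge_minus_one[of a] cos_le_one[of a] by linarith+
      then show "0 \<le> q v * (1 + cos a)" "q v * (1 + cos a) \<le> 2"
        using q mult_mono[of "q v" 1 "1 + cos a" 2] by auto
    qed
    show "0 \<le> q (V \<omega>) * (1 + cos (u \<bullet> V \<omega> + b))" "q (V \<omega>) * (1 + cos (u \<bullet> V \<omega> + b)) \<le> 2" for \<omega>
      by (rule bnd)+
    show "0 \<le> q (W \<omega>) * (1 + cos (u \<bullet> W \<omega> + b))" "q (W \<omega>) * (1 + cos (u \<bullet> W \<omega> + b)) \<le> 2" for \<omega>
      by (rule bnd)+
  qed auto
  have IH0: "(CLINT \<omega>|M. complex_of_real (q (V \<omega>)) * iexp (s * V \<omega> $ j)) = (CLINT \<omega>|N. complex_of_real (q (W \<omega>)) * iexp (s * W \<omega> $ j))" for s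
    using IH[of "s *\<^sub>R axis j 1"] by (simp add: inner_axis')
  \<comment> \<open>Subtracting the weight 1 from the weight 1 + cos isolates the cosine, which is
    signed and so not itself a density.\<close>
  have w0: "(\<integral>\<omega>. q (V \<omega>) * indicator (A j) (V \<omega> $ j) \<partial>M) = (\<integral>\<omega>. q (W \<omega>) * indicator (A j) (W \<omega> $ j) \<partial>N)"
    by (rule weighted_Levy_uniqueness[OF assms(1,2) _ _ _ _ _ _ _ _ IH0, where K=1]) (auto simp: q)
  have bnd: "\<bar>q v * c * indicator (A j) (v $ j)\<bar> \<le> 1" if "\<bar>c\<bar> \<le> 1" for v c
    using q[of v] that mult_mono[of "q v" 1 "\<bar>c\<bar>" 1] by (auto simp: indicator_def abs_mult)
  have i1: "integrable M (\<lambda>\<omega>. q (V \<omega>) * cos (u \<bullet> V \<omega> + b) * indicator (A j) (V \<omega> $ j))"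
    "integrable N (\<lambda>\<omega>. q (W \<omega>) * cos (u \<bullet> W \<omega> + b) * indicator (A j) (W \<omega> $ j))"
    "integrable M (\<lambda>\<omega>. q (V \<omega>) * indicator (A j) (V \<omega> $ j))"
    "integrable N (\<lambda>\<omega>. q (W \<omega>) * indicator (A j) (W \<omega> $ j))" for b
    using bnd[of "cos _"] bnd[of 1]
    by (auto intro!: M.integrable_const_bound[where B=1] N.integrable_const_bound[where B=1])
  have wc: "(\<integral>\<omega>. q (V \<omega>) * cos (u \<bullet> V \<omega> + b) * indicator (A j) (V \<omega> $ j) \<partial>M) =
     (\<integral>\<omega>. q (W \<omega>) * cos (u \<bullet> W \<omega> + b) * indicator (A j) (W \<omega> $ j) \<partial>N)" for b
    using w[of b] w0 i1 by (simp add: distrib_left distrib_right)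
  \<comment> \<open>Phase 0 yields the real part, and phase -\<pi>/2 turns the cosine into the sine
    of the imaginary part; for this reason the phase \<open>b\<close> was kept free.\<close>
  have split: "complex_of_real (\<Prod>i\<in>insert j I. indicator (A i) (v $ i)) * iexp (u \<bullet> v) =
     complex_of_real (q v * cos (u \<bullet> v + 0) * indicator (A j) (v $ j)) +
     \<i> * complex_of_real (q v * cos (u \<bullet> v + (- pi / 2)) * indicator (A j) (v $ j))" for v
  proof -
    have "cos (a - pi / 2) = sin a" for a :: real by (simp add: cos_diff)
    moreover have "(\<Prod>i\<in>insert j I. indicator (A i) (v $ i)) = indicator (A j) (v $ j) * q v"
      using insert.hyps by (simp add: q_def)
    ultimately show ?thesis
      by (simp only: cis_conv_exp[symmetric] complex_eq_iff) simp
  qed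
  have complexify: "(CLINT \<omega>|M. complex_of_real (f \<omega>) + \<i> * complex_of_real (g \<omega>)) =
      complex_of_real (\<integral>\<omega>. f \<omega> \<partial>M) + \<i> * complex_of_real (\<integral>\<omega>. g \<omega> \<partial>M)"
    if "integrable M f" "integrable M g" for M :: "'c measure" and f g :: "'c \<Rightarrow> real"
    using that by (simp add: integral_complex_of_real)
  show ?case
    unfolding split complexify[OF i1(1) i1(1)] complexify[OF i1(2) i1(2)] wc ..
qed

text \<open>Closed lower orthants form an intersection-stable generator of the Borel sets, and the
  indicator of an orthant is a product of coordinate indicators. Hence
  \<open>char_unique_boxes\<close> at frequency 0 compares the two laws on a generator.\<close>

theorem char_unique_vec:
  fixes V :: "'a \<Rightarrow> real ^ 'd::finite" and W :: "'b \<Rightarrow> real ^ 'd"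
  assumes "prob_space M" "prob_space N"
    and V [measurable]: "V \<in> borel_measurable M" and W [measurable]: "W \<in> borel_measurable N"
    and eq: "\<And>u. (CLINT \<omega>|M. iexp (u \<bullet> V \<omega>)) = (CLINT \<omega>|N. iexp (u \<bullet> W \<omega>))"
  shows "distr M borel V = distr N borel W"
proof -
  interpret M: prob_space M by fact
  interpret N: prob_space N by fact
  interpret MV: prob_space "distr M borel V" by (rule M.prob_space_distr) simp
  interpret NW: prob_space "distr N borel W" by (rule N.prob_space_distr) simp
  show ?thesis
  proof (rule measure_eqI_generator_eq[where \<Omega>=UNIV and E="range (\<lambda>a. {..a})" and A="\<lambda>n. {..\<chi> i. real n}"])
    show "Int_stable (range (\<lambda>a::real ^ 'd. {..a}))"
    proof (rule Int_stableI)
      fix S T :: "(real ^ 'd) set" assume "S \<in> range atMost" "T \<in> range atMost"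
      then obtain a b where "S = {..a}" "T = {..b}" by auto
      then have "S \<inter> T = {..\<chi> i. min (a $ i) (b $ i)}" by (auto simp: less_eq_vec_def)
      then show "S \<inter> T \<in> range atMost" by blast
    qed
    show "sets (distr M borel V) = sigma_sets UNIV (range atMost)" "sets (distr N borel W) = sigma_sets UNIV (range atMost)"
      by (simp_all add: borel_eq_atMost)
    show "(\<Union>n. {..\<chi> i. real n}) = (UNIV :: (real ^ 'd) set)"
    proof -
      have "\<exists>n. v \<le> (\<chi> i. real n)" for v :: "real ^ 'd"
      proof -
        obtain n where "Max (range (($) v)) \<le> real n" using real_arch_simple by blast
        then have "v $ i \<le> real n" for i using Max_ge[of "range (($) v)" "v $ i"] by simp
        then show ?thesis by (auto simp: less_eq_vec_def)
      qed
      then show ?thesis by auto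
    qed
    fix S :: "(real ^ 'd) set" assume "S \<in> range atMost"
    then obtain a where S: "S = {..a}" by auto
    have ind: "complex_of_real (\<Prod>i\<in>UNIV. indicator {..a $ i} (v $ i)) * iexp (0 \<bullet> v) = complex_of_real (indicator S v)" for v
      by (auto simp: S less_eq_vec_def indicator_def)
    have "(\<integral>\<omega>. indicator S (V \<omega>) \<partial>M) = (\<integral>\<omega>. indicator S (W \<omega>) \<partial>N :: real)"
      using char_unique_boxes[OF assms(1-4) eq, of "\<lambda>i. {..a $ i}" UNIV 0] unfolding ind by simp
    moreover have Sm [measurable]: "S \<in> sets borel" by (simp add: S)
    moreover have "(\<integral>\<omega>. indicator S (V \<omega>) \<partial>M) = measure (distr M borel V) S"
    proof -
      have "measure (distr M borel V) S = (\<integral>x. indicator S x \<partial>distr M borel V)" by simp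
      also have "\<dots> = (\<integral>\<omega>. indicator S (V \<omega>) \<partial>M)" by (subst integral_distr) auto
      finally show ?thesis by simp
    qed
    moreover have "(\<integral>\<omega>. indicator S (W \<omega>) \<partial>N) = measure (distr N borel W) S"
    proof -
      have "measure (distr N borel W) S = (\<integral>x. indicator S x \<partial>distr N borel W)" by simp
      also have "\<dots> = (\<integral>\<omega>. indicator S (W \<omega>) \<partial>N)" by (subst integral_distr) auto
      finally show ?thesis by simp
    qed
    ultimately show "emeasure (distr M borel V) S = emeasure (distr N borel W) S"
      by (simp add: MV.emeasure_eq_measure NW.emeasure_eq_measure)
  qed (auto simp: MV.emeasure_eq_measure)
qed

subsection \<open>Square-integrable variables\<close>

definition square_integrable :: "'a measure \<Rightarrow> ('a \<Rightarrow> real) \<Rightarrow> bool" where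
  "square_integrable M U \<longleftrightarrow> U \<in> borel_measurable M \<and> integrable M (\<lambda>x. (U x)\<^sup>2)"

lemma square_integrable_measurable: "square_integrable M U \<Longrightarrow> U \<in> borel_measurable M"
  by (simp add: square_integrable_def)

lemma square_integrable_mult:
  assumes "square_integrable M U" "square_integrable M V"
  shows "integrable M (\<lambda>x. U x * V x)"
proof (rule Bochner_Integration.integrable_bound)
  show "integrable M (\<lambda>x. (U x)\<^sup>2 + (V x)\<^sup>2)"
    using assms by (auto simp: square_integrable_def)
  have "\<bar>a * b\<bar> \<le> a\<^sup>2 + b\<^sup>2" for a b :: real
  proof -
    have "0 \<le> (\<bar>a\<bar> - \<bar>b\<bar>)\<^sup>2" by simp
    then have "2 * \<bar>a * b\<bar> \<le> a\<^sup>2 + b\<^sup>2" by (simp add: power2_diff abs_mult)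
    moreover have "0 \<le> a\<^sup>2 + b\<^sup>2" by simp
    ultimately show ?thesis by linarith
  qed
  then show "AE x in M. norm (U x * V x) \<le> norm ((U x)\<^sup>2 + (V x)\<^sup>2)"
    by simp
qed (use assms in \<open>auto simp: square_integrable_def\<close>)

lemma square_integrable_add:
  assumes "square_integrable M U" "square_integrable M V"
  shows "square_integrable M (\<lambda>x. U x + V x)"
  using square_integrable_mult[OF assms] assms
  by (auto simp: square_integrable_def power2_sum mult.assoc)

lemma square_integrable_cmult:
  "square_integrable M U \<Longrightarrow> square_integrable M (\<lambda>x. c * U x)"
  by (auto simp: square_integrable_def power_mult_distrib)

lemma square_integrable_diff:
  assumes "square_integrable M U" "square_integrable M V"
  shows "square_integrable M (\<lambda>x. U x - V x)"
  using square_integrable_add[OF assms(1) square_integrable_cmult[OF assms(2), of "- 1"]] by simp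

lemma square_integrable_const: "finite_measure M \<Longrightarrow> square_integrable M (\<lambda>_. c)"
  by (simp add: square_integrable_def finite_measure.integrable_const)

lemma square_integrable_sum:
  assumes "finite_measure M" "\<And>i. i \<in> I \<Longrightarrow> square_integrable M (U i)"
  shows "square_integrable M (\<lambda>x. \<Sum>i\<in>I. U i x)"
  using assms(2)
  by (induction I rule: infinite_finite_induct) (auto intro: square_integrable_add square_integrable_const assms(1))

lemma square_integrable_bound:
  assumes "square_integrable M V" "U \<in> borel_measurable M" "AE x in M. \<bar>U x\<bar> \<le> \<bar>V x\<bar>"
  shows "square_integrable M U"
  unfolding square_integrable_def
proof
  show "integrable M (\<lambda>x. (U x)\<^sup>2)"
    using assms(3)
    by (rule Bochner_Integration.integrable_bound[of M "\<lambda>x. (V x)\<^sup>2", rotated 2, OF AE_mp])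
       (use assms in \<open>auto simp: square_integrable_def abs_le_square_iff\<close>)
qed fact

lemma square_integrable_abs:
  "square_integrable M U \<Longrightarrow> square_integrable M (\<lambda>x. \<bar>U x\<bar>)"
  by (rule square_integrable_bound) (auto dest: square_integrable_measurable)

lemma square_integrable_integrable:
  assumes "finite_measure M" "square_integrable M U"
  shows "integrable M U"
  using square_integrable_mult[OF assms(2) square_integrable_const[OF assms(1), of 1]] by simp

text \<open>Bounded partial derivatives force at most linear growth, and a linear bound in the
  coordinates of \<open>V\<close> is square integrable.\<close>

lemma square_integrable_Ck:
  fixes \<phi> :: "real ^ 'd::finite \<Rightarrow> real"
  assumes "finite_measure M" and C: "Ck (Suc k) \<phi>" and L: "\<And>i x. \<bar>partial_deriv i \<phi> x\<bar> \<le> L"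
    and V: "V \<in> borel_measurable M" "\<And>i. square_integrable M (\<lambda>\<omega>. V \<omega> $ i)"
  shows "square_integrable M (\<lambda>\<omega>. \<phi> (V \<omega>))"
proof (rule square_integrable_bound)
  show "square_integrable M (\<lambda>\<omega>. \<bar>\<phi> 0\<bar> + L * (\<Sum>i\<in>UNIV. \<bar>V \<omega> $ i\<bar>))"
    by (intro square_integrable_add square_integrable_cmult square_integrable_sum square_integrable_const
          square_integrable_abs assms)
  show "(\<lambda>\<omega>. \<phi> (V \<omega>)) \<in> borel_measurable M"
    by (rule measurable_compose[OF V(1) Ck_borel_measurable[OF C]])
  have "\<bar>\<phi> v\<bar> \<le> \<bar>\<bar>\<phi> 0\<bar> + L * (\<Sum>i\<in>UNIV. \<bar>v $ i\<bar>)\<bar>" for v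
    using abs_increment_le[OF C L, of v 0] by simp
  then show "AE \<omega> in M. \<bar>\<phi> (V \<omega>)\<bar> \<le> \<bar>\<bar>\<phi> 0\<bar> + L * (\<Sum>i\<in>UNIV. \<bar>V \<omega> $ i\<bar>)\<bar>" by simp
qed

subsection \<open>Gaussian integration by parts\<close>

text \<open>The density n satisfies n'(x) = -(x / s^2) n(x), so n h has derivative n h' - x n h /
  s^2. A bounded \<open>h'\<close> gives \<open>h\<close> linear growth; this makes both terms
  integrable and lets n h vanish at both ends of the line.\<close>

lemma normal_integration_by_parts:
  fixes h h' :: "real \<Rightarrow> real"
  assumes s: "0 < s" and h: "\<And>x. (h has_real_derivative h' x) (at x)"
    and cont: "continuous_on UNIV h'" and L: "\<And>x. \<bar>h' x\<bar> \<le> L"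
  shows "(\<integral>x. normal_density 0 s x * (x * h x) \<partial>lborel) = s\<^sup>2 * (\<integral>x. normal_density 0 s x * h' x \<partial>lborel)"
proof -
  let ?n = "normal_density 0 s"
  have growth: "\<bar>h x\<bar> \<le> \<bar>h 0\<bar> + L * \<bar>x\<bar>" for x
  proof -
    have "norm (h x - h 0) \<le> L * norm (x - 0)"
      by (rule field_differentiable_bound[of UNIV h h' L])
         (use h L in \<open>auto intro: has_field_derivative_at_within\<close>)
    then show ?thesis by simp
  qed
  have L0: "0 \<le> L" using L[of 0] by linarith
  have n: "(?n has_real_derivative - (x / s\<^sup>2) * ?n x) (at x)" for x
    unfolding normal_density_def using s
    by (auto intro!: derivative_eq_intros simp: field_simps power2_eq_square)
  have [measurable]: "h \<in> borel_measurable borel" "h' \<in> borel_measurable borel"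
    using cont h by (auto intro!: borel_measurable_continuous_onI continuous_at_imp_continuous_on DERIV_isCont)
  have i1: "integrable lborel (\<lambda>x. ?n x * h' x)"
  proof (rule Bochner_Integration.integrable_bound)
    show "integrable lborel (\<lambda>x. ?n x * L)" using s by simp
    show "AE x in lborel. norm (?n x * h' x) \<le> norm (?n x * L)"
      using L L0 by (auto simp: abs_mult intro!: mult_left_mono)
  qed simp
  have i2: "integrable lborel (\<lambda>x. ?n x * (x * h x))"
  proof (rule Bochner_Integration.integrable_bound)
    show "integrable lborel (\<lambda>x. \<bar>h 0\<bar> * (?n x * \<bar>x\<bar>) + L * (?n x * \<bar>x\<bar> ^ 2))"
      using integrable_normal_moment_abs[OF s, of 0 1] integrable_normal_moment_abs[OF s, of 0 2] by simp
    have "\<bar>x * h x\<bar> \<le> \<bar>h 0\<bar> * \<bar>x\<bar> + L * \<bar>x\<bar>\<^sup>2" for x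
      using mult_left_mono[OF growth[of x], of "\<bar>x\<bar>"] by (simp add: abs_mult algebra_simps power2_eq_square)
    then have "\<bar>?n x * (x * h x)\<bar> \<le> ?n x * (\<bar>h 0\<bar> * \<bar>x\<bar> + L * \<bar>x\<bar>\<^sup>2)" for x
      by (simp add: abs_mult mult_left_mono)
    moreover have "0 \<le> \<bar>h 0\<bar> * (?n x * \<bar>x\<bar>) + L * (?n x * \<bar>x\<bar>\<^sup>2)" for x
      using L0 by simp
    ultimately show "AE x in lborel. norm (?n x * (x * h x)) \<le> norm (\<bar>h 0\<bar> * (?n x * \<bar>x\<bar>) + L * (?n x * \<bar>x\<bar> ^ 2))"
      by (simp add: algebra_simps)
  qed simp
  let ?F = "\<lambda>x. ?n x * h x"
  let ?f = "\<lambda>x. ?n x * h' x - (?n x * (x * h x)) / s\<^sup>2"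
  have F: "(?F has_real_derivative ?f x) (at x)" for x
    by (auto intro!: derivative_eq_intros n h simp: field_simps)
  have n0: "((\<lambda>x. ?n x * (\<bar>h 0\<bar> + L * \<bar>x\<bar>)) \<longlongrightarrow> 0) at_top" "((\<lambda>x. ?n x * (\<bar>h 0\<bar> + L * \<bar>x\<bar>)) \<longlongrightarrow> 0) at_bot"
    unfolding normal_density_def using s by real_asymp+
  have le: "norm (?F x) \<le> ?n x * (\<bar>h 0\<bar> + L * \<bar>x\<bar>)" for x
    using growth[of x] by (auto simp: abs_mult intro!: mult_left_mono)
  have lim: "(?F \<longlongrightarrow> 0) at_top" "(?F \<longlongrightarrow> 0) at_bot"
    using Lim_null_comparison[OF _ n0(1), of ?F] Lim_null_comparison[OF _ n0(2), of ?F] le by auto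
  have "(LBINT x=-\<infinity>..\<infinity>. ?f x) = 0 - 0"
  proof (rule interval_integral_FTC_integrable[where F="?F"])
    show "(?F has_vector_derivative ?f x) (at x)" for x
      using F by (simp add: has_real_derivative_iff_has_vector_derivative)
    have c: "continuous_on UNIV ?n" "continuous_on UNIV h"
      using n h by (auto intro!: continuous_at_imp_continuous_on DERIV_isCont)
    have "continuous_on UNIV ?f"
      by (intro continuous_intros c cont) (use s in auto)
    then show "isCont ?f x" for x by (simp add: continuous_on_eq_continuous_at)
    show "set_integrable lborel (einterval (- \<infinity>) \<infinity>) ?f"
      unfolding set_integrable_def using i1 i2 by (simp add: einterval_eq)
    show "((?F \<circ> real_of_ereal) \<longlongrightarrow> 0) (at_right (- \<infinity>))" "((?F \<circ> real_of_ereal) \<longlongrightarrow> 0) (at_left \<infinity>)"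
      using lim by (simp_all add: ereal_tendsto_simps)
  qed simp
  then have "(\<integral>x. ?f x \<partial>lborel) = 0"
    by (simp add: interval_lebesgue_integral_def einterval_eq set_lebesgue_integral_def)
  moreover have "(\<integral>x. ?f x \<partial>lborel) = (\<integral>x. ?n x * h' x \<partial>lborel) - (\<integral>x. ?n x * (x * h x) \<partial>lborel) / s\<^sup>2"
    using i1 i2 by simp
  ultimately show ?thesis using s by (simp add: field_simps)
qed

lemma normal_char:
  assumes "prob_space N" and s: "0 < s" and D: "distributed N lborel U (\<lambda>x. ennreal (normal_density 0 s x))"
  shows "(CLINT \<omega>|N. iexp (U \<omega>)) = complex_of_real (exp (- s\<^sup>2 / 2))"
proof -
  interpret prob_space N by fact
  have [measurable]: "U \<in> borel_measurable N" using D by (simp add: distributed_def)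
  have "distributed N lborel (\<lambda>\<omega>. 0 + 1 / s * U \<omega>) (\<lambda>x. ennreal (normal_density (0 + 1 / s * 0) (\<bar>1 / s\<bar> * s) x))"
    using s by (intro normal_density_affine[OF D]) auto
  then have "distributed N lborel (\<lambda>\<omega>. U \<omega> / s) (\<lambda>x. ennreal (std_normal_density x))"
    using s by simp
  then have eq: "distr N lborel (\<lambda>\<omega>. U \<omega> / s) = std_normal_distribution"
    by (simp add: distributed_def)
  have "(CLINT \<omega>|N. iexp (U \<omega>)) = (CLINT x|distr N lborel (\<lambda>\<omega>. U \<omega> / s). iexp (s * x))"
    using s by (subst integral_distr) auto
  also have "\<dots> = char std_normal_distribution s"
    unfolding eq char_def ..
  finally show ?thesis by (simp add: char_std_normal_distribution)
qed

section \<open>Linear functionals of a Gaussian vector\<close>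

locale gaussian =
  prob_space N for N :: "'b measure" +
  fixes Y :: "'b \<Rightarrow> real ^ 'd::finite" and C :: "real ^ 'd ^ 'd"
  assumes cgv: "centered_gaussian_vector N Y C"
begin

lemma Y_measurable [measurable]: "Y \<in> borel_measurable N"
  using cgv by (simp add: centered_gaussian_vector_def gaussian_vector_def)

lemma Y_nth_measurable [measurable]: "(\<lambda>\<omega>. Y \<omega> $ i) \<in> borel_measurable N"
  by (rule measurable_compose[OF Y_measurable borel_measurable_nth])

lemma linear_form_cases:
  obtains (const) m where "AE \<omega> in N. u \<bullet> Y \<omega> = m"
  | (normal) m s where "0 < s" "distributed N lborel (\<lambda>\<omega>. u \<bullet> Y \<omega>) (\<lambda>x. ennreal (normal_density m s x))"
  using cgv unfolding centered_gaussian_vector_def gaussian_vector_def by blast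

lemma linear_form_sq: "square_integrable N (\<lambda>\<omega>. u \<bullet> Y \<omega>)"
proof (cases rule: linear_form_cases[of u])
  case (const m)
  then show ?thesis
    by (intro square_integrable_bound[OF square_integrable_const[of N m]]) (auto simp: finite_measure_axioms)
next
  case (normal m s)
  have "integrable N (\<lambda>\<omega>. (u \<bullet> Y \<omega> - m) ^ 2)"
    using distributed_integrable[OF normal(2), of "\<lambda>x. (x - m)\<^sup>2"] integrable_normal_moment[OF normal(1), of m 2] by simp
  then have "square_integrable N (\<lambda>\<omega>. u \<bullet> Y \<omega> - m)"
    by (simp add: square_integrable_def)
  from square_integrable_add[OF this square_integrable_const[of N m]] show ?thesis
    by (simp add: finite_measure_axioms)
qed

lemma Y_sq: "square_integrable N (\<lambda>\<omega>. Y \<omega> $ i)"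
  using linear_form_sq[of "axis i 1"] by (simp add: inner_axis')

lemma Y_expectation: "(\<integral>\<omega>. Y \<omega> $ i \<partial>N) = 0"
  and Y_covariance: "(\<integral>\<omega>. Y \<omega> $ i * Y \<omega> $ j \<partial>N) = C $ i $ j"
  using cgv by (auto simp: centered_gaussian_vector_def)

lemma linear_form_expectation: "(\<integral>\<omega>. u \<bullet> Y \<omega> \<partial>N) = 0"
  using Y_expectation square_integrable_integrable[OF finite_measure_axioms Y_sq]
  by (simp add: inner_vec_def)

definition qf :: "real ^ 'd \<Rightarrow> real" where
  "qf u = (\<Sum>i\<in>UNIV. \<Sum>j\<in>UNIV. u $ i * u $ j * C $ i $ j)"

lemma linear_form_variance: "(\<integral>\<omega>. (u \<bullet> Y \<omega>)\<^sup>2 \<partial>N) = qf u"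
proof -
  have "(u \<bullet> v)\<^sup>2 = (\<Sum>i\<in>UNIV. \<Sum>j\<in>UNIV. u $ i * u $ j * (v $ i * v $ j))" for v
    by (simp add: inner_vec_def power2_eq_square sum_product mult_ac)
  then show ?thesis
    using square_integrable_mult[OF Y_sq Y_sq]
    by (simp add: qf_def Bochner_Integration.integral_sum Y_covariance)
qed

text \<open>In the degenerate case the constant must be the mean 0, so \<open>qf u\<close> is the
  vanishing variance and the same formula gives 1. Both alternatives of the definition thus lead to
  one expression in \<open>C\<close>.\<close>

lemma char_Y: "(CLINT \<omega>|N. iexp (u \<bullet> Y \<omega>)) = complex_of_real (exp (- qf u / 2))"
proof (cases rule: linear_form_cases[of u])
  case (const m)
  have "(\<integral>\<omega>. u \<bullet> Y \<omega> \<partial>N) = (\<integral>\<omega>. m \<partial>N)"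
    using const by (intro integral_cong_AE) auto
  then have m: "m = 0" by (simp add: linear_form_expectation prob_space)
  have "(\<integral>\<omega>. (u \<bullet> Y \<omega>)\<^sup>2 \<partial>N) = (\<integral>\<omega>. 0 \<partial>N)"
    using const m by (intro integral_cong_AE) auto
  then have "qf u = 0" by (simp add: linear_form_variance)
  moreover have "(CLINT \<omega>|N. iexp (u \<bullet> Y \<omega>)) = (CLINT \<omega>|N. 1)"
    using const m by (intro integral_cong_AE) auto
  ultimately show ?thesis by (simp add: prob_space)
next
  case (normal m s)
  have m: "m = 0"
    using normal_distributed_expectation[OF normal] linear_form_expectation by simp
  have "s\<^sup>2 = qf u"
    using normal_distributed_variance[OF normal] linear_form_expectation linear_form_variance by simp
  then show ?thesis
    using normal_char[OF prob_space_axioms normal(1) normal(2)[unfolded m]] by simp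
qed

text \<open>Positive variance excludes the almost surely constant alternative; mean and variance
  then fix the parameters of the normal one.\<close>

lemma coordinate_normal:
  assumes "0 < C $ i $ i"
  shows "distributed N lborel (\<lambda>\<omega>. Y \<omega> $ i) (\<lambda>x. ennreal (normal_density 0 (sqrt (C $ i $ i)) x))"
proof (cases rule: linear_form_cases[of "axis i 1"])
  case (const m)
  have "(\<integral>\<omega>. axis i 1 \<bullet> Y \<omega> \<partial>N) = (\<integral>\<omega>. m \<partial>N)"
    using const by (intro integral_cong_AE) auto
  then have m: "m = 0" by (simp add: linear_form_expectation prob_space)
  have "(\<integral>\<omega>. (Y \<omega> $ i * Y \<omega> $ i) \<partial>N) = (\<integral>\<omega>. 0 \<partial>N)"
    using const m by (intro integral_cong_AE) (auto simp: inner_axis')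
  then show ?thesis using assms by (simp add: Y_covariance)
next
  case (normal m s)
  note normal = normal(1) normal(2)[unfolded inner_axis' inner_real_def mult_1_left]
  have m: "m = 0"
    using normal_distributed_expectation[OF normal] Y_expectation[of i] by simp
  have "s\<^sup>2 = C $ i $ i"
    using normal_distributed_variance[OF normal] Y_expectation[of i] Y_covariance[of i i]
    by (simp add: power2_eq_square)
  then have "s = sqrt (C $ i $ i)" using normal(1) by (metis less_imp_le real_sqrt_unique)
  with normal m show ?thesis by simp
qed

text \<open>The hypothesis says that the covariance of \<open>u \<bullet> Y\<close> and
  \<open>Y $ i\<close> is r times the variance of \<open>Y $ i\<close>. So r times
  \<open>Y $ i\<close> is the orthogonal projection of \<open>u \<bullet> Y\<close> onto that
  coordinate, and the claim is Pythagoras for variances.\<close>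

lemma qf_split:
  assumes r: "(\<Sum>j\<in>UNIV. u $ j * C $ i $ j) = r * C $ i $ i"
  shows "qf (u - r *\<^sub>R axis i 1) + qf (r *\<^sub>R axis i 1) = qf u"
proof -
  have int: "integrable N (\<lambda>\<omega>. Y \<omega> $ j * Y \<omega> $ k)" "integrable N (\<lambda>\<omega>. (u \<bullet> Y \<omega>)\<^sup>2)"
    "integrable N (\<lambda>\<omega>. (u \<bullet> Y \<omega>) * Y \<omega> $ j)" for j k
    using Y_sq linear_form_sq[of u] by (auto intro!: square_integrable_mult simp: power2_eq_square)
  have "(\<integral>\<omega>. (u \<bullet> Y \<omega>) * Y \<omega> $ i \<partial>N) = (\<integral>\<omega>. (\<Sum>j\<in>UNIV. u $ j * (Y \<omega> $ i * Y \<omega> $ j)) \<partial>N)"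
    by (intro Bochner_Integration.integral_cong refl) (simp add: inner_vec_def sum_distrib_left sum_distrib_right mult_ac)
  also have "\<dots> = r * C $ i $ i"
    using int(1) r by (simp add: Y_covariance)
  finally have cross: "(\<integral>\<omega>. (u \<bullet> Y \<omega>) * Y \<omega> $ i \<partial>N) = r * C $ i $ i" .
  have "qf (u - r *\<^sub>R axis i 1) = (\<integral>\<omega>. (u \<bullet> Y \<omega>)\<^sup>2 - 2 * r * ((u \<bullet> Y \<omega>) * Y \<omega> $ i) + r\<^sup>2 * (Y \<omega> $ i * Y \<omega> $ i) \<partial>N)"
    unfolding linear_form_variance[symmetric]
    by (intro Bochner_Integration.integral_cong refl)
       (simp add: inner_diff_left inner_axis' power2_eq_square algebra_simps)
  also have "\<dots> = qf u - 2 * r * (r * C $ i $ i) + r\<^sup>2 * C $ i $ i"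
    using int by (simp add: linear_form_variance cross Y_covariance)
  finally have "qf (u - r *\<^sub>R axis i 1) = qf u - r\<^sup>2 * C $ i $ i"
    by (simp add: power2_eq_square)
  moreover have "qf (r *\<^sub>R axis i 1) = (\<integral>\<omega>. r\<^sup>2 * (Y \<omega> $ i * Y \<omega> $ i) \<partial>N)"
    unfolding linear_form_variance[symmetric]
    by (intro Bochner_Integration.integral_cong refl) (simp add: inner_axis' power2_eq_square)
  ultimately show ?thesis by (simp add: Y_covariance)
qed

text \<open>Regressing \<open>Y\<close> on \<open>Y $ i\<close> leaves a residual that is independent of \<open>Y $ i\<close>, so \<open>Y\<close> has the law
  of the residual plus an independent copy of the regression term.\<close>

lemma Y_regression:
  fixes i :: 'd
  defines "b \<equiv> (\<chi> j. C $ i $ j / C $ i $ i)"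
  assumes pos: "0 < C $ i $ i"
  shows "distr N borel Y = distr (N \<Otimes>\<^sub>M N) borel (\<lambda>(\<omega>1, \<omega>2). Y \<omega>1 - Y \<omega>1 $ i *\<^sub>R b + Y \<omega>2 $ i *\<^sub>R b)"
proof (rule char_unique_vec)
  interpret NN: pair_prob_space N N ..
  show "prob_space N" "prob_space (N \<Otimes>\<^sub>M N)" by unfold_locales
  fix u :: "real ^ 'd"
  \<comment> \<open>With this \<open>r\<close>, the residual tested against \<open>u\<close> is
    \<open>(u - r *\<^sub>R axis i 1) \<bullet> Y\<close>, and the regression term is r times
    \<open>Y $ i\<close>. The choice of \<open>b\<close> as covariances over the variance is exactly
    the hypothesis of \<open>qf_split\<close>.\<close>
  define r where "r = u \<bullet> b"
  have e: "iexp (u \<bullet> (Y \<omega>1 - Y \<omega>1 $ i *\<^sub>R b + Y \<omega>2 $ i *\<^sub>R b)) =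
      iexp ((u - r *\<^sub>R axis i 1) \<bullet> Y \<omega>1) * iexp ((r *\<^sub>R axis i 1) \<bullet> Y \<omega>2)" for \<omega>1 \<omega>2
    by (simp add: exp_add[symmetric] inner_diff_left inner_diff_right inner_add_right inner_axis' r_def algebra_simps)
  have int: "integrable (N \<Otimes>\<^sub>M N) (\<lambda>z. iexp ((u - r *\<^sub>R axis i 1) \<bullet> Y (fst z)) * iexp ((r *\<^sub>R axis i 1) \<bullet> Y (snd z)))"
    by (rule NN.integrable_const_bound[where B=1]) (auto simp: norm_mult)
  have "(CLINT z|N \<Otimes>\<^sub>M N. iexp (u \<bullet> (case z of (\<omega>1, \<omega>2) \<Rightarrow> Y \<omega>1 - Y \<omega>1 $ i *\<^sub>R b + Y \<omega>2 $ i *\<^sub>R b))) =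
      (CLINT z|N \<Otimes>\<^sub>M N. iexp ((u - r *\<^sub>R axis i 1) \<bullet> Y (fst z)) * iexp ((r *\<^sub>R axis i 1) \<bullet> Y (snd z)))"
    using e by (auto intro!: Bochner_Integration.integral_cong simp: split_beta)
  also have "\<dots> = (CLINT \<omega>1|N. CLINT \<omega>2|N. iexp ((u - r *\<^sub>R axis i 1) \<bullet> Y \<omega>1) * iexp ((r *\<^sub>R axis i 1) \<bullet> Y \<omega>2))"
    using NN.integral_fst'[OF int] by simp
  also have "\<dots> = complex_of_real (exp (- qf (u - r *\<^sub>R axis i 1) / 2)) * complex_of_real (exp (- qf (r *\<^sub>R axis i 1) / 2))"
    by (simp only: integral_mult_right_zero integral_mult_left_zero char_Y)
  also have "\<dots> = complex_of_real (exp (- qf u / 2))"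
  proof -
    have "qf (u - r *\<^sub>R axis i 1) + qf (r *\<^sub>R axis i 1) = qf u"
      using pos by (intro qf_split) (simp add: r_def b_def inner_vec_def sum_distrib_right)
    then have "- qf (u - r *\<^sub>R axis i 1) / 2 + - qf (r *\<^sub>R axis i 1) / 2 = - qf u / 2"
      by linarith
    then show ?thesis
      by (simp only: of_real_mult[symmetric] exp_add[symmetric])
  qed
  finally show "(CLINT \<omega>|N. iexp (u \<bullet> Y \<omega>)) =
      (CLINT z|N \<Otimes>\<^sub>M N. iexp (u \<bullet> (case z of (\<omega>1, \<omega>2) \<Rightarrow> Y \<omega>1 - Y \<omega>1 $ i *\<^sub>R b + Y \<omega>2 $ i *\<^sub>R b)))"
    using char_Y by simp
qed simp_all

text \<open>By the regression law \<open>Y\<close> may be replaced by \<open>T\<close>, which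
  depends on the second sample through one normal variable only; the one-dimensional formula applies
  for each fixed first sample. The chain rule contributes \<open>b $ j\<close>, and
  \<open>C $ i $ i\<close> times \<open>b $ j\<close> is \<open>C $ i $ j\<close>. Only the diagonal
  entry is inverted, never \<open>C\<close>.\<close>

lemma integration_by_parts:
  fixes \<phi> :: "real ^ 'd \<Rightarrow> real"
  assumes Ck: "Ck (Suc k) \<phi>" and L: "\<And>j y. \<bar>partial_deriv j \<phi> y\<bar> \<le> L"
  shows "(\<integral>\<omega>. Y \<omega> $ i * \<phi> (x + c *\<^sub>R Y \<omega>) \<partial>N) =
    c * (\<Sum>j\<in>UNIV. C $ i $ j * (\<integral>\<omega>. partial_deriv j \<phi> (x + c *\<^sub>R Y \<omega>) \<partial>N))"
proof (cases "C $ i $ i = 0")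
  case True
  have "(\<integral>\<omega>. (Y \<omega> $ i)\<^sup>2 \<partial>N) = 0"
    using Y_covariance[of i i] True by (simp add: power2_eq_square)
  then have 0: "AE \<omega> in N. Y \<omega> $ i = 0"
    using Y_sq[of i] by (simp add: square_integrable_def integral_nonneg_eq_0_iff_AE)
  \<comment> \<open>A coordinate that vanishes almost surely has zero covariance with all others, so
    both sides of the formula are 0.\<close>
  have "C $ i $ j = 0" for j
    using 0 unfolding Y_covariance[symmetric] by (intro integral_eq_zero_AE) auto
  moreover have "(\<integral>\<omega>. Y \<omega> $ i * \<phi> (x + c *\<^sub>R Y \<omega>) \<partial>N) = 0"
    using 0 by (intro integral_eq_zero_AE) auto
  ultimately show ?thesis by simp
next
  case False
  moreover have "0 \<le> C $ i $ i"
    unfolding Y_covariance[symmetric] by (intro integral_nonneg_AE) simp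
  ultimately have pos: "0 < C $ i $ i" by simp
  interpret NN: pair_prob_space N N ..
  have [measurable]: "\<phi> \<in> borel_measurable borel" "partial_deriv j \<phi> \<in> borel_measurable borel" for j
    using Ck_borel_measurable[OF Ck] Ck Ck_borel_measurable[of k] by auto
  define b where "b = (\<chi> j. C $ i $ j / C $ i $ i)"
  define T where "T = (\<lambda>(\<omega>1, \<omega>2). Y \<omega>1 - Y \<omega>1 $ i *\<^sub>R b + Y \<omega>2 $ i *\<^sub>R b)"
  have [measurable]: "T \<in> borel_measurable (N \<Otimes>\<^sub>M N)" unfolding T_def by measurable
  have law: "distr N borel Y = distr (N \<Otimes>\<^sub>M N) borel T"
    unfolding T_def b_def by (rule Y_regression[OF pos])
  have transfer: "(\<integral>\<omega>. H (Y \<omega>) \<partial>N) = (\<integral>\<omega>1. \<integral>\<omega>2. H (T (\<omega>1, \<omega>2)) \<partial>N \<partial>N)"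
    if [measurable]: "H \<in> borel_measurable borel" and int: "integrable N (\<lambda>\<omega>. H (Y \<omega>))" for H :: "real ^ 'd \<Rightarrow> real"
  proof -
    have "integrable (distr N borel Y) H"
      using int by (simp add: integrable_distr_eq)
    then have int2: "integrable (N \<Otimes>\<^sub>M N) (\<lambda>z. H (T z))"
      unfolding law by (simp add: integrable_distr_eq)
    have "(\<integral>\<omega>. H (Y \<omega>) \<partial>N) = (\<integral>y. H y \<partial>distr N borel Y)" by (simp add: integral_distr)
    also have "\<dots> = (\<integral>z. H (T z) \<partial>(N \<Otimes>\<^sub>M N))" unfolding law by (simp add: integral_distr)
    finally show ?thesis using NN.integral_fst'[OF int2] by simp
  qed
  \<comment> \<open>The residual has i-th coordinate 0, so that
    \<open>T (\<omega>1, \<omega>2) $ i\<close> reduces to \<open>Y \<omega>2 $ i\<close>.\<close>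
  have bi: "b $ i = 1" using pos by (simp add: b_def)
  have sq: "square_integrable N (\<lambda>\<omega>. \<phi> (x + c *\<^sub>R Y \<omega>))"
  proof (rule square_integrable_Ck[OF finite_measure_axioms Ck L])
    show "square_integrable N (\<lambda>\<omega>. (x + c *\<^sub>R Y \<omega>) $ j)" for j
      using square_integrable_add[OF square_integrable_const[OF finite_measure_axioms, of "x $ j"]
          square_integrable_cmult[OF Y_sq[of j], of c]] by simp
  qed simp
  have intd: "integrable N (\<lambda>\<omega>. partial_deriv j \<phi> (x + c *\<^sub>R Y \<omega>))" for j
    by (rule integrable_const_bound[where B=L]) (use L in auto)
  note D = coordinate_normal[OF pos]
  have inner: "(\<integral>\<omega>2. T (\<omega>1, \<omega>2) $ i * \<phi> (x + c *\<^sub>R T (\<omega>1, \<omega>2)) \<partial>N) =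
      (\<integral>\<omega>2. c * (\<Sum>j\<in>UNIV. C $ i $ j * partial_deriv j \<phi> (x + c *\<^sub>R T (\<omega>1, \<omega>2))) \<partial>N)" for \<omega>1
  proof -
    \<comment> \<open>For fixed \<open>\<omega>1\<close> the argument of \<open>\<phi>\<close> moves
      along a line with base point \<open>z\<close> and direction \<open>c *\<^sub>R b\<close>,
      parametrised by \<open>Y \<omega>2 $ i\<close>.\<close>
    define z where "z = x + c *\<^sub>R (Y \<omega>1 - Y \<omega>1 $ i *\<^sub>R b)"
    define h where "h r = \<phi> (z + r *\<^sub>R (c *\<^sub>R b))" for r
    define h' where "h' r = (\<Sum>j\<in>UNIV. (c *\<^sub>R b) $ j * partial_deriv j \<phi> (z + r *\<^sub>R (c *\<^sub>R b)))" for r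
    have zT: "x + c *\<^sub>R T (\<omega>1, \<omega>2) = z + (Y \<omega>2 $ i) *\<^sub>R (c *\<^sub>R b)" for \<omega>2
      by (simp add: z_def T_def algebra_simps)
    have h: "(h has_real_derivative h' r) (at r)" for r
      unfolding h_def h'_def by (rule Ck_line[OF Ck])
    have cont: "continuous_on UNIV h'"
    proof -
      have pd: "continuous_on UNIV (partial_deriv j \<phi>)" for j
        using Ck by (intro Ck_imp_continuous[of k]) simp
      have "continuous_on UNIV (\<lambda>r. partial_deriv j \<phi> (z + r *\<^sub>R (c *\<^sub>R b)))" for j
        by (rule continuous_on_compose2[OF pd]) (auto intro!: continuous_intros)
      then show ?thesis
        unfolding h'_def by (intro continuous_on_sum continuous_on_mult_left)
    qed
    have [measurable]: "h \<in> borel_measurable borel" "h' \<in> borel_measurable borel"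
      unfolding h_def h'_def by measurable
    have bnd: "\<bar>h' r\<bar> \<le> (\<Sum>j\<in>UNIV. \<bar>(c *\<^sub>R b) $ j\<bar> * L)" for r
      unfolding h'_def by (intro order_trans[OF sum_abs] sum_mono) (auto simp: abs_mult intro!: mult_left_mono L)
    have "(\<integral>\<omega>2. T (\<omega>1, \<omega>2) $ i * \<phi> (x + c *\<^sub>R T (\<omega>1, \<omega>2)) \<partial>N) = (\<integral>\<omega>2. Y \<omega>2 $ i * h (Y \<omega>2 $ i) \<partial>N)"
      unfolding zT by (simp add: h_def T_def bi)
    also have "\<dots> = (\<integral>r. normal_density 0 (sqrt (C $ i $ i)) r * (r * h r) \<partial>lborel)"
      by (rule distributed_integral[OF D, symmetric]) auto
    also have "\<dots> = (sqrt (C $ i $ i))\<^sup>2 * (\<integral>r. normal_density 0 (sqrt (C $ i $ i)) r * h' r \<partial>lborel)"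
      by (rule normal_integration_by_parts[OF _ h cont bnd]) (use pos in simp)
    also have "(\<integral>r. normal_density 0 (sqrt (C $ i $ i)) r * h' r \<partial>lborel) = (\<integral>\<omega>2. h' (Y \<omega>2 $ i) \<partial>N)"
      by (rule distributed_integral[OF D]) auto
    also have "(sqrt (C $ i $ i))\<^sup>2 * \<dots> = (\<integral>\<omega>2. C $ i $ i * h' (Y \<omega>2 $ i) \<partial>N)"
      using pos by simp
    also have "\<dots> = (\<integral>\<omega>2. c * (\<Sum>j\<in>UNIV. C $ i $ j * partial_deriv j \<phi> (x + c *\<^sub>R T (\<omega>1, \<omega>2))) \<partial>N)"
      unfolding zT h'_def sum_distrib_left using pos
      by (intro Bochner_Integration.integral_cong sum.cong refl) (simp add: b_def)
    finally show ?thesis .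
  qed
  have "(\<integral>\<omega>. Y \<omega> $ i * \<phi> (x + c *\<^sub>R Y \<omega>) \<partial>N) =
      (\<integral>\<omega>1. \<integral>\<omega>2. T (\<omega>1, \<omega>2) $ i * \<phi> (x + c *\<^sub>R T (\<omega>1, \<omega>2)) \<partial>N \<partial>N)"
    by (rule transfer[of "\<lambda>y. y $ i * \<phi> (x + c *\<^sub>R y)"]) (auto intro!: square_integrable_mult Y_sq sq borel_measurable_nth)
  also have "\<dots> = (\<integral>\<omega>. c * (\<Sum>j\<in>UNIV. C $ i $ j * partial_deriv j \<phi> (x + c *\<^sub>R Y \<omega>)) \<partial>N)"
    unfolding inner using intd
    by (intro transfer[of "\<lambda>y. c * (\<Sum>j\<in>UNIV. C $ i $ j * partial_deriv j \<phi> (x + c *\<^sub>R y))", symmetric]) auto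
  also have "\<dots> = c * (\<Sum>j\<in>UNIV. C $ i $ j * (\<integral>\<omega>. partial_deriv j \<phi> (x + c *\<^sub>R Y \<omega>) \<partial>N))"
    using intd by simp
  finally show ?thesis .
qed

end

subsection \<open>Gaussian interpolation\<close>

text \<open>The mean value inequality bounds every difference quotient by the same \<open>B\<close>,
  so dominated convergence applies along each sequence tending to 0.\<close>

lemma has_real_derivative_integral:
  fixes \<Phi> \<Phi>' :: "real \<Rightarrow> 'a \<Rightarrow> real"
  assumes int: "\<And>\<theta>. integrable M (\<Phi> \<theta>)"
    and deriv: "\<And>\<theta> \<omega>. \<omega> \<in> space M \<Longrightarrow> ((\<lambda>\<theta>. \<Phi> \<theta> \<omega>) has_real_derivative \<Phi>' \<theta> \<omega>) (at \<theta>)"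
    and meas: "\<Phi>' \<theta> \<in> borel_measurable M"
    and bound: "\<And>\<theta> \<omega>. \<omega> \<in> space M \<Longrightarrow> \<bar>\<Phi>' \<theta> \<omega>\<bar> \<le> B \<omega>" and B: "integrable M B"
  shows "((\<lambda>\<theta>. \<integral>\<omega>. \<Phi> \<theta> \<omega> \<partial>M) has_real_derivative (\<integral>\<omega>. \<Phi>' \<theta> \<omega> \<partial>M)) (at \<theta>)"
  unfolding DERIV_def tendsto_at_iff_sequentially
proof (intro allI impI)
  fix X :: "nat \<Rightarrow> real" assume X: "\<forall>i. X i \<in> UNIV - {0}" "X \<longlonglongrightarrow> 0"
  let ?q = "\<lambda>h \<omega>. (\<Phi> (\<theta> + h) \<omega> - \<Phi> \<theta> \<omega>) / h"
  have eq: "((\<integral>\<omega>. \<Phi> (\<theta> + h) \<omega> \<partial>M) - (\<integral>\<omega>. \<Phi> \<theta> \<omega> \<partial>M)) / h = (\<integral>\<omega>. ?q h \<omega> \<partial>M)" for h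
    using int by simp
  have "(\<lambda>i. \<integral>\<omega>. ?q (X i) \<omega> \<partial>M) \<longlonglongrightarrow> (\<integral>\<omega>. \<Phi>' \<theta> \<omega> \<partial>M)"
  proof (rule integral_dominated_convergence[OF meas _ B])
    show "?q (X i) \<in> borel_measurable M" for i
      using int by (intro borel_measurable_divide borel_measurable_diff) auto
    show "AE \<omega> in M. (\<lambda>i. ?q (X i) \<omega>) \<longlonglongrightarrow> \<Phi>' \<theta> \<omega>"
    proof (rule AE_I2)
      fix \<omega> assume "\<omega> \<in> space M"
      from deriv[OF this, of \<theta>] X show "(\<lambda>i. ?q (X i) \<omega>) \<longlonglongrightarrow> \<Phi>' \<theta> \<omega>"
        unfolding DERIV_def tendsto_at_iff_sequentially by (auto simp: comp_def)
    qed
    show "AE \<omega> in M. norm (?q (X i) \<omega>) \<le> B \<omega>" for i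
    proof (rule AE_I2)
      fix \<omega> assume \<omega>: "\<omega> \<in> space M"
      have "norm (\<Phi> (\<theta> + X i) \<omega> - \<Phi> \<theta> \<omega>) \<le> B \<omega> * norm (\<theta> + X i - \<theta>)"
        by (rule field_differentiable_bound[of UNIV "\<lambda>\<theta>. \<Phi> \<theta> \<omega>" "\<lambda>\<theta>. \<Phi>' \<theta> \<omega>" "B \<omega>"])
           (use deriv bound \<omega> in auto)
      then show "norm (?q (X i) \<omega>) \<le> B \<omega>"
        using X(1) by (simp add: field_simps)
    qed
  qed
  then show "((\<lambda>h. ((\<integral>\<omega>. \<Phi> (\<theta> + h) \<omega> \<partial>M) - (\<integral>\<omega>. \<Phi> \<theta> \<omega> \<partial>M)) / h) \<circ> X) \<longlonglongrightarrow> (\<integral>\<omega>. \<Phi>' \<theta> \<omega> \<partial>M)"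
    unfolding eq by (simp add: comp_def)
qed

text \<open>The gradient grows at most linearly, hence \<open>g\<close> at most quadratically. The
  bound is kept as a sum of products of two affine expressions, so that integrability later follows
  factor by factor from square integrability.\<close>

lemma quadratic_growth:
  fixes g :: "real ^ 'd::finite \<Rightarrow> real"
  assumes C: "Ck (Suc (Suc k)) g" and L: "\<And>i j x. \<bar>partial_deriv i (partial_deriv j g) x\<bar> \<le> L"
  shows "\<bar>g x\<bar> \<le> \<bar>g 0\<bar> + (\<Sum>i\<in>UNIV. \<bar>x $ i\<bar> * (\<bar>partial_deriv i g 0\<bar> + L * (\<Sum>j\<in>UNIV. \<bar>x $ j\<bar>)))"
proof -
  have L0: "0 \<le> L" using L[of undefined undefined undefined] by linarith
  obtain t where t: "0 < t" "t < 1" "g (0 + 1 *\<^sub>R x) - g (0 + 0 *\<^sub>R x) =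
      (1 - 0) * (\<Sum>i\<in>UNIV. x $ i * partial_deriv i g (0 + t *\<^sub>R x))"
    using MVT2[OF zero_less_one, of "\<lambda>t. g (0 + t *\<^sub>R x)", OF Ck_line[OF C]] by blast
  have "\<bar>partial_deriv i g (t *\<^sub>R x)\<bar> \<le> \<bar>partial_deriv i g 0\<bar> + L * (\<Sum>j\<in>UNIV. \<bar>x $ j\<bar>)" for i
  proof -
    have "\<bar>partial_deriv i g (t *\<^sub>R x) - partial_deriv i g 0\<bar> \<le> L * (\<Sum>j\<in>UNIV. \<bar>(t *\<^sub>R x) $ j - 0 $ j\<bar>)"
      using C L by (intro abs_increment_le[of k]) auto
    also have "\<dots> \<le> L * (\<Sum>j\<in>UNIV. \<bar>x $ j\<bar>)"
      using t L0 by (intro mult_left_mono sum_mono) (auto simp: abs_mult intro!: mult_left_le_one_le)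
    finally show ?thesis by linarith
  qed
  then have "\<bar>\<Sum>i\<in>UNIV. x $ i * partial_deriv i g (t *\<^sub>R x)\<bar> \<le>
      (\<Sum>i\<in>UNIV. \<bar>x $ i\<bar> * (\<bar>partial_deriv i g 0\<bar> + L * (\<Sum>j\<in>UNIV. \<bar>x $ j\<bar>)))"
    by (intro order_trans[OF sum_abs] sum_mono) (simp add: abs_mult mult_left_mono)
  with t(3) show ?thesis by simp
qed

lemma integrable_Ck2:
  fixes g :: "real ^ 'd::finite \<Rightarrow> real"
  assumes "finite_measure M" and C: "Ck (Suc (Suc k)) g" and L: "\<And>i j x. \<bar>partial_deriv i (partial_deriv j g) x\<bar> \<le> L"
    and V: "V \<in> borel_measurable M" "\<And>i. square_integrable M (\<lambda>\<omega>. V \<omega> $ i)"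
  shows "integrable M (\<lambda>\<omega>. g (V \<omega>))"
proof (rule Bochner_Integration.integrable_bound)
  show "integrable M (\<lambda>\<omega>. \<bar>g 0\<bar> + (\<Sum>i\<in>UNIV. \<bar>V \<omega> $ i\<bar> * (\<bar>partial_deriv i g 0\<bar> + L * (\<Sum>j\<in>UNIV. \<bar>V \<omega> $ j\<bar>))))"
    by (intro Bochner_Integration.integrable_add finite_measure.integrable_const Bochner_Integration.integrable_sum
        square_integrable_mult square_integrable_abs square_integrable_add
        square_integrable_const square_integrable_cmult square_integrable_sum assms)
  show "(\<lambda>\<omega>. g (V \<omega>)) \<in> borel_measurable M"
    by (rule measurable_compose[OF V(1) Ck_borel_measurable[OF C]])
  show "AE \<omega> in M. norm (g (V \<omega>)) \<le> norm (\<bar>g 0\<bar> + (\<Sum>i\<in>UNIV. \<bar>V \<omega> $ i\<bar> * (\<bar>partial_deriv i g 0\<bar> + L * (\<Sum>j\<in>UNIV. \<bar>V \<omega> $ j\<bar>))))"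
    unfolding real_norm_def by (intro AE_I2 order_trans[OF quadratic_growth[OF C L] abs_ge_self])
qed

section \<open>Integrability on product spaces\<close>

lemma (in pair_prob_space) integrable_pair_fst:
  fixes f :: "'a \<Rightarrow> real"
  assumes "integrable M1 f" shows "integrable (M1 \<Otimes>\<^sub>M M2) (\<lambda>z. f (fst z))"
proof -
  have "integrable (distr (M1 \<Otimes>\<^sub>M M2) M1 fst) f"
    using assms by (simp add: M2.distr_pair_fst)
  then show ?thesis by (rule integrable_distr[rotated]) simp
qed

lemma (in pair_prob_space) integrable_pair_snd:
  fixes f :: "'b \<Rightarrow> real"
  assumes "integrable M2 f" shows "integrable (M1 \<Otimes>\<^sub>M M2) (\<lambda>z. f (snd z))"
proof -
  interpret Q: pair_prob_space M2 M1 ..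
  show ?thesis
    using Q.integrable_product_swap[OF Q.integrable_pair_fst[OF assms]] by (simp add: split_beta')
qed

lemma (in pair_prob_space) square_integrable_fst:
  "square_integrable M1 U \<Longrightarrow> square_integrable (M1 \<Otimes>\<^sub>M M2) (\<lambda>z. U (fst z))"
  using integrable_pair_fst[of "\<lambda>x. (U x)\<^sup>2"] by (auto simp: square_integrable_def)

lemma (in pair_prob_space) square_integrable_snd:
  "square_integrable M2 U \<Longrightarrow> square_integrable (M1 \<Otimes>\<^sub>M M2) (\<lambda>z. U (snd z))"
  using integrable_pair_snd[of "\<lambda>x. (U x)\<^sup>2"] by (auto simp: square_integrable_def)

text \<open>The path \<open>sin \<theta> F + cos \<theta> Y\<close> is the smart path \<open>\<surd>t F + \<surd>(1-t) Y\<close> with \<open>t = sin\<^sup>2 \<theta>\<close>; this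
  parametrization has no singularity at the end points.\<close>

theorem (in gaussian) interpolation:
  fixes F :: "'a \<Rightarrow> real ^ 'd" and Z :: "'d \<Rightarrow> 'd \<Rightarrow> 'a \<Rightarrow> real"
  assumes "prob_space M" and F [measurable]: "F \<in> borel_measurable M"
    and F_sq: "\<And>i. square_integrable M (\<lambda>\<omega>. F \<omega> $ i)" and Z: "\<And>i j. integrable M (Z i j)"
    and Ck: "Ck (Suc (Suc k)) g" and L: "\<And>i j x. \<bar>partial_deriv i (partial_deriv j g) x\<bar> \<le> L"
    and stein: "\<And>s y. 0 \<le> s \<Longrightarrow>
      \<bar>(\<Sum>i\<in>UNIV. \<integral>\<omega>. F \<omega> $ i * partial_deriv i g (s *\<^sub>R F \<omega> + y) \<partial>M)
        - s * (\<Sum>i\<in>UNIV. \<Sum>j\<in>UNIV. \<integral>\<omega>. Z i j \<omega> * partial_deriv j (partial_deriv i g) (s *\<^sub>R F \<omega> + y) \<partial>M)\<bar> \<le> s\<^sup>2 * R"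
  shows "\<bar>(\<integral>\<omega>. g (F \<omega>) \<partial>M) - (\<integral>\<omega>. g (Y \<omega>) \<partial>N)\<bar>
    \<le> L / 2 * (\<Sum>i\<in>UNIV. \<Sum>j\<in>UNIV. \<integral>\<omega>. \<bar>C $ i $ j - Z i j \<omega>\<bar> \<partial>M) + R / 3"
proof -
  interpret M: prob_space M by fact
  interpret P: pair_prob_space M N ..
  \<comment> \<open>\<open>F\<close> and \<open>Y\<close> live on separate spaces; pulled back to
    the product they become independent.\<close>
  define P where "P = M \<Otimes>\<^sub>M N"
  have finP: "finite_measure P" unfolding P_def by unfold_locales
  have L0: "0 \<le> L" using L[of undefined undefined undefined] by linarith
  have [measurable]: "g \<in> borel_measurable borel" "partial_deriv i g \<in> borel_measurable borel"
    "partial_deriv j (partial_deriv i g) \<in> borel_measurable borel" for i j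
    using Ck_borel_measurable[OF Ck] Ck_borel_measurable[of "Suc k" "partial_deriv i g"]
      Ck_borel_measurable[of k "partial_deriv j (partial_deriv i g)"] Ck by auto
  have [measurable]: "Z i j \<in> borel_measurable M" for i j using Z by auto
  have [measurable]: "(\<lambda>\<omega>. F \<omega> $ i) \<in> borel_measurable M" for i
    using F_sq by (rule square_integrable_measurable)
  have Ck1: "Ck (Suc k) (partial_deriv i g)" for i using Ck by simp
  define V where "V \<theta> z = sin \<theta> *\<^sub>R F (fst z) + cos \<theta> *\<^sub>R Y (snd z)" for \<theta> and z :: "'a \<times> 'b"
  have Vm [measurable]: "V \<theta> \<in> borel_measurable P" for \<theta> unfolding V_def P_def by measurable
  have Fsq: "square_integrable P (\<lambda>z. F (fst z) $ i)" for i
    unfolding P_def by (rule P.square_integrable_fst[OF F_sq])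
  have Ysq: "square_integrable P (\<lambda>z. Y (snd z) $ i)" for i
    unfolding P_def by (rule P.square_integrable_snd[OF Y_sq])
  have Vsq: "square_integrable P (\<lambda>z. V \<theta> z $ i)" for \<theta> i
    unfolding V_def by (simp add: square_integrable_add square_integrable_cmult Fsq Ysq)
  have gi_sq: "square_integrable P (\<lambda>z. partial_deriv i g (V \<theta> z))" for \<theta> i
    by (rule square_integrable_Ck[OF finP Ck1 L Vm Vsq])
  have gij_int: "integrable P (\<lambda>z. partial_deriv j (partial_deriv i g) (V \<theta> z))" for \<theta> i j
    using L by (intro finite_measure.integrable_const_bound[OF finP, where B=L]) auto
  have Z_fst_int: "integrable P (\<lambda>z. Z i j (fst z))" for i j
    unfolding P_def by (rule P.integrable_pair_fst[OF Z])
  have Zgij: "integrable P (\<lambda>z. Z i j (fst z) * partial_deriv j (partial_deriv i g) (V \<theta> z))" for \<theta> i j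
  proof (rule Bochner_Integration.integrable_bound)
    show "integrable P (\<lambda>z. L * Z i j (fst z))" using Z_fst_int by simp
    have [measurable]: "(\<lambda>z. Z i j (fst z)) \<in> borel_measurable P" using Z_fst_int by auto
    show "(\<lambda>z. Z i j (fst z) * partial_deriv j (partial_deriv i g) (V \<theta> z)) \<in> borel_measurable P" by measurable
    show "AE z in P. norm (Z i j (fst z) * partial_deriv j (partial_deriv i g) (V \<theta> z)) \<le> norm (L * Z i j (fst z))"
      using L0 by (intro AE_I2) (simp add: abs_mult mult.commute[of L] mult_left_mono L)
  qed
  define \<Psi> where "\<Psi> \<theta> = (\<integral>z. g (V \<theta> z) \<partial>P)" for \<theta>
  define \<Phi>' where "\<Phi>' \<theta> z = (\<Sum>i\<in>UNIV. (cos \<theta> *\<^sub>R F (fst z) - sin \<theta> *\<^sub>R Y (snd z)) $ i * partial_deriv i g (V \<theta> z))" for \<theta> z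
  have \<Psi>_deriv: "(\<Psi> has_real_derivative (\<integral>z. \<Phi>' \<theta> z \<partial>P)) (at \<theta>)" for \<theta>
    unfolding \<Psi>_def
  proof (rule has_real_derivative_integral)
    \<comment> \<open>As sine and cosine are at most 1 in absolute value, \<open>?a\<close>
      dominates the coordinates of the path and of its velocity for every \<theta>, which gives one
      integrable bound for all derivatives.\<close>
    let ?a = "\<lambda>i z. \<bar>F (fst z) $ i\<bar> + \<bar>Y (snd z) $ i\<bar>"
    show "integrable P (\<lambda>z. g (V \<theta> z))" for \<theta>
      by (rule integrable_Ck2[OF finP Ck L Vm Vsq])
    show "((\<lambda>\<theta>. g (V \<theta> z)) has_real_derivative \<Phi>' \<theta> z) (at \<theta>)" for \<theta> z
      unfolding \<Phi>'_def
      by (rule Ck_has_real_derivative_compose[OF Ck])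
         (auto simp: V_def has_vector_derivative_def algebra_simps intro!: derivative_eq_intros)
    show "\<Phi>' \<theta> \<in> borel_measurable P"
      using Fsq Ysq gi_sq unfolding \<Phi>'_def square_integrable_def
      by (auto intro!: borel_measurable_sum borel_measurable_times borel_measurable_diff)
    show "integrable P (\<lambda>z. \<Sum>i\<in>UNIV. ?a i z * (\<bar>partial_deriv i g 0\<bar> + L * (\<Sum>j\<in>UNIV. ?a j z)))"
      by (intro Bochner_Integration.integrable_sum square_integrable_mult square_integrable_abs square_integrable_add
        square_integrable_const square_integrable_cmult square_integrable_sum finP Fsq Ysq)
    have le1: "\<bar>s * a\<bar> \<le> \<bar>a\<bar>" if "\<bar>s\<bar> \<le> 1" for s a :: real
      using that by (simp add: abs_mult mult_left_le_one_le)
    have V_le: "\<bar>V \<theta> z $ j\<bar> \<le> ?a j z" for \<theta> j z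
      unfolding V_def using le1[of "sin \<theta>" "F (fst z) $ j"] le1[of "cos \<theta>" "Y (snd z) $ j"] by simp
    show "\<bar>\<Phi>' \<theta> z\<bar> \<le> (\<Sum>i\<in>UNIV. ?a i z * (\<bar>partial_deriv i g 0\<bar> + L * (\<Sum>j\<in>UNIV. ?a j z)))" for \<theta> z
      unfolding \<Phi>'_def
    proof (intro order_trans[OF sum_abs] sum_mono, unfold abs_mult, intro mult_mono)
      fix i
      show "\<bar>(cos \<theta> *\<^sub>R F (fst z) - sin \<theta> *\<^sub>R Y (snd z)) $ i\<bar> \<le> ?a i z"
        using le1[of "cos \<theta>" "F (fst z) $ i"] le1[of "sin \<theta>" "Y (snd z) $ i"] by simp
      have "\<bar>partial_deriv i g (V \<theta> z) - partial_deriv i g 0\<bar> \<le> L * (\<Sum>j\<in>UNIV. \<bar>V \<theta> z $ j - 0 $ j\<bar>)"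
        by (rule abs_increment_le[OF Ck1 L])
      also have "\<dots> \<le> L * (\<Sum>j\<in>UNIV. ?a j z)"
        using L0 V_le by (intro mult_left_mono sum_mono) auto
      finally show "\<bar>partial_deriv i g (V \<theta> z)\<bar> \<le> \<bar>partial_deriv i g 0\<bar> + L * (\<Sum>j\<in>UNIV. ?a j z)"
        by linarith
    qed auto
  qed
  \<comment> \<open>Integration by parts in the second factor with \<open>F \<omega>1\<close>
    frozen; cos \<theta> is the scale of \<open>Y\<close> in the path.\<close>
  have YIBP: "(\<integral>z. Y (snd z) $ i * partial_deriv i g (V \<theta> z) \<partial>P) =
      cos \<theta> * (\<Sum>j\<in>UNIV. C $ i $ j * (\<integral>z. partial_deriv j (partial_deriv i g) (V \<theta> z) \<partial>P))" for \<theta> i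
  proof -
    have "(\<integral>z. Y (snd z) $ i * partial_deriv i g (V \<theta> z) \<partial>P) =
        (\<integral>\<omega>1. \<integral>\<omega>2. Y \<omega>2 $ i * partial_deriv i g (sin \<theta> *\<^sub>R F \<omega>1 + cos \<theta> *\<^sub>R Y \<omega>2) \<partial>N \<partial>M)"
      using P.integral_fst'[OF square_integrable_mult[OF Ysq gi_sq, unfolded P_def], of i i \<theta>]
      by (simp add: V_def P_def)
    also have "\<dots> = (\<integral>\<omega>1. cos \<theta> * (\<Sum>j\<in>UNIV. C $ i $ j * (\<integral>\<omega>2. partial_deriv j (partial_deriv i g) (V \<theta> (\<omega>1, \<omega>2)) \<partial>N)) \<partial>M)"
      using integration_by_parts[OF Ck1 L] by (simp add: V_def)
    also have "\<dots> = cos \<theta> * (\<Sum>j\<in>UNIV. C $ i $ j * (\<integral>\<omega>1. \<integral>\<omega>2. partial_deriv j (partial_deriv i g) (V \<theta> (\<omega>1, \<omega>2)) \<partial>N \<partial>M))"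
      using P.integrable_fst'[OF gij_int[unfolded P_def]] by simp
    also have "\<dots> = cos \<theta> * (\<Sum>j\<in>UNIV. C $ i $ j * (\<integral>z. partial_deriv j (partial_deriv i g) (V \<theta> z) \<partial>P))"
      using P.integral_fst'[OF gij_int[unfolded P_def]] by (simp add: P_def)
    finally show ?thesis .
  qed
  \<comment> \<open>\<open>A \<theta>\<close> is the defect in the Stein identity of
    \<open>F\<close>, averaged over \<open>Y\<close>. Freezing \<open>Y\<close> turns the Gaussian
    part of the path into the shift \<open>y\<close> that \<open>stein\<close> leaves
    arbitrary.\<close>
  define A where "A \<theta> = (\<Sum>i\<in>UNIV. \<integral>z. F (fst z) $ i * partial_deriv i g (V \<theta> z) \<partial>P)
      - sin \<theta> * (\<Sum>i\<in>UNIV. \<Sum>j\<in>UNIV. \<integral>z. Z i j (fst z) * partial_deriv j (partial_deriv i g) (V \<theta> z) \<partial>P)" for \<theta>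
  have A_bound: "\<bar>A \<theta>\<bar> \<le> (sin \<theta>)\<^sup>2 * R" if "0 \<le> sin \<theta>" for \<theta>
  proof -
    let ?f = "\<lambda>i \<omega>1 \<omega>2. F \<omega>1 $ i * partial_deriv i g (V \<theta> (\<omega>1, \<omega>2))"
    let ?h = "\<lambda>i j \<omega>1 \<omega>2. Z i j \<omega>1 * partial_deriv j (partial_deriv i g) (V \<theta> (\<omega>1, \<omega>2))"
    have f: "integrable (M \<Otimes>\<^sub>M N) (case_prod (?f i))" for i
      using square_integrable_mult[OF Fsq gi_sq, unfolded P_def] by (simp add: split_beta')
    have h: "integrable (M \<Otimes>\<^sub>M N) (case_prod (?h i j))" for i j
      using Zgij[unfolded P_def] by (simp add: split_beta')
    have "A \<theta> = (\<Sum>i\<in>UNIV. \<integral>\<omega>2. \<integral>\<omega>1. ?f i \<omega>1 \<omega>2 \<partial>M \<partial>N)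
      - sin \<theta> * (\<Sum>i\<in>UNIV. \<Sum>j\<in>UNIV. \<integral>\<omega>2. \<integral>\<omega>1. ?h i j \<omega>1 \<omega>2 \<partial>M \<partial>N)"
      unfolding P.integral_snd[OF f] P.integral_snd[OF h] A_def P_def by (simp add: split_beta')
    also have "\<dots> = (\<integral>\<omega>2. (\<Sum>i\<in>UNIV. \<integral>\<omega>1. ?f i \<omega>1 \<omega>2 \<partial>M)
      - sin \<theta> * (\<Sum>i\<in>UNIV. \<Sum>j\<in>UNIV. \<integral>\<omega>1. ?h i j \<omega>1 \<omega>2 \<partial>M) \<partial>N)"
      using P.integrable_snd[OF f] P.integrable_snd[OF h] by simp
    finally have A: "A \<theta> = (\<integral>\<omega>2. (\<Sum>i\<in>UNIV. \<integral>\<omega>1. ?f i \<omega>1 \<omega>2 \<partial>M)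
      - sin \<theta> * (\<Sum>i\<in>UNIV. \<Sum>j\<in>UNIV. \<integral>\<omega>1. ?h i j \<omega>1 \<omega>2 \<partial>M) \<partial>N)" (is "_ = (\<integral>\<omega>2. ?H \<omega>2 \<partial>N)") .
    have int: "integrable N ?H"
      using P.integrable_snd[OF f] P.integrable_snd[OF h] by simp
    have "\<bar>?H \<omega>2\<bar> \<le> (sin \<theta>)\<^sup>2 * R" for \<omega>2
      using stein[OF that, of "cos \<theta> *\<^sub>R Y \<omega>2"] by (simp add: V_def)
    then have "(\<integral>\<omega>2. \<bar>?H \<omega>2\<bar> \<partial>N) \<le> (sin \<theta>)\<^sup>2 * R"
      using int by (intro integral_le_const) auto
    then show ?thesis unfolding A using integral_abs_bound[of N ?H] by linarith
  qed
  define K where "K = L * (\<Sum>i\<in>UNIV. \<Sum>j\<in>UNIV. \<integral>\<omega>. \<bar>C $ i $ j - Z i j \<omega>\<bar> \<partial>M)"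
  \<comment> \<open>The factor cos \<theta> comes from the velocity of \<open>F\<close> in one term
    and from integration by parts in the other, and sin \<theta> the other way round. With equal
    prefactors the two merge into C - Z.\<close>
  have \<Psi>'_eq: "(\<integral>z. \<Phi>' \<theta> z \<partial>P) = cos \<theta> * A \<theta> - sin \<theta> * cos \<theta> *
      (\<Sum>i\<in>UNIV. \<Sum>j\<in>UNIV. \<integral>z. (C $ i $ j - Z i j (fst z)) * partial_deriv j (partial_deriv i g) (V \<theta> z) \<partial>P)" for \<theta>
  proof -
    let ?a = "\<lambda>i. \<integral>z. F (fst z) $ i * partial_deriv i g (V \<theta> z) \<partial>P"
    let ?b = "\<lambda>i. \<integral>z. Y (snd z) $ i * partial_deriv i g (V \<theta> z) \<partial>P"
    let ?h = "\<lambda>i j. \<integral>z. Z i j (fst z) * partial_deriv j (partial_deriv i g) (V \<theta> z) \<partial>P"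
    let ?q = "\<lambda>i j. \<integral>z. partial_deriv j (partial_deriv i g) (V \<theta> z) \<partial>P"
    have "\<Phi>' \<theta> z = (\<Sum>i\<in>UNIV. cos \<theta> * (F (fst z) $ i * partial_deriv i g (V \<theta> z)) - sin \<theta> * (Y (snd z) $ i * partial_deriv i g (V \<theta> z)))" for z
      by (simp add: \<Phi>'_def algebra_simps)
    then have "(\<integral>z. \<Phi>' \<theta> z \<partial>P) = (\<Sum>i\<in>UNIV. cos \<theta> * ?a i - sin \<theta> * ?b i)"
      using square_integrable_mult[OF Fsq gi_sq] square_integrable_mult[OF Ysq gi_sq] by simp
    also have "\<dots> = cos \<theta> * (\<Sum>i\<in>UNIV. ?a i) - sin \<theta> * cos \<theta> * (\<Sum>i\<in>UNIV. \<Sum>j\<in>UNIV. C $ i $ j * ?q i j)"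
      unfolding YIBP by (simp add: sum_subtractf sum_distrib_left mult.assoc)
    also have "(\<Sum>i\<in>UNIV. ?a i) = A \<theta> + sin \<theta> * (\<Sum>i\<in>UNIV. \<Sum>j\<in>UNIV. ?h i j)"
      by (simp add: A_def)
    finally have "(\<integral>z. \<Phi>' \<theta> z \<partial>P) = cos \<theta> * (A \<theta> + sin \<theta> * (\<Sum>i\<in>UNIV. \<Sum>j\<in>UNIV. ?h i j))
      - sin \<theta> * cos \<theta> * (\<Sum>i\<in>UNIV. \<Sum>j\<in>UNIV. C $ i $ j * ?q i j)" .
    moreover have "(\<Sum>i\<in>UNIV. \<Sum>j\<in>UNIV. \<integral>z. (C $ i $ j - Z i j (fst z)) * partial_deriv j (partial_deriv i g) (V \<theta> z) \<partial>P)
        = (\<Sum>i\<in>UNIV. \<Sum>j\<in>UNIV. C $ i $ j * ?q i j) - (\<Sum>i\<in>UNIV. \<Sum>j\<in>UNIV. ?h i j)"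
      using gij_int Zgij by (simp add: left_diff_distrib sum_subtractf)
    \<comment> \<open>The integrals are abstracted to real variables, which leaves a pure ring
      identity.\<close>
    moreover have "a = c * A' - s * c * E" if "a = c * (A' + s * H) - s * c * Q" "E = Q - H" for a c s A' H Q E :: real
      unfolding that by (simp add: algebra_simps)
    ultimately show ?thesis by blast
  qed
  have K_bound: "\<bar>\<Sum>i\<in>UNIV. \<Sum>j\<in>UNIV. \<integral>z. (C $ i $ j - Z i j (fst z)) * partial_deriv j (partial_deriv i g) (V \<theta> z) \<partial>P\<bar> \<le> K" for \<theta>
    unfolding K_def sum_distrib_left
  proof (intro order_trans[OF sum_abs] sum_mono)
    fix i j
    have CZ: "integrable M (\<lambda>\<omega>. \<bar>C $ i $ j - Z i j \<omega>\<bar>)" using Z by simp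
    have "\<bar>\<integral>z. (C $ i $ j - Z i j (fst z)) * partial_deriv j (partial_deriv i g) (V \<theta> z) \<partial>P\<bar>
        \<le> (\<integral>z. \<bar>(C $ i $ j - Z i j (fst z)) * partial_deriv j (partial_deriv i g) (V \<theta> z)\<bar> \<partial>P)"
      by (rule integral_abs_bound)
    also have "\<dots> \<le> (\<integral>z. L * \<bar>C $ i $ j - Z i j (fst z)\<bar> \<partial>P)"
    proof (rule integral_mono)
      show "integrable P (\<lambda>z. \<bar>(C $ i $ j - Z i j (fst z)) * partial_deriv j (partial_deriv i g) (V \<theta> z)\<bar>)"
        using gij_int Zgij by (simp add: left_diff_distrib)
      show "integrable P (\<lambda>z. L * \<bar>C $ i $ j - Z i j (fst z)\<bar>)"
        using P.integrable_pair_fst[OF CZ] by (simp add: P_def)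
      show "\<bar>(C $ i $ j - Z i j (fst z)) * partial_deriv j (partial_deriv i g) (V \<theta> z)\<bar> \<le> L * \<bar>C $ i $ j - Z i j (fst z)\<bar>" for z
        using L by (simp add: abs_mult mult.commute mult_right_mono)
    qed
    also have "\<dots> = L * (\<integral>\<omega>. \<bar>C $ i $ j - Z i j \<omega>\<bar> \<partial>M)"
      using P.integral_fst'[OF P.integrable_pair_fst[OF CZ]] by (simp add: P_def prob_space)
    finally show "\<bar>\<integral>z. (C $ i $ j - Z i j (fst z)) * partial_deriv j (partial_deriv i g) (V \<theta> z) \<partial>P\<bar>
        \<le> L * (\<integral>\<omega>. \<bar>C $ i $ j - Z i j \<omega>\<bar> \<partial>M)" .
  qed
  \<comment> \<open>An antiderivative of the bound on the derivative of \<Psi>. Its value K/2 + R/3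
    at \<pi>/2 is the origin of both coefficients in the conclusion.\<close>
  define G where "G \<theta> = K * (sin \<theta>)\<^sup>2 / 2 + R * (sin \<theta>) ^ 3 / 3" for \<theta>
  have G_deriv: "(G has_real_derivative K * sin \<theta> * cos \<theta> + R * (sin \<theta>)\<^sup>2 * cos \<theta>) (at \<theta>)" for \<theta>
    unfolding G_def by (auto intro!: derivative_eq_intros simp: field_simps power2_eq_square)
  have \<Psi>'_bound: "\<bar>\<integral>z. \<Phi>' \<theta> z \<partial>P\<bar> \<le> K * sin \<theta> * cos \<theta> + R * (sin \<theta>)\<^sup>2 * cos \<theta>" if "0 \<le> \<theta>" "\<theta> \<le> pi / 2" for \<theta>
  proof -
    have s: "0 \<le> sin \<theta>" and c: "0 \<le> cos \<theta>"
      using that by (auto intro!: sin_ge_zero cos_ge_zero)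
    have "\<bar>\<integral>z. \<Phi>' \<theta> z \<partial>P\<bar> \<le> cos \<theta> * \<bar>A \<theta>\<bar> + sin \<theta> * cos \<theta> *
      \<bar>\<Sum>i\<in>UNIV. \<Sum>j\<in>UNIV. \<integral>z. (C $ i $ j - Z i j (fst z)) * partial_deriv j (partial_deriv i g) (V \<theta> z) \<partial>P\<bar>"
      unfolding \<Psi>'_eq using s c by (intro order_trans[OF abs_triangle_ineq4]) (simp add: abs_mult)
    also have "\<dots> \<le> cos \<theta> * ((sin \<theta>)\<^sup>2 * R) + sin \<theta> * cos \<theta> * K"
      using s c by (intro add_mono mult_left_mono A_bound K_bound mult_nonneg_nonneg)
    finally show ?thesis by (simp add: algebra_simps)
  qed
  \<comment> \<open>Monotonicity of \<Psi> - G and \<Psi> + G takes the place of integrating the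
    derivative of \<Psi>, so a pointwise bound on that derivative suffices.\<close>
  have "\<Psi> (pi / 2) - G (pi / 2) \<le> \<Psi> 0 - G 0"
  proof (rule DERIV_nonpos_imp_nonincreasing[of 0 "pi / 2" "\<lambda>\<theta>. \<Psi> \<theta> - G \<theta>"])
    fix \<theta> assume "0 \<le> \<theta>" "\<theta> \<le> pi / 2"
    note b = \<Psi>'_bound[OF this]
    show "\<exists>y. ((\<lambda>\<theta>. \<Psi> \<theta> - G \<theta>) has_real_derivative y) (at \<theta>) \<and> y \<le> 0"
      by (rule exI, rule conjI, rule DERIV_diff[OF \<Psi>_deriv G_deriv]) (use b in linarith)
  qed simp
  moreover have "\<Psi> 0 + G 0 \<le> \<Psi> (pi / 2) + G (pi / 2)"
  proof (rule DERIV_nonneg_imp_nondecreasing[of 0 "pi / 2" "\<lambda>\<theta>. \<Psi> \<theta> + G \<theta>"])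
    fix \<theta> assume "0 \<le> \<theta>" "\<theta> \<le> pi / 2"
    note b = \<Psi>'_bound[OF this]
    show "\<exists>y. ((\<lambda>\<theta>. \<Psi> \<theta> + G \<theta>) has_real_derivative y) (at \<theta>) \<and> 0 \<le> y"
      by (rule exI, rule conjI, rule DERIV_add[OF \<Psi>_deriv G_deriv]) (use b in linarith)
  qed simp
  moreover have "\<Psi> (pi / 2) = (\<integral>\<omega>. g (F \<omega>) \<partial>M)"
  proof -
    have "integrable M (\<lambda>\<omega>. g (F \<omega>))"
      by (rule integrable_Ck2[OF M.finite_measure_axioms Ck L F F_sq])
    from P.integral_fst'[OF P.integrable_pair_fst[OF this]] show ?thesis
      by (simp add: \<Psi>_def V_def P_def prob_space)
  qed
  moreover have "\<Psi> 0 = (\<integral>\<omega>. g (Y \<omega>) \<partial>N)"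
  proof -
    have "integrable N (\<lambda>\<omega>. g (Y \<omega>))"
      by (rule integrable_Ck2[OF finite_measure_axioms Ck L Y_measurable Y_sq])
    from P.integral_fst'[OF P.integrable_pair_snd[OF this]] show ?thesis
      by (simp add: \<Psi>_def V_def P_def M.prob_space)
  qed
  moreover have "G 0 = 0" "G (pi / 2) = L / 2 * (\<Sum>i\<in>UNIV. \<Sum>j\<in>UNIV. \<integral>\<omega>. \<bar>C $ i $ j - Z i j \<omega>\<bar> \<partial>M) + R / 3"
    by (simp_all add: G_def K_def)
  ultimately show ?thesis by linarith
qed

subsection \<open>Conditional expectations given independent variables\<close>

locale indep_sequence = prob_space M for M :: "'o measure" +
  fixes S :: "'a measure" and X :: "nat \<Rightarrow> 'o \<Rightarrow> 'a" and n :: nat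
  assumes indep: "indep_vars (\<lambda>_. S) X {1..n}"
begin

abbreviation sig :: "nat set \<Rightarrow> 'o measure" where "sig \<equiv> rv_sigma M S X"
abbreviation CE :: "nat set \<Rightarrow> ('o \<Rightarrow> real) \<Rightarrow> 'o \<Rightarrow> real" where "CE K \<equiv> real_cond_exp M (sig K)"

lemma X_measurable: "k \<in> {1..n} \<Longrightarrow> X k \<in> measurable M S"
  using indep by (simp add: indep_vars_def)

lemma sets_X: "k \<in> {1..n} \<Longrightarrow> sets (vimage_algebra (space M) (X k) S) = {X k -` A \<inter> space M | A. A \<in> sets S}"
  using X_measurable by (intro sets_vimage_algebra2) (auto simp: measurable_def)

lemma sig_generator_subset: "(\<Union>k\<in>K. sets (vimage_algebra (space M) (X k) S)) \<subseteq> Pow (space M)"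
  using sets.space_closed[of "vimage_algebra (space M) (X _) S"] by auto

lemma space_sig [simp]: "space (sig K) = space M"
  unfolding rv_sigma_def by (rule space_measure_of[OF sig_generator_subset])

lemma sets_sig: "sets (sig K) = sigma_sets (space M) (\<Union>k\<in>K. sets (vimage_algebra (space M) (X k) S))"
  unfolding rv_sigma_def by (rule sets_measure_of[OF sig_generator_subset])

lemma sets_sig_mono: "K \<subseteq> L \<Longrightarrow> sets (sig K) \<subseteq> sets (sig L)"
  unfolding sets_sig by (intro sigma_sets_mono') auto

lemma subalgebra_sig_sig: "K \<subseteq> L \<Longrightarrow> subalgebra (sig L) (sig K)"
  using sets_sig_mono by (simp add: subalgebra_def)

lemma subalgebra_sig:
  assumes K: "K \<subseteq> {1..n}"
  shows "subalgebra M (sig K)"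
proof -
  have "sets (vimage_algebra (space M) (X k) S) \<subseteq> events" if "k \<in> K" for k
    using X_measurable[OF subsetD[OF K that]] by (intro sets_image_in_sets) auto
  then have "(\<Union>k\<in>K. sets (vimage_algebra (space M) (X k) S)) \<subseteq> events" by (rule UN_least)
  from sets.sigma_sets_subset[OF this] show ?thesis
    by (simp add: subalgebra_def sets_sig)
qed

lemma cond_exp_sig: "K \<subseteq> {1..n} \<Longrightarrow> sigma_finite_subalgebra M (sig K)"
  using finite_measure_axioms subalgebra_sig
  by (intro finite_measure_subalgebra_is_sigma_finite)
     (simp add: finite_measure_subalgebra_def finite_measure_subalgebra_axioms_def)

lemma X_measurable_sig:
  assumes k: "k \<in> K" "K \<subseteq> {1..n}"
  shows "X k \<in> measurable (sig K) S"
proof (rule measurableI)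
  show "X k x \<in> space S" if "x \<in> space (sig K)" for x
    using that measurable_space[OF X_measurable[OF subsetD[OF k(2,1)]]] by simp
  show "X k -` A \<inter> space (sig K) \<in> sets (sig K)" if "A \<in> sets S" for A
    using that k by (auto simp: sets_sig intro!: sigma_sets.Basic in_vimage_algebra)
qed

lemma indep_sig:
  assumes "K \<subseteq> {1..n}" "J \<subseteq> {1..n}" "K \<inter> J = {}"
  shows "indep_set (sets (sig K)) (sets (sig J))"
proof -
  have "indep_sets (\<lambda>j. sigma_sets (space M) (\<Union>i\<in>(if j then K else J). {X i -` A \<inter> space M | A. A \<in> sets S})) UNIV"
  proof (rule indep_sets_collect_sigma)
    show "indep_sets (\<lambda>i. {X i -` A \<inter> space M | A. A \<in> sets S}) (\<Union>j\<in>UNIV. if j then K else J)"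
      using indep assms by (auto simp: indep_vars_def2 UNIV_bool intro: indep_sets_mono_index)
    show "Int_stable {X i -` A \<inter> space M | A. A \<in> sets S}" for i
    proof (rule Int_stableI)
      fix a b assume "a \<in> {X i -` A \<inter> space M | A. A \<in> sets S}" "b \<in> {X i -` A \<inter> space M | A. A \<in> sets S}"
      then obtain A B where "A \<in> sets S" "B \<in> sets S" "a = X i -` A \<inter> space M" "b = X i -` B \<inter> space M" by blast
      then show "a \<inter> b \<in> {X i -` A \<inter> space M | A. A \<in> sets S}"
        by (intro CollectI exI[of _ "A \<inter> B"]) auto
    qed
    show "disjoint_family (\<lambda>j. if j then K else J)"
      using assms(3) by (auto simp: disjoint_family_on_def)
  qed
  moreover have "(\<Union>i\<in>L. sets (vimage_algebra (space M) (X i) S)) = (\<Union>i\<in>L. {X i -` A \<inter> space M | A. A \<in> sets S})"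
    if "L \<subseteq> {1..n}" for L
    by (intro SUP_cong refl sets_X subsetD[OF that])
  ultimately show ?thesis
    using assms unfolding indep_set_def sets_sig
    by (elim indep_sets_cong[THEN iffD1, rotated 2]) (auto split: bool.split)
qed

lemma integral_mult_indep_indicator:
  assumes K: "K \<subseteq> {1..n}" "J \<subseteq> {1..n}" "K \<inter> J = {}"
    and U: "U \<in> borel_measurable (sig K)" "integrable M U" and D: "D \<in> sets (sig J)"
  shows "(\<integral>\<omega>. U \<omega> * indicator D \<omega> \<partial>M) = (\<integral>\<omega>. U \<omega> \<partial>M) * prob D"
proof -
  have DM [measurable]: "D \<in> events" using D subalgebra_sig[OF K(2)] by (auto simp: subalgebra_def)
  have "indep_var borel U borel (indicator D :: 'o \<Rightarrow> real)"
    unfolding indep_var_eq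
  proof (intro conjI)
    have "{U -` A \<inter> space M | A. A \<in> sets borel} \<subseteq> sets (sig K)"
      using measurable_sets[OF U(1)] by auto
    from sets.sigma_sets_subset[OF this]
    have "sigma_sets (space M) {U -` A \<inter> space M | A. A \<in> sets borel} \<subseteq> sets (sig K)" by simp
    moreover have "sigma_sets (space M) {(indicator D :: 'o \<Rightarrow> real) -` A \<inter> space M | A. A \<in> sets borel} \<subseteq> sets (sig J)"
    proof -
      have "(indicator D :: 'o \<Rightarrow> real) \<in> borel_measurable (sig J)" using D by simp
      from measurable_sets[OF this]
      have "{(indicator D :: 'o \<Rightarrow> real) -` A \<inter> space M | A. A \<in> sets borel} \<subseteq> sets (sig J)" by auto
      from sets.sigma_sets_subset[OF this] show ?thesis by simp
    qed
    ultimately show "indep_set (sigma_sets (space M) {U -` A \<inter> space M | A. A \<in> sets borel})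
        (sigma_sets (space M) {(indicator D :: 'o \<Rightarrow> real) -` A \<inter> space M | A. A \<in> sets borel})"
      using indep_sig[OF K] unfolding indep_set_def
      by (elim indep_sets_mono_sets) (auto split: bool.split)
  qed (use U in auto)
  then have "(\<integral>\<omega>. U \<omega> * indicator D \<omega> \<partial>M) = (\<integral>\<omega>. U \<omega> \<partial>M) * (\<integral>\<omega>. indicator D \<omega> \<partial>M)"
    using U(2) by (intro indep_var_lebesgue_integral integrable_real_indicator) (auto simp: emeasure_eq_measure)
  then show ?thesis by simp
qed

text \<open>The variables in \<open>L - K\<close> are independent of everything measurable for
  \<open>K\<close>, so they carry no information on \<open>V\<close>. On sets B \<inter> D with B
  from the common indices and D from \<open>L - K\<close>, the integrals of \<open>V\<close> and of
  the candidate both split off the probability of D; such sets form an intersection-stable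
  generator, and the Dynkin argument extends the equality.\<close>

lemma cond_exp_Int:
  assumes K: "K \<subseteq> {1..n}" and L: "L \<subseteq> {1..n}"
    and V: "V \<in> borel_measurable (sig K)" "integrable M V"
  shows "AE \<omega> in M. CE L V \<omega> = CE (K \<inter> L) V \<omega>"
proof -
  interpret L: sigma_finite_subalgebra M "sig L" by (rule cond_exp_sig[OF L])
  interpret KL: sigma_finite_subalgebra M "sig (K \<inter> L)" using K by (intro cond_exp_sig) auto
  let ?W = "CE (K \<inter> L) V"
  let ?E = "{B \<inter> D | B D. B \<in> sets (sig (K \<inter> L)) \<and> D \<in> sets (sig (L - K))}"
  have W: "integrable M ?W" "?W \<in> borel_measurable (sig (K \<inter> L))"
    using KL.real_cond_exp_int(1)[OF V(2)] by auto
  have inM: "A \<in> sets M" if "A \<in> sets (sig J)" "J \<subseteq> {1..n}" for A J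
    using that subalgebra_sig by (auto simp: subalgebra_def)
  have subs: "K \<inter> L \<subseteq> {1..n}" "L - K \<subseteq> {1..n}" using L by auto
  have E_sets: "?E \<subseteq> sets (sig L)"
    using sets_sig_mono[of "K \<inter> L" L] sets_sig_mono[of "L - K" L] by auto
  have gen: "sets (sig L) = sigma_sets (space M) ?E"
  proof
    show "sigma_sets (space M) ?E \<subseteq> sets (sig L)"
      using sets.sigma_sets_subset[OF E_sets] by simp
    have "sets (vimage_algebra (space M) (X k) S) \<subseteq> ?E" if "k \<in> L" for k
    proof
      fix A assume A: "A \<in> sets (vimage_algebra (space M) (X k) S)"
      then have As: "A \<subseteq> space M" using sets.sets_into_space by fastforce
      have top: "space M \<in> sets (sig J)" for J using sets.top[of "sig J"] by simp
      show "A \<in> ?E"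
      proof (cases "k \<in> K")
        case True
        then have "A \<in> sets (sig (K \<inter> L))" using A that unfolding sets_sig by (intro sigma_sets.Basic) auto
        moreover have "A = A \<inter> space M" using As by auto
        ultimately show ?thesis using top by blast
      next
        case False
        then have "A \<in> sets (sig (L - K))" using A that unfolding sets_sig by (intro sigma_sets.Basic) auto
        moreover have "A = space M \<inter> A" using As by auto
        ultimately show ?thesis using top by blast
      qed
    qed
    then show "sets (sig L) \<subseteq> sigma_sets (space M) ?E"
      unfolding sets_sig[of L] by (intro sigma_sets_mono') auto
  qed
  show ?thesis
  proof (rule L.real_cond_exp_charact)
    show "?W \<in> borel_measurable (sig L)"
      by (rule measurable_from_subalg[OF subalgebra_sig_sig W(2)]) simp
    fix A assume A: "A \<in> sets (sig L)"
    have int: "set_integrable M A V" "set_integrable M A ?W" if "A \<in> events" for A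
      unfolding set_integrable_def by (rule integrable_mult_indicator[OF that V(2)], rule integrable_mult_indicator[OF that W(1)])
    have "Int_stable ?E"
    proof (rule Int_stableI)
      fix a b assume "a \<in> ?E" "b \<in> ?E"
      then obtain B D B' D' where "a = B \<inter> D" "b = B' \<inter> D'" "B \<in> sets (sig (K \<inter> L))" "B' \<in> sets (sig (K \<inter> L))"
        "D \<in> sets (sig (L - K))" "D' \<in> sets (sig (L - K))" by blast
      then show "a \<inter> b \<in> ?E"
        by (intro CollectI exI[of _ "B \<inter> B'"] exI[of _ "D \<inter> D'"]) auto
    qed
    moreover have "?E \<subseteq> Pow (space M)" using E_sets sets.space_closed[of "sig L"] by auto
    moreover note A[unfolded gen]
    ultimately show "(\<integral>\<omega>\<in>A. V \<omega> \<partial>M) = (\<integral>\<omega>\<in>A. ?W \<omega> \<partial>M)"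
    proof (induction rule: sigma_sets_induct_disjoint)
      case (basic A)
      then obtain B D where A: "A = B \<inter> D" and B: "B \<in> sets (sig (K \<inter> L))" and D: "D \<in> sets (sig (L - K))" by blast
      have BM: "B \<in> events" using inM[OF B] subs by auto
      have BK: "B \<in> sets (sig K)" using B sets_sig_mono[of "K \<inter> L" K] by auto
      have WK: "?W \<in> borel_measurable (sig K)"
        by (rule measurable_from_subalg[OF subalgebra_sig_sig W(2)]) simp
      \<comment> \<open>The product of \<open>U\<close> and the indicator of \<open>B\<close> is
        still measurable for \<open>K\<close>, hence independent of \<open>D\<close>.\<close>
      have prod: "(\<integral>\<omega>\<in>A. U \<omega> \<partial>M) = (\<integral>\<omega>\<in>B. U \<omega> \<partial>M) * prob D"
        if U: "U \<in> borel_measurable (sig K)" "integrable M U" for U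
      proof -
        have "(\<integral>\<omega>\<in>A. U \<omega> \<partial>M) = (\<integral>\<omega>. (indicator B \<omega> * U \<omega>) * indicator D \<omega> \<partial>M)"
          unfolding set_lebesgue_integral_def A
          by (intro Bochner_Integration.integral_cong) (auto simp: indicator_def)
        also have "\<dots> = (\<integral>\<omega>. indicator B \<omega> * U \<omega> \<partial>M) * prob D"
          using U BK BM D K subs integrable_mult_indicator[OF BM U(2)]
          by (intro integral_mult_indep_indicator[where J="L - K"]) auto
        finally show ?thesis by (simp add: set_lebesgue_integral_def)
      qed
      show ?case
        using prod[OF V] prod[OF WK W(1)] KL.real_cond_exp_intA[OF V(2) B] by simp
    next
      case empty
      then show ?case by (simp add: set_lebesgue_integral_def)
    next
      case (compl A)
      have AM: "A \<in> events" using compl.hyps inM[of A L] L gen by simp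
      have "(\<integral>\<omega>\<in>space M - A. U \<omega> \<partial>M) = (\<integral>\<omega>. U \<omega> \<partial>M) - (\<integral>\<omega>\<in>A. U \<omega> \<partial>M)" if "integrable M U"
        for U :: "'o \<Rightarrow> real"
      proof -
        have "(\<integral>\<omega>\<in>space M - A. U \<omega> \<partial>M) = (\<integral>\<omega>. U \<omega> - indicator A \<omega> *\<^sub>R U \<omega> \<partial>M)"
          unfolding set_lebesgue_integral_def by (intro Bochner_Integration.integral_cong) (auto simp: indicator_def)
        then show ?thesis
          using that integrable_mult_indicator[OF AM that] by (simp add: set_lebesgue_integral_def)
      qed
      then show ?case using V(2) W(1) compl.IH KL.real_cond_exp_int(2)[OF V(2)] by simp
    next
      case (union A)
      have AM: "A i \<in> events" for i using union.hyps inM[of "A i" L] L gen by auto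
      then have U: "(\<Union>i. A i) \<in> events" by auto
      have disj: "\<And>i j. i \<noteq> j \<Longrightarrow> A i \<inter> A j = {}" using union.hyps by (auto simp: disjoint_family_on_def)
      show ?case
        using lebesgue_integral_countable_add[OF AM disj int(1)[OF U]] lebesgue_integral_countable_add[OF AM disj int(2)[OF U]] union.IH
        by simp
    qed
  qed (use V W in auto)
qed

text \<open>Unlike the tower property, this holds for index sets that are not nested, by
  independence. It reduces all later identities for difference operators to set algebra on
  indices.\<close>

lemma cond_exp_cond_exp:
  assumes K: "K \<subseteq> {1..n}" and L: "L \<subseteq> {1..n}" and U: "integrable M U"
  shows "AE \<omega> in M. CE L (CE K U) \<omega> = CE (K \<inter> L) U \<omega>"
proof -
  interpret K: sigma_finite_subalgebra M "sig K" by (rule cond_exp_sig[OF K])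
  interpret KL: sigma_finite_subalgebra M "sig (K \<inter> L)" using K by (intro cond_exp_sig) auto
  have "AE \<omega> in M. CE L (CE K U) \<omega> = CE (K \<inter> L) (CE K U) \<omega>"
    by (rule cond_exp_Int[OF K L]) (use U in auto)
  moreover have "AE \<omega> in M. CE (K \<inter> L) (CE K U) \<omega> = CE (K \<inter> L) U \<omega>"
    by (rule KL.real_cond_exp_nested_subalg[OF subalgebra_sig[OF K] subalgebra_sig_sig U]) auto
  ultimately show ?thesis by eventually_elim simp
qed

lemma cond_exp_empty:
  assumes U: "integrable M U"
  shows "AE \<omega> in M. CE {} U \<omega> = expectation U"
proof -
  interpret E: sigma_finite_subalgebra M "sig {}" by (rule cond_exp_sig) simp
  show ?thesis
  proof (rule E.real_cond_exp_charact)
    fix A assume "A \<in> sets (sig {})"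
    then have "A = {} \<or> A = space M" by (simp add: sets_sig sigma_sets_empty_eq)
    then show "(\<integral>\<omega>\<in>A. U \<omega> \<partial>M) = (\<integral>\<omega>\<in>A. expectation U \<partial>M)"
      using U by (auto simp: set_lebesgue_integral_def prob_space cong: Bochner_Integration.integral_cong)
  qed (use U in auto)
qed

end

subsection \<open>Difference operators\<close>

lemma sum_telescope_up: fixes n :: nat shows "(\<Sum>k=1..n. a k - a (k - 1)) = a n - (a 0 :: real)"
  by (induction n) auto

lemma sum_telescope_down: fixes n :: nat shows "(\<Sum>k=1..n. a k - a (Suc k)) = a 1 - (a (Suc n) :: real)"
  by (induction n) auto

lemma convex_on_abs_cubed: "convex_on UNIV (\<lambda>x::real. \<bar>x\<bar> ^ 3)"
proof (rule convex_onI)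
  fix t x y :: real assume t: "0 < t" "t < 1"
  have "\<bar>(1 - t) * x + t * y\<bar> \<le> \<bar>(1 - t) * x\<bar> + \<bar>t * y\<bar>"
    by (rule abs_triangle_ineq)
  also have "\<dots> = (1 - t) * \<bar>x\<bar> + t * \<bar>y\<bar>"
    using t by (simp only: abs_mult)
  finally have "\<bar>(1 - t) *\<^sub>R x + t *\<^sub>R y\<bar> ^ 3 \<le> ((1 - t) *\<^sub>R \<bar>x\<bar> + t *\<^sub>R \<bar>y\<bar>) ^ 3"
    unfolding real_scaleR_def by (rule power_mono) (rule abs_ge_zero)
  also have "\<dots> \<le> (1 - t) * \<bar>x\<bar> ^ 3 + t * \<bar>y\<bar> ^ 3"
    by (rule convex_onD[OF convex_power_odd]) (use t in simp_all)
  finally show "\<bar>(1 - t) *\<^sub>R x + t *\<^sub>R y\<bar> ^ 3 \<le> (1 - t) * \<bar>x\<bar> ^ 3 + t * \<bar>y\<bar> ^ 3" .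
qed (rule convex_UNIV)

lemma convex_on_square: "convex_on UNIV (\<lambda>x::real. x\<^sup>2)"
  using convex_power_even[of 2] by simp

section \<open>Martingale increments and orthogonality\<close>

context indep_sequence
begin

abbreviation DO :: "nat \<Rightarrow> ('o \<Rightarrow> real) \<Rightarrow> 'o \<Rightarrow> real" where "DO \<equiv> diff_op M S X n"
abbreviation DM :: "real \<Rightarrow> nat \<Rightarrow> ('o \<Rightarrow> real) \<Rightarrow> 'o \<Rightarrow> real" where "DM \<equiv> diff_op_mix M S X n"

lemma square_integrable_cond_exp:
  assumes K: "K \<subseteq> {1..n}" and U: "square_integrable M U"
  shows "square_integrable M (CE K U)"
  unfolding square_integrable_def
proof
  interpret K: sigma_finite_subalgebra M "sig K" by (rule cond_exp_sig[OF K])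
  show "CE K U \<in> borel_measurable M" by simp
  have int: "integrable M U" "integrable M (\<lambda>\<omega>. (U \<omega>)\<^sup>2)"
    using U square_integrable_integrable[OF finite_measure_axioms U] by (auto simp: square_integrable_def)
  have J: "AE \<omega> in M. (CE K U \<omega>)\<^sup>2 \<le> CE K (\<lambda>\<omega>. (U \<omega>)\<^sup>2) \<omega>"
    by (rule K.real_cond_exp_jensens_inequality(2)[where I=UNIV]) (simp_all add: int convex_on_square)
  show "integrable M (\<lambda>\<omega>. (CE K U \<omega>)\<^sup>2)"
  proof (rule Bochner_Integration.integrable_bound[OF K.real_cond_exp_int(1)[OF int(2)]])
    show "AE \<omega> in M. norm ((CE K U \<omega>)\<^sup>2) \<le> norm (CE K (\<lambda>\<omega>. (U \<omega>)\<^sup>2) \<omega>)"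
      using J by eventually_elim simp
  qed simp
qed

lemma square_integrable_diff_op: "square_integrable M U \<Longrightarrow> square_integrable M (DO k U)"
  unfolding diff_op_def by (intro square_integrable_diff square_integrable_cond_exp) auto

lemma square_integrable_diff_op_mix:
  assumes "k \<in> {1..n}" "square_integrable M U"
  shows "square_integrable M (DM \<alpha> k U)"
  unfolding diff_op_mix_def using assms
  by (intro square_integrable_add square_integrable_cmult square_integrable_cond_exp square_integrable_diff_op) auto

lemma integrable_diff_op:
  assumes U: "integrable M U" shows "integrable M (DO k U)"
proof -
  interpret K: sigma_finite_subalgebra M "sig ({1..n} - {k})" by (rule cond_exp_sig) auto
  show ?thesis unfolding diff_op_def using U by (intro Bochner_Integration.integrable_diff K.real_cond_exp_int)
qed

text \<open>Averaging out the k-th variable and then conditioning on \<open>L\<close> leaves the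
  indices \<open>L - {k}\<close>; if \<open>k\<close> is not in \<open>L\<close>, the two terms
  cancel.\<close>

lemma cond_exp_diff_op:
  assumes L: "L \<subseteq> {1..n}" and U: "integrable M U"
  shows "AE \<omega> in M. CE L (DO k U) \<omega> = CE L U \<omega> - CE (L - {k}) U \<omega>"
proof -
  let ?K = "{1..n} - {k}"
  interpret K: sigma_finite_subalgebra M "sig ?K" by (rule cond_exp_sig) auto
  interpret L: sigma_finite_subalgebra M "sig L" by (rule cond_exp_sig[OF L])
  have "AE \<omega> in M. CE L (DO k U) \<omega> = CE L U \<omega> - CE L (CE ?K U) \<omega>"
    unfolding diff_op_def by (intro L.real_cond_exp_diff U K.real_cond_exp_int)
  moreover have "AE \<omega> in M. CE L (CE ?K U) \<omega> = CE (L - {k}) U \<omega>"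
  proof -
    have "?K \<inter> L = L - {k}" using L by auto
    then show ?thesis using cond_exp_cond_exp[OF _ L U, of ?K] by simp
  qed
  ultimately show ?thesis by eventually_elim simp
qed

text \<open>Conditioned on the past up to k, the differences are martingale increments; conditioned
  on the future from k on, reverse martingale increments. Each family telescopes to \<open>U\<close>
  minus its mean, and hence so does the mixture.\<close>

lemma sum_diff_op_mix:
  assumes U: "integrable M U" "U \<in> borel_measurable (sig {1..n})" "expectation U = 0"
  shows "AE \<omega> in M. (\<Sum>k=1..n. DM \<alpha> k U \<omega>) = U \<omega>"
proof -
  interpret F: sigma_finite_subalgebra M "sig {1..n}" by (rule cond_exp_sig) simp
  have "AE \<omega> in M. \<forall>k\<in>{1..n}. DM \<alpha> k U \<omega> = \<alpha> * (CE {1..k} U \<omega> - CE {1..k - 1} U \<omega>)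
      + (1 - \<alpha>) * (CE {k..n} U \<omega> - CE {Suc k..n} U \<omega>)"
  proof (subst AE_ball_countable, simp, intro ballI)
    fix k assume k: "k \<in> {1..n}"
    have eq: "{1..k} - {k} = {1..k - 1}" "{k..n} - {k} = {Suc k..n}" by auto
    have sub: "{1..k} \<subseteq> {1..n}" "{k..n} \<subseteq> {1..n}" using k by auto
    have "AE \<omega> in M. CE {1..k} (DO k U) \<omega> = CE {1..k} U \<omega> - CE {1..k - 1} U \<omega>"
      using cond_exp_diff_op[OF sub(1) U(1), of k] unfolding eq .
    moreover have "AE \<omega> in M. CE {k..n} (DO k U) \<omega> = CE {k..n} U \<omega> - CE {Suc k..n} U \<omega>"
      using cond_exp_diff_op[OF sub(2) U(1), of k] unfolding eq .
    ultimately show "AE \<omega> in M. DM \<alpha> k U \<omega> = \<alpha> * (CE {1..k} U \<omega> - CE {1..k - 1} U \<omega>)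
      + (1 - \<alpha>) * (CE {k..n} U \<omega> - CE {Suc k..n} U \<omega>)"
      by eventually_elim (simp only: diff_op_mix_def)
  qed
  moreover have "AE \<omega> in M. CE {1..n} U \<omega> = U \<omega>"
    by (rule F.real_cond_exp_F_meas[OF U(1,2)])
  moreover have "AE \<omega> in M. CE {} U \<omega> = 0"
    using cond_exp_empty[OF U(1)] U(3) by simp
  ultimately show ?thesis
  proof eventually_elim
    case (elim \<omega>)
    have "(\<Sum>k=1..n. DM \<alpha> k U \<omega>) = \<alpha> * (\<Sum>k=1..n. CE {1..k} U \<omega> - CE {1..k - 1} U \<omega>)
      + (1 - \<alpha>) * (\<Sum>k=1..n. CE {k..n} U \<omega> - CE {Suc k..n} U \<omega>)"
      using elim(1) by (simp add: sum.distrib sum_distrib_left)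
    \<comment> \<open>The index sets \<open>{1..0}\<close> and \<open>{Suc n..n}\<close> left by the
      two telescopes are empty, so these terms are the mean, which is 0.\<close>
    also have "\<dots> = \<alpha> * (CE {1..n} U \<omega> - CE {1..0} U \<omega>) + (1 - \<alpha>) * (CE {1..n} U \<omega> - CE {Suc n..n} U \<omega>)"
      by (simp only: sum_telescope_up[of "\<lambda>k. CE {1..k} U \<omega>"] sum_telescope_down[of "\<lambda>k. CE {k..n} U \<omega>"])
    also have "\<dots> = U \<omega>"
      using elim(2,3) by (simp add: algebra_simps)
    finally show ?case .
  qed
qed

text \<open>Intersecting any \<open>L\<close> with the complement of \<open>k\<close> gives a set
  that does not change when \<open>k\<close> is removed, so the two terms of
  \<open>cond_exp_diff_op\<close> coincide.\<close>

lemma cond_exp_diff_op_mix: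
  assumes k: "k \<in> {1..n}" and U: "integrable M U"
  shows "AE \<omega> in M. CE ({1..n} - {k}) (DM \<alpha> k U) \<omega> = 0"
proof -
  let ?K = "{1..n} - {k}"
  interpret K: sigma_finite_subalgebra M "sig ?K" by (rule cond_exp_sig) auto
  have zero: "AE \<omega> in M. CE ?K (CE L (DO k U)) \<omega> = 0" and int: "integrable M (CE L (DO k U))"
    if L: "L \<subseteq> {1..n}" for L
  proof -
    interpret L: sigma_finite_subalgebra M "sig L" by (rule cond_exp_sig[OF L])
    show "integrable M (CE L (DO k U))" by (intro L.real_cond_exp_int integrable_diff_op U)
    have "AE \<omega> in M. CE ?K (CE L (DO k U)) \<omega> = CE (L \<inter> ?K) (DO k U) \<omega>"
      using L by (intro cond_exp_cond_exp integrable_diff_op U) auto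
    moreover have "AE \<omega> in M. CE (L \<inter> ?K) (DO k U) \<omega> = CE (L \<inter> ?K) U \<omega> - CE (L \<inter> ?K - {k}) U \<omega>"
      using L by (intro cond_exp_diff_op U) auto
    ultimately have "AE \<omega> in M. CE ?K (CE L (DO k U)) \<omega> = CE (L \<inter> ?K) U \<omega> - CE (L \<inter> ?K - {k}) U \<omega>"
      by eventually_elim (rule trans)
    moreover have "L \<inter> ?K - {k} = L \<inter> ?K" by auto
    ultimately show "AE \<omega> in M. CE ?K (CE L (DO k U)) \<omega> = 0" by (simp only: diff_self)
  qed
  let ?a = "CE {1..k} (DO k U)" and ?b = "CE {k..n} (DO k U)"
  have "{1..k} \<subseteq> {1..n}" "{k..n} \<subseteq> {1..n}" using k by auto
  note ab = this[THEN int] this[THEN zero]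
  have "AE \<omega> in M. CE ?K (DM \<alpha> k U) \<omega> = CE ?K (\<lambda>\<omega>. \<alpha> * ?a \<omega>) \<omega> + CE ?K (\<lambda>\<omega>. (1 - \<alpha>) * ?b \<omega>) \<omega>"
    unfolding diff_op_mix_def using ab by (intro K.real_cond_exp_add) auto
  moreover have "AE \<omega> in M. CE ?K (\<lambda>\<omega>. \<alpha> * ?a \<omega>) \<omega> = \<alpha> * CE ?K ?a \<omega>"
    "AE \<omega> in M. CE ?K (\<lambda>\<omega>. (1 - \<alpha>) * ?b \<omega>) \<omega> = (1 - \<alpha>) * CE ?K ?b \<omega>"
    using ab by (intro K.real_cond_exp_cmult; simp)+
  ultimately show ?thesis using ab(3,4) by eventually_elim simp
qed

text \<open>Used twice: to subtract from a test function its version free of the k-th variable, and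
  to compute the mean of \<open>Z\<close>.\<close>

lemma integral_diff_op_mix_orthogonal:
  assumes k: "k \<in> {1..n}" and U: "integrable M U"
    and H: "H \<in> borel_measurable (sig ({1..n} - {k}))" and int: "integrable M (\<lambda>\<omega>. H \<omega> * DM \<alpha> k U \<omega>)"
  shows "(\<integral>\<omega>. H \<omega> * DM \<alpha> k U \<omega> \<partial>M) = 0"
proof -
  let ?K = "{1..n} - {k}"
  interpret K: sigma_finite_subalgebra M "sig ?K" by (rule cond_exp_sig) auto
  have "DM \<alpha> k U \<in> borel_measurable M" unfolding diff_op_mix_def by simp
  then have "(\<integral>\<omega>. H \<omega> * DM \<alpha> k U \<omega> \<partial>M) = (\<integral>\<omega>. H \<omega> * CE ?K (DM \<alpha> k U) \<omega> \<partial>M)"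
    using K.real_cond_exp_intg(2)[OF int H] by simp
  also have "\<dots> = 0"
  proof (rule integral_eq_zero_AE)
    show "AE \<omega> in M. H \<omega> * CE ?K (DM \<alpha> k U) \<omega> = 0"
      using cond_exp_diff_op_mix[OF k U, of \<alpha>] by eventually_elim simp
  qed
  finally show ?thesis .
qed

text \<open>Jensen's inequality if the third moment of \<open>V\<close> is finite; otherwise the
  right-hand side is \<infinity>.\<close>

lemma nn_integral_cond_exp_cubed_le:
  assumes K: "K \<subseteq> {1..n}" and V: "integrable M V"
  shows "(\<integral>\<^sup>+\<omega>. ennreal (\<bar>CE K V \<omega>\<bar> ^ 3) \<partial>M) \<le> (\<integral>\<^sup>+\<omega>. ennreal (\<bar>V \<omega>\<bar> ^ 3) \<partial>M)"
proof (cases "integrable M (\<lambda>\<omega>. \<bar>V \<omega>\<bar> ^ 3)")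
  case True
  interpret K: sigma_finite_subalgebra M "sig K" by (rule cond_exp_sig[OF K])
  have J: "AE \<omega> in M. \<bar>CE K V \<omega>\<bar> ^ 3 \<le> CE K (\<lambda>\<omega>. \<bar>V \<omega>\<bar> ^ 3) \<omega>"
    by (rule K.real_cond_exp_jensens_inequality(2)[where I=UNIV]) (simp_all add: V True convex_on_abs_cubed)
  then have nn: "AE \<omega> in M. 0 \<le> CE K (\<lambda>\<omega>. \<bar>V \<omega>\<bar> ^ 3) \<omega>"
    by eventually_elim (rule order_trans[rotated], assumption, simp)
  have "(\<integral>\<^sup>+\<omega>. ennreal (\<bar>CE K V \<omega>\<bar> ^ 3) \<partial>M) \<le> (\<integral>\<^sup>+\<omega>. ennreal (CE K (\<lambda>\<omega>. \<bar>V \<omega>\<bar> ^ 3) \<omega>) \<partial>M)"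
    using J by (intro nn_integral_mono_AE) (auto intro: ennreal_leI)
  also have "\<dots> = ennreal (\<integral>\<omega>. \<bar>V \<omega>\<bar> ^ 3 \<partial>M)"
    using K.real_cond_exp_int[OF True] nn by (simp add: nn_integral_eq_integral)
  also have "\<dots> = (\<integral>\<^sup>+\<omega>. ennreal (\<bar>V \<omega>\<bar> ^ 3) \<partial>M)"
    using True by (simp add: nn_integral_eq_integral)
  finally show ?thesis .
next
  case False
  have "(\<integral>\<^sup>+\<omega>. ennreal (\<bar>V \<omega>\<bar> ^ 3) \<partial>M) = \<infinity>"
  proof (rule ccontr)
    assume "(\<integral>\<^sup>+\<omega>. ennreal (\<bar>V \<omega>\<bar> ^ 3) \<partial>M) \<noteq> \<infinity>"
    then have "integrable M (\<lambda>\<omega>. \<bar>V \<omega>\<bar> ^ 3)"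
      using V by (intro integrableI_bounded) (auto simp: less_top)
    with False show False by simp
  qed
  then show ?thesis by simp
qed

text \<open>The mixture is a convex combination of two conditional expectations of the plain
  difference: convexity of the absolute cube is combined with the contraction property. Here the
  range of \<open>\<alpha>\<close> enters.\<close>

lemma nn_integral_diff_op_mix_cubed_le:
  assumes k: "k \<in> {1..n}" and U: "integrable M U" and \<alpha>: "0 \<le> \<alpha>" "\<alpha> \<le> 1"
  shows "(\<integral>\<^sup>+\<omega>. ennreal (\<bar>DM \<alpha> k U \<omega>\<bar> ^ 3) \<partial>M) \<le> (\<integral>\<^sup>+\<omega>. ennreal (\<bar>DO k U \<omega>\<bar> ^ 3) \<partial>M)"
proof -
  let ?a = "CE {1..k} (DO k U)" and ?b = "CE {k..n} (DO k U)" and ?T = "\<integral>\<^sup>+\<omega>. ennreal (\<bar>DO k U \<omega>\<bar> ^ 3) \<partial>M"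
  have "\<bar>DM \<alpha> k U \<omega>\<bar> ^ 3 \<le> \<alpha> * \<bar>?a \<omega>\<bar> ^ 3 + (1 - \<alpha>) * \<bar>?b \<omega>\<bar> ^ 3" for \<omega>
    using convex_onD[OF convex_on_abs_cubed, of "1 - \<alpha>" "?a \<omega>" "?b \<omega>"] \<alpha> by (simp add: diff_op_mix_def)
  then have "(\<integral>\<^sup>+\<omega>. ennreal (\<bar>DM \<alpha> k U \<omega>\<bar> ^ 3) \<partial>M)
      \<le> (\<integral>\<^sup>+\<omega>. ennreal \<alpha> * ennreal (\<bar>?a \<omega>\<bar> ^ 3) + ennreal (1 - \<alpha>) * ennreal (\<bar>?b \<omega>\<bar> ^ 3) \<partial>M)"
    using \<alpha> by (intro nn_integral_mono) (simp add: ennreal_leI flip: ennreal_mult ennreal_plus)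
  also have "\<dots> = ennreal \<alpha> * (\<integral>\<^sup>+\<omega>. ennreal (\<bar>?a \<omega>\<bar> ^ 3) \<partial>M) + ennreal (1 - \<alpha>) * (\<integral>\<^sup>+\<omega>. ennreal (\<bar>?b \<omega>\<bar> ^ 3) \<partial>M)"
    by (simp add: nn_integral_add nn_integral_cmult)
  also have "\<dots> \<le> ennreal \<alpha> * ?T + ennreal (1 - \<alpha>) * ?T"
    using k by (intro add_mono mult_left_mono nn_integral_cond_exp_cubed_le integrable_diff_op U) auto
  also have "\<dots> = ?T"
  proof -
    have "ennreal \<alpha> + ennreal (1 - \<alpha>) = 1"
      using \<alpha> by (subst ennreal_plus[symmetric]) auto
    then show ?thesis by (simp add: distrib_right[symmetric])
  qed
  finally show ?thesis .
qed

end

subsection \<open>The approximate Stein identity\<close>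

lemma borel_measurable_vec:
  fixes V :: "'a \<Rightarrow> real ^ 'd::finite"
  assumes "\<And>i. (\<lambda>\<omega>. V \<omega> $ i) \<in> borel_measurable M"
  shows "V \<in> borel_measurable M"
  unfolding borel_measurable_euclidean_space[of V]
  using assms by (auto simp: Basis_vec_def inner_axis)

text \<open>The inequality of arithmetic and geometric means for three cubes, from the factorisation
  of p^3 + q^3 + r^3 - 3 p q r as (p + q + r)/2 times a sum of squares of differences.\<close>

lemma abs_mult3_le_cubes:
  fixes x y z :: real
  shows "\<bar>x\<bar> * (\<bar>y\<bar> * \<bar>z\<bar>) \<le> (\<bar>x\<bar> ^ 3 + \<bar>y\<bar> ^ 3 + \<bar>z\<bar> ^ 3) / 3"
proof -
  have "p * (q * r) \<le> (p ^ 3 + q ^ 3 + r ^ 3) / 3" if "0 \<le> p" "0 \<le> q" "0 \<le> r" for p q r :: real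
  proof -
    have "0 \<le> (p + q + r) * ((p - q)\<^sup>2 + (q - r)\<^sup>2 + (r - p)\<^sup>2)"
      using that by (intro mult_nonneg_nonneg add_nonneg_nonneg) auto
    also have "\<dots> = 2 * (p ^ 3 + q ^ 3 + r ^ 3 - 3 * (p * (q * r)))"
      by (simp add: power2_eq_square power3_eq_cube algebra_simps)
    finally show ?thesis by simp
  qed
  then show ?thesis by simp
qed

text \<open>Nonnegativity of the variance of |V - E V| bounds its squared mean by the variance of
  \<open>V\<close>.\<close>

lemma nn_integral_abs_le_sqrt_variance:
  assumes "prob_space M" and V: "integrable M V"
  shows "(\<integral>\<^sup>+\<omega>. ennreal \<bar>V \<omega> - (\<integral>\<omega>'. V \<omega>' \<partial>M)\<bar> \<partial>M) \<le> sqrt_ennreal (nn_variance M V)"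
proof (cases "nn_variance M V = \<infinity>")
  case True
  then show ?thesis by (simp add: sqrt_ennreal_def)
next
  case False
  interpret prob_space M by fact
  define U where "U \<omega> = V \<omega> - expectation V" for \<omega>
  have U: "integrable M U" unfolding U_def using V by simp
  then have [measurable]: "U \<in> borel_measurable M" by auto
  have v: "nn_variance M V = (\<integral>\<^sup>+\<omega>. ennreal ((U \<omega>)\<^sup>2) \<partial>M)"
    by (simp add: nn_variance_def U_def)
  have U2: "integrable M (\<lambda>\<omega>. (U \<omega>)\<^sup>2)"
    using False by (intro integrableI_bounded) (auto simp: v less_top)
  have "0 \<le> variance (\<lambda>\<omega>. \<bar>U \<omega>\<bar>)" by (rule variance_positive)
  also have "\<dots> = expectation (\<lambda>\<omega>. (U \<omega>)\<^sup>2) - (expectation (\<lambda>\<omega>. \<bar>U \<omega>\<bar>))\<^sup>2"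
    using U U2 by (subst variance_eq) auto
  finally have "(expectation (\<lambda>\<omega>. \<bar>U \<omega>\<bar>))\<^sup>2 \<le> expectation (\<lambda>\<omega>. (U \<omega>)\<^sup>2)" by simp
  then have "expectation (\<lambda>\<omega>. \<bar>U \<omega>\<bar>) \<le> sqrt (expectation (\<lambda>\<omega>. (U \<omega>)\<^sup>2))"
    by (rule real_le_rsqrt)
  moreover have "enn2real (nn_variance M V) = expectation (\<lambda>\<omega>. (U \<omega>)\<^sup>2)"
    using U2 by (simp add: v nn_integral_eq_integral)
  moreover have "(\<integral>\<^sup>+\<omega>. ennreal \<bar>U \<omega>\<bar> \<partial>M) = ennreal (expectation (\<lambda>\<omega>. \<bar>U \<omega>\<bar>))"
    using U by (simp add: nn_integral_eq_integral)
  ultimately show ?thesis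
    using False by (simp add: sqrt_ennreal_def U_def ennreal_leI)
qed

locale indep_functional = indep_sequence M S X n
  for M :: "'o measure" and S :: "'a measure" and X :: "nat \<Rightarrow> 'o \<Rightarrow> 'a" and n :: nat +
  fixes F :: "'o \<Rightarrow> real ^ 'd::finite" and \<alpha> :: real
  assumes F_measurable_sig: "\<And>i. (\<lambda>\<omega>. F \<omega> $ i) \<in> borel_measurable (sig {1..n})"
    and F_sq: "\<And>i. square_integrable M (\<lambda>\<omega>. F \<omega> $ i)"
    and F_mean: "\<And>i. (\<integral>\<omega>. F \<omega> $ i \<partial>M) = 0"
    and \<alpha>: "0 \<le> \<alpha>" "\<alpha> \<le> 1"
begin

abbreviation Fi :: "'d \<Rightarrow> 'o \<Rightarrow> real" where "Fi i \<equiv> \<lambda>\<omega>. F \<omega> $ i"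
abbreviation a :: "nat \<Rightarrow> 'd \<Rightarrow> 'o \<Rightarrow> real" where "a k i \<equiv> DM \<alpha> k (Fi i)"
abbreviation b :: "nat \<Rightarrow> 'd \<Rightarrow> 'o \<Rightarrow> real" where "b k i \<equiv> DO k (Fi i)"
abbreviation Z :: "'d \<Rightarrow> 'd \<Rightarrow> 'o \<Rightarrow> real" where "Z \<equiv> Z_mix M S X n \<alpha> F"

lemma F_measurable: "F \<in> borel_measurable M"
  using F_sq by (intro borel_measurable_vec square_integrable_measurable)

lemma F_int: "integrable M (Fi i)"
  by (rule square_integrable_integrable[OF finite_measure_axioms F_sq])

lemma b_sq: "square_integrable M (b k i)"
  by (rule square_integrable_diff_op[OF F_sq])

lemma a_sq: "k \<in> {1..n} \<Longrightarrow> square_integrable M (a k i)"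
  by (rule square_integrable_diff_op_mix[OF _ F_sq])

lemma Z_eq: "Z i j \<omega> = (\<Sum>k=1..n. b k i \<omega> * a k j \<omega>)"
  by (simp add: Z_mix_def)

lemma Z_int: "integrable M (Z i j)"
  unfolding Z_eq[abs_def] by (intro Bochner_Integration.integrable_sum square_integrable_mult b_sq a_sq)

lemma integral_F_mult:
  assumes h: "square_integrable M h"
  shows "(\<integral>\<omega>. F \<omega> $ i * h \<omega> \<partial>M) = (\<Sum>k=1..n. \<integral>\<omega>. a k i \<omega> * h \<omega> \<partial>M)"
proof -
  have "AE \<omega> in M. F \<omega> $ i * h \<omega> = (\<Sum>k=1..n. a k i \<omega> * h \<omega>)"
    using sum_diff_op_mix[OF F_int F_measurable_sig F_mean, of \<alpha> i]
    by eventually_elim (simp add: sum_distrib_right[symmetric])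
  then have "(\<integral>\<omega>. F \<omega> $ i * h \<omega> \<partial>M) = (\<integral>\<omega>. (\<Sum>k=1..n. a k i \<omega> * h \<omega>) \<partial>M)"
    using square_integrable_mult[OF F_sq h] square_integrable_mult[OF a_sq h]
    by (intro integral_cong_AE borel_measurable_sum) auto
  also have "\<dots> = (\<Sum>k=1..n. \<integral>\<omega>. a k i \<omega> * h \<omega> \<partial>M)"
    by (intro Bochner_Integration.integral_sum square_integrable_mult a_sq h)
  finally show ?thesis .
qed

text \<open>The plain difference and \<open>F $ i\<close> differ by a conditional expectation
  orthogonal to \<open>a k j\<close>, so it may be replaced by \<open>F $ i\<close>; the sum of the
  \<open>a k j\<close> then restores \<open>F $ j\<close>.\<close>

lemma Z_expectation: "(\<integral>\<omega>. Z i j \<omega> \<partial>M) = (\<integral>\<omega>. F \<omega> $ i * F \<omega> $ j \<partial>M)"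
proof -
  have "(\<integral>\<omega>. b k i \<omega> * a k j \<omega> \<partial>M) = (\<integral>\<omega>. a k j \<omega> * F \<omega> $ i \<partial>M)" if k: "k \<in> {1..n}" for k
  proof -
    let ?H = "CE ({1..n} - {k}) (Fi i)"
    have H: "square_integrable M ?H" by (rule square_integrable_cond_exp[OF _ F_sq]) auto
    have "(\<integral>\<omega>. ?H \<omega> * a k j \<omega> \<partial>M) = 0"
      by (rule integral_diff_op_mix_orthogonal[OF k F_int _ square_integrable_mult[OF H a_sq[OF k]]]) simp
    moreover have "(\<integral>\<omega>. b k i \<omega> * a k j \<omega> \<partial>M) = (\<integral>\<omega>. a k j \<omega> * F \<omega> $ i - ?H \<omega> * a k j \<omega> \<partial>M)"
      by (intro Bochner_Integration.integral_cong refl) (simp add: diff_op_def algebra_simps)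
    ultimately show ?thesis
      using square_integrable_mult[OF a_sq[OF k] F_sq] square_integrable_mult[OF H a_sq[OF k]] by simp
  qed
  then have "(\<integral>\<omega>. Z i j \<omega> \<partial>M) = (\<Sum>k=1..n. \<integral>\<omega>. a k j \<omega> * F \<omega> $ i \<partial>M)"
    unfolding Z_eq using square_integrable_mult[OF b_sq a_sq] by simp
  also have "\<dots> = (\<integral>\<omega>. F \<omega> $ i * F \<omega> $ j \<partial>M)"
    unfolding integral_F_mult[OF F_sq, symmetric] by (simp add: mult.commute)
  finally show ?thesis .
qed

definition third_moments :: ennreal where
  "third_moments = (\<Sum>i\<in>UNIV. \<Sum>k=1..n. \<integral>\<^sup>+\<omega>. ennreal (\<bar>b k i \<omega>\<bar> ^ 3) \<partial>M)"

text \<open>Each of the three terms ignores two of the three coordinate sums, so it is counted d^2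
  times. The identity is stated in [0,\<infinity>] because the moments may be infinite.\<close>

lemma sum_third_moments:
  fixes t :: "nat \<Rightarrow> 'd \<Rightarrow> ennreal"
  shows "(\<Sum>i\<in>UNIV. \<Sum>k=1..n. \<Sum>j\<in>UNIV. \<Sum>l\<in>UNIV. t k i + t k j + t k l)
    = 3 * of_nat (CARD('d) ^ 2) * (\<Sum>i\<in>UNIV. \<Sum>k=1..n. t k i)"
proof -
  define q where "q k = (\<Sum>i\<in>UNIV. t k i)" for k
  have "(\<Sum>i\<in>UNIV. \<Sum>k=1..n. \<Sum>j\<in>UNIV. \<Sum>l\<in>UNIV. t k i + t k j + t k l)
      = (\<Sum>k=1..n. \<Sum>i\<in>UNIV. \<Sum>j\<in>UNIV. \<Sum>l\<in>UNIV. t k i + t k j + t k l)"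
    by (rule sum.swap)
  also have "\<dots> = (\<Sum>k=1..n. 3 * of_nat (CARD('d) ^ 2) * q k)"
  proof (rule sum.cong[OF refl])
    fix k
    have "(\<Sum>i\<in>UNIV. \<Sum>j\<in>UNIV. \<Sum>l\<in>UNIV. t k i + t k j + t k l)
      = of_nat CARD('d) * (of_nat CARD('d) * q k) + of_nat CARD('d) * (of_nat CARD('d) * q k)
        + of_nat CARD('d) * (of_nat CARD('d) * q k)"
      by (simp add: sum.distrib sum_distrib_left[symmetric] q_def distrib_left add.assoc)
    also have "\<dots> = 3 * of_nat (CARD('d) ^ 2) * q k"
    proof -
      have "x + x + x = 3 * x" for x :: ennreal
        by (metis (no_types) distrib_right mult_1 numeral_Bit1 numeral_One numeral_plus_one one_add_one add.commute)
      then show ?thesis by (simp add: power2_eq_square mult.assoc)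
    qed
    finally show "(\<Sum>i\<in>UNIV. \<Sum>j\<in>UNIV. \<Sum>l\<in>UNIV. t k i + t k j + t k l) = 3 * of_nat (CARD('d) ^ 2) * q k" .
  qed
  also have "\<dots> = 3 * of_nat (CARD('d) ^ 2) * (\<Sum>i\<in>UNIV. \<Sum>k=1..n. t k i)"
    unfolding q_def by (subst sum.swap) (simp only: sum_distrib_left)
  finally show ?thesis .
qed

lemma stein_identity:
  assumes Ck: "Ck (Suc (Suc (Suc m))) g"
    and L2: "\<And>i j x. \<bar>partial_deriv i (partial_deriv j g) x\<bar> \<le> L2"
    and L3: "\<And>i j l x. \<bar>partial_deriv i (partial_deriv j (partial_deriv l g)) x\<bar> \<le> L3"
    and s: "0 \<le> s" and \<tau>: "ennreal L3 * third_moments = ennreal \<tau>" "0 \<le> \<tau>"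
  shows "\<bar>(\<Sum>i\<in>UNIV. \<integral>\<omega>. F \<omega> $ i * partial_deriv i g (s *\<^sub>R F \<omega> + y) \<partial>M)
        - s * (\<Sum>i\<in>UNIV. \<Sum>j\<in>UNIV. \<integral>\<omega>. Z i j \<omega> * partial_deriv j (partial_deriv i g) (s *\<^sub>R F \<omega> + y) \<partial>M)\<bar>
    \<le> s\<^sup>2 * (real (CARD('d) ^ 2) * \<tau> / 2)"
proof -
  have L30: "0 \<le> L3" using L3[of undefined undefined undefined undefined] by linarith
  have C2: "Ck (Suc (Suc m)) (partial_deriv i g)" and C1: "Ck (Suc m) (partial_deriv j (partial_deriv i g))" for i j
    using Ck by auto
  define W where "W k \<omega> = (\<chi> i. CE ({1..n} - {k}) (Fi i) \<omega>)" for k \<omega>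
  have FW: "s *\<^sub>R W k \<omega> + y = (s *\<^sub>R F \<omega> + y) - (\<chi> j. s * b k j \<omega>)" for k \<omega>
    by (simp add: vec_eq_iff W_def diff_op_def algebra_simps)
  have Wsig: "W k \<in> borel_measurable (sig ({1..n} - {k}))" for k
    by (rule borel_measurable_vec) (simp add: W_def)
  define h where "h i \<omega> = partial_deriv i g (s *\<^sub>R F \<omega> + y)" for i \<omega>
  define H where "H k i \<omega> = partial_deriv i g (s *\<^sub>R W k \<omega> + y)" for k i \<omega>
  define d where "d j i \<omega> = partial_deriv j (partial_deriv i g) (s *\<^sub>R F \<omega> + y)" for j i \<omega>
  define \<rho> where "\<rho> k i \<omega> = h i \<omega> - H k i \<omega> - s * (\<Sum>j\<in>UNIV. b k j \<omega> * d j i \<omega>)" for k i \<omega>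
  have affine_sq: "square_integrable M (\<lambda>\<omega>. (s *\<^sub>R V \<omega> + y) $ i)" if "square_integrable M (\<lambda>\<omega>. V \<omega> $ i)" for V :: "'o \<Rightarrow> real ^ 'd" and i
    using square_integrable_add[OF square_integrable_cmult[OF that, of s] square_integrable_const[OF finite_measure_axioms, of "y $ i"]]
    by simp
  have W_sq: "square_integrable M (\<lambda>\<omega>. W k \<omega> $ i)" for k i
    unfolding W_def by (simp, rule square_integrable_cond_exp[OF _ F_sq]) auto
  have h_sq: "square_integrable M (h i)" for i
    unfolding h_def using F_measurable
    by (intro square_integrable_Ck[OF finite_measure_axioms C2 L2] affine_sq F_sq) simp
  have H_sq: "square_integrable M (H k i)" for k i
    unfolding H_def using borel_measurable_vec[OF square_integrable_measurable[OF W_sq]]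
    by (intro square_integrable_Ck[OF finite_measure_axioms C2 L2] affine_sq W_sq) simp
  have H_sig: "H k i \<in> borel_measurable (sig ({1..n} - {k}))" for k i
    unfolding H_def using Wsig by (intro measurable_compose[OF _ Ck_borel_measurable[OF C2]]) simp
  have d_meas [measurable]: "d j i \<in> borel_measurable M" for j i
    unfolding d_def using F_measurable by (intro measurable_compose[OF _ Ck_borel_measurable[OF C1]]) simp
  have abd_int: "integrable M (\<lambda>\<omega>. a k l \<omega> * b k j \<omega> * d j i \<omega>)" if k: "k \<in> {1..n}" for k l j i
  proof (rule Bochner_Integration.integrable_bound)
    show int: "integrable M (\<lambda>\<omega>. L2 * (a k l \<omega> * b k j \<omega>))"
      using square_integrable_mult[OF a_sq[OF k] b_sq] by simp
    show "(\<lambda>\<omega>. a k l \<omega> * b k j \<omega> * d j i \<omega>) \<in> borel_measurable M"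
      by (intro borel_measurable_times d_meas square_integrable_measurable[OF a_sq[OF k]] square_integrable_measurable[OF b_sq])
    show "AE \<omega> in M. norm (a k l \<omega> * b k j \<omega> * d j i \<omega>) \<le> norm (L2 * (a k l \<omega> * b k j \<omega>))"
    proof (rule AE_I2)
      fix \<omega>
      have "\<bar>d j i \<omega>\<bar> \<le> \<bar>L2\<bar>" unfolding d_def using L2[of j i] by (rule order_trans) simp
      from mult_left_mono[OF this, of "\<bar>a k l \<omega> * b k j \<omega>\<bar>"]
      show "norm (a k l \<omega> * b k j \<omega> * d j i \<omega>) \<le> norm (L2 * (a k l \<omega> * b k j \<omega>))"
        by (simp add: abs_mult mult_ac)
    qed
  qed
  have \<rho>_bound: "\<bar>\<rho> k i \<omega>\<bar> \<le> L3 * s\<^sup>2 / 2 * (\<Sum>j\<in>UNIV. \<Sum>l\<in>UNIV. \<bar>b k j \<omega>\<bar> * \<bar>b k l \<omega>\<bar>)" for k i \<omega>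
  proof -
    let ?v = "\<chi> j. s * b k j \<omega>"
    have "\<bar>partial_deriv i g ((s *\<^sub>R F \<omega> + y) - ?v) - partial_deriv i g (s *\<^sub>R F \<omega> + y)
        + (\<Sum>j\<in>UNIV. ?v $ j * partial_deriv j (partial_deriv i g) (s *\<^sub>R F \<omega> + y))\<bar>
        \<le> L3 / 2 * (\<Sum>j\<in>UNIV. \<Sum>l\<in>UNIV. \<bar>?v $ j\<bar> * \<bar>?v $ l\<bar>)"
      by (rule first_order_Taylor_bound[OF C2 L3])
    also have "partial_deriv i g ((s *\<^sub>R F \<omega> + y) - ?v) - partial_deriv i g (s *\<^sub>R F \<omega> + y)
        + (\<Sum>j\<in>UNIV. ?v $ j * partial_deriv j (partial_deriv i g) (s *\<^sub>R F \<omega> + y)) = - \<rho> k i \<omega>"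
      unfolding \<rho>_def h_def H_def FW d_def by (simp add: sum_distrib_left mult.assoc)
    also have "L3 / 2 * (\<Sum>j\<in>UNIV. \<Sum>l\<in>UNIV. \<bar>?v $ j\<bar> * \<bar>?v $ l\<bar>)
        = L3 * s\<^sup>2 / 2 * (\<Sum>j\<in>UNIV. \<Sum>l\<in>UNIV. \<bar>b k j \<omega>\<bar> * \<bar>b k l \<omega>\<bar>)"
      using s by (simp add: sum_distrib_left abs_mult power2_eq_square mult_ac)
    finally show ?thesis by simp
  qed
  have a\<rho>_int: "integrable M (\<lambda>\<omega>. a k i \<omega> * \<rho> k i \<omega>)"
    and a\<rho>_eq: "(\<integral>\<omega>. a k i \<omega> * \<rho> k i \<omega> \<partial>M) = (\<integral>\<omega>. a k i \<omega> * h i \<omega> \<partial>M) - s * (\<Sum>j\<in>UNIV. \<integral>\<omega>. a k i \<omega> * b k j \<omega> * d j i \<omega> \<partial>M)"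
    if k: "k \<in> {1..n}" for k i
  proof -
    have eq: "a k i \<omega> * \<rho> k i \<omega> = a k i \<omega> * h i \<omega> - H k i \<omega> * a k i \<omega> - s * (\<Sum>j\<in>UNIV. a k i \<omega> * b k j \<omega> * d j i \<omega>)" for \<omega>
      by (simp add: \<rho>_def left_diff_distrib right_diff_distrib sum_distrib_left mult_ac)
    note ints = square_integrable_mult[OF a_sq[OF k] h_sq, of i i] square_integrable_mult[OF H_sq a_sq[OF k], of k i i]
      abd_int[OF k, of i _ i]
    have "(\<integral>\<omega>. H k i \<omega> * a k i \<omega> \<partial>M) = 0"
      by (rule integral_diff_op_mix_orthogonal[OF k F_int H_sig ints(2)])
    then show "integrable M (\<lambda>\<omega>. a k i \<omega> * \<rho> k i \<omega>)"
      "(\<integral>\<omega>. a k i \<omega> * \<rho> k i \<omega> \<partial>M) = (\<integral>\<omega>. a k i \<omega> * h i \<omega> \<partial>M) - s * (\<Sum>j\<in>UNIV. \<integral>\<omega>. a k i \<omega> * b k j \<omega> * d j i \<omega> \<partial>M)"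
      unfolding eq using ints by simp_all
  qed
  \<comment> \<open>Decomposing \<open>F $ i\<close> attaches the mixed difference to the index
    \<open>i\<close> and so produces \<open>Z j i\<close>; symmetry of the second derivatives
    restores \<open>Z i j\<close>.\<close>
  have "(\<Sum>i\<in>UNIV. \<Sum>j\<in>UNIV. \<integral>\<omega>. Z i j \<omega> * d j i \<omega> \<partial>M) = (\<Sum>i\<in>UNIV. \<Sum>j\<in>UNIV. \<integral>\<omega>. Z j i \<omega> * d j i \<omega> \<partial>M)"
    unfolding d_def by (subst sum.swap) (simp add: partial_deriv_commute[OF Ck_Suc_imp[OF Ck]])
  also have "\<dots> = (\<Sum>i\<in>UNIV. \<Sum>j\<in>UNIV. \<Sum>k=1..n. \<integral>\<omega>. a k i \<omega> * b k j \<omega> * d j i \<omega> \<partial>M)"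
  proof (intro sum.cong refl)
    fix i j
    have "(\<integral>\<omega>. Z j i \<omega> * d j i \<omega> \<partial>M) = (\<integral>\<omega>. (\<Sum>k=1..n. a k i \<omega> * b k j \<omega> * d j i \<omega>) \<partial>M)"
      by (simp add: Z_eq sum_distrib_left sum_distrib_right mult_ac)
    also have "\<dots> = (\<Sum>k=1..n. \<integral>\<omega>. a k i \<omega> * b k j \<omega> * d j i \<omega> \<partial>M)"
      by (intro Bochner_Integration.integral_sum abd_int)
    finally show "(\<integral>\<omega>. Z j i \<omega> * d j i \<omega> \<partial>M) = (\<Sum>k=1..n. \<integral>\<omega>. a k i \<omega> * b k j \<omega> * d j i \<omega> \<partial>M)" .
  qed
  also have "\<dots> = (\<Sum>i\<in>UNIV. \<Sum>k=1..n. \<Sum>j\<in>UNIV. \<integral>\<omega>. a k i \<omega> * b k j \<omega> * d j i \<omega> \<partial>M)"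
    by (intro sum.cong refl sum.swap)
  finally have Zsum: "(\<Sum>i\<in>UNIV. \<Sum>j\<in>UNIV. \<integral>\<omega>. Z i j \<omega> * d j i \<omega> \<partial>M)
      = (\<Sum>i\<in>UNIV. \<Sum>k=1..n. \<Sum>j\<in>UNIV. \<integral>\<omega>. a k i \<omega> * b k j \<omega> * d j i \<omega> \<partial>M)" .
  let ?X = "(\<Sum>i\<in>UNIV. \<integral>\<omega>. F \<omega> $ i * h i \<omega> \<partial>M) - s * (\<Sum>i\<in>UNIV. \<Sum>j\<in>UNIV. \<integral>\<omega>. Z i j \<omega> * d j i \<omega> \<partial>M)"
  have X: "?X = (\<Sum>i\<in>UNIV. \<Sum>k=1..n. \<integral>\<omega>. a k i \<omega> * \<rho> k i \<omega> \<partial>M)"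
    unfolding Zsum integral_F_mult[OF h_sq] using a\<rho>_eq by (simp add: sum_subtractf sum_distrib_left)
  define t where "t k i = (\<integral>\<^sup>+\<omega>. ennreal (\<bar>b k i \<omega>\<bar> ^ 3) \<partial>M)" for k i
  \<comment> \<open>1/6 is the 1/2 of the Taylor bound times the 1/3 of
    \<open>abs_mult3_le_cubes\<close>.\<close>
  define c where "c = L3 * s\<^sup>2 / 6"
  have c0: "0 \<le> c" using L30 by (simp add: c_def)
  have summand_le: "ennreal \<bar>\<integral>\<omega>. a k i \<omega> * \<rho> k i \<omega> \<partial>M\<bar> \<le> ennreal c * (\<Sum>j\<in>UNIV. \<Sum>l\<in>UNIV. t k i + t k j + t k l)"
    if k: "k \<in> {1..n}" for k i
  proof -
    have am: "a k i \<in> borel_measurable M" "\<And>j. b k j \<in> borel_measurable M"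
      using a_sq[OF k] b_sq by (auto dest: square_integrable_measurable)
    note [measurable] = am
    have "ennreal \<bar>\<integral>\<omega>. a k i \<omega> * \<rho> k i \<omega> \<partial>M\<bar> \<le> (\<integral>\<^sup>+\<omega>. ennreal \<bar>a k i \<omega> * \<rho> k i \<omega>\<bar> \<partial>M)"
      using integral_norm_bound_ennreal[OF a\<rho>_int[OF k, of i]] by simp
    also have "\<dots> \<le> (\<integral>\<^sup>+\<omega>. ennreal c * (\<Sum>j\<in>UNIV. \<Sum>l\<in>UNIV.
        ennreal (\<bar>a k i \<omega>\<bar> ^ 3) + ennreal (\<bar>b k j \<omega>\<bar> ^ 3) + ennreal (\<bar>b k l \<omega>\<bar> ^ 3)) \<partial>M)"
    proof (rule nn_integral_mono)
      fix \<omega>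
      have "\<bar>a k i \<omega> * \<rho> k i \<omega>\<bar> \<le> \<bar>a k i \<omega>\<bar> * (L3 * s\<^sup>2 / 2 * (\<Sum>j\<in>UNIV. \<Sum>l\<in>UNIV. \<bar>b k j \<omega>\<bar> * \<bar>b k l \<omega>\<bar>))"
        unfolding abs_mult by (intro mult_left_mono \<rho>_bound) simp
      also have "\<dots> = L3 * s\<^sup>2 / 2 * (\<Sum>j\<in>UNIV. \<Sum>l\<in>UNIV. \<bar>a k i \<omega>\<bar> * (\<bar>b k j \<omega>\<bar> * \<bar>b k l \<omega>\<bar>))"
        by (simp add: sum_distrib_left mult_ac)
      also have "\<dots> \<le> L3 * s\<^sup>2 / 2 * (\<Sum>j\<in>UNIV. \<Sum>l\<in>UNIV. (\<bar>a k i \<omega>\<bar> ^ 3 + \<bar>b k j \<omega>\<bar> ^ 3 + \<bar>b k l \<omega>\<bar> ^ 3) / 3)"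
        using L30 by (intro mult_left_mono sum_mono abs_mult3_le_cubes) auto
      also have "\<dots> = c * (\<Sum>j\<in>UNIV. \<Sum>l\<in>UNIV. \<bar>a k i \<omega>\<bar> ^ 3 + \<bar>b k j \<omega>\<bar> ^ 3 + \<bar>b k l \<omega>\<bar> ^ 3)"
        by (simp only: sum_divide_distrib[symmetric]) (simp add: c_def)
      finally have "ennreal \<bar>a k i \<omega> * \<rho> k i \<omega>\<bar> \<le> ennreal (c * (\<Sum>j\<in>UNIV. \<Sum>l\<in>UNIV. \<bar>a k i \<omega>\<bar> ^ 3 + \<bar>b k j \<omega>\<bar> ^ 3 + \<bar>b k l \<omega>\<bar> ^ 3))"
        by (rule ennreal_leI)
      also have "\<dots> = ennreal c * (\<Sum>j\<in>UNIV. \<Sum>l\<in>UNIV. ennreal (\<bar>a k i \<omega>\<bar> ^ 3) + ennreal (\<bar>b k j \<omega>\<bar> ^ 3) + ennreal (\<bar>b k l \<omega>\<bar> ^ 3))"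
        using c0 by (simp add: ennreal_mult sum_nonneg flip: sum_ennreal ennreal_plus)
      finally show "ennreal \<bar>a k i \<omega> * \<rho> k i \<omega>\<bar> \<le> ennreal c * (\<Sum>j\<in>UNIV. \<Sum>l\<in>UNIV.
        ennreal (\<bar>a k i \<omega>\<bar> ^ 3) + ennreal (\<bar>b k j \<omega>\<bar> ^ 3) + ennreal (\<bar>b k l \<omega>\<bar> ^ 3))" .
    qed
    also have "\<dots> = ennreal c * (\<Sum>j\<in>UNIV. \<Sum>l\<in>UNIV. (\<integral>\<^sup>+\<omega>. ennreal (\<bar>a k i \<omega>\<bar> ^ 3) \<partial>M) + t k j + t k l)"
      unfolding t_def by (subst nn_integral_cmult, measurable) (simp add: nn_integral_sum nn_integral_add)
    \<comment> \<open>The cubes of mixed differences are traded for those of plain ones, in which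
      \<open>third_moments\<close> is expressed.\<close>
    also have "\<dots> \<le> ennreal c * (\<Sum>j\<in>UNIV. \<Sum>l\<in>UNIV. t k i + t k j + t k l)"
      unfolding t_def
      by (intro mult_left_mono sum_mono add_mono nn_integral_diff_op_mix_cubed_le[OF k F_int \<alpha>]) auto
    finally show ?thesis .
  qed
  have "ennreal \<bar>?X\<bar> \<le> ennreal (\<Sum>i\<in>UNIV. \<Sum>k=1..n. \<bar>\<integral>\<omega>. a k i \<omega> * \<rho> k i \<omega> \<partial>M\<bar>)"
    unfolding X by (intro ennreal_leI order_trans[OF sum_abs] sum_mono order_refl)
  also have "\<dots> = (\<Sum>i\<in>UNIV. \<Sum>k=1..n. ennreal \<bar>\<integral>\<omega>. a k i \<omega> * \<rho> k i \<omega> \<partial>M\<bar>)"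
    by (simp add: sum_nonneg flip: sum_ennreal)
  also have "\<dots> \<le> (\<Sum>i\<in>UNIV. \<Sum>k=1..n. ennreal c * (\<Sum>j\<in>UNIV. \<Sum>l\<in>UNIV. t k i + t k j + t k l))"
    by (intro sum_mono summand_le)
  also have "\<dots> = ennreal c * (3 * of_nat (CARD('d) ^ 2) * third_moments)"
    unfolding third_moments_def t_def[symmetric] sum_third_moments[symmetric] by (simp only: sum_distrib_left)
  also have "\<dots> = ennreal (s\<^sup>2 * (real (CARD('d) ^ 2) / 2)) * (ennreal L3 * third_moments)"
  proof -
    have "ennreal c * (3 * of_nat (CARD('d) ^ 2)) = ennreal c * (ennreal 3 * ennreal (real (CARD('d) ^ 2)))"
      by (simp only: ennreal_of_nat_eq_real_of_nat ennreal_numeral)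
    also have "ennreal 3 * ennreal (real (CARD('d) ^ 2)) = ennreal (3 * real (CARD('d) ^ 2))"
      by (rule ennreal_mult[symmetric]) simp_all
    also have "ennreal c * \<dots> = ennreal (c * (3 * real (CARD('d) ^ 2)))"
      by (rule ennreal_mult[symmetric]) (use c0 in simp_all)
    also have "c * (3 * real (CARD('d) ^ 2)) = s\<^sup>2 * (real (CARD('d) ^ 2) / 2) * L3"
      by (simp add: c_def)
    also have "\<dots> = ennreal (s\<^sup>2 * (real (CARD('d) ^ 2) / 2)) * ennreal L3"
      using L30 by (intro ennreal_mult) auto
    finally show ?thesis by (simp only: mult.assoc[symmetric])
  qed
  also have "\<dots> = ennreal (s\<^sup>2 * (real (CARD('d) ^ 2) * \<tau> / 2))"
    unfolding \<tau>(1) using \<tau>(2) by (simp flip: ennreal_mult)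
  finally have "\<bar>?X\<bar> \<le> s\<^sup>2 * (real (CARD('d) ^ 2) * \<tau> / 2)"
    using \<tau>(2) by (subst (asm) ennreal_le_iff) auto
  then show ?thesis unfolding h_def d_def .
qed

end

section \<open>Combination of the interpolation with the approximate Stein identity\<close>

theorem theorem3p2:
  fixes M :: "'o measure" and N :: "'b measure" and S :: "'a measure"
    and X :: "nat \<Rightarrow> 'o \<Rightarrow> 'a" and n :: nat
    and f :: "'d::{finite,linorder} \<Rightarrow> (nat \<Rightarrow> 'a) \<Rightarrow> real"
    and F :: "'o \<Rightarrow> real ^ 'd::{finite,linorder}" and Y :: "'b \<Rightarrow> real ^ 'd::{finite,linorder}"
    and C :: "(real ^ 'd::{finite,linorder}) ^ 'd::{finite,linorder}"
    and g :: "real ^ 'd::{finite,linorder} \<Rightarrow> real" and \<alpha> :: real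
  assumes "CARD('d::{finite,linorder}) \<ge> 2" and "n \<ge> 1"
    and "prob_space M" and "prob_space N"
    and "prob_space.indep_vars M (\<lambda>_. S) X {1..n}"
    and "centered_gaussian_vector N Y C"
    and "\<forall>i. f i \<in> borel_measurable (PiM {1..n} (\<lambda>_. S))"
    and "\<forall>\<omega>\<in>space M. \<forall>i. F \<omega> $ i = f i (\<lambda>k\<in>{1..n}. X k \<omega>)"
    and "\<forall>i. (\<integral>\<omega>. F \<omega> $ i \<partial>M) = 0"
    and "\<forall>i j. integrable M (\<lambda>\<omega>. F \<omega> $ i * F \<omega> $ j)"
    and "0 \<le> \<alpha>" and "\<alpha> \<le> 1"
    and "Ck 3 g" and "deriv_sup_norm 2 g + deriv_sup_norm 3 g < \<infinity>"
  shows "let B3 = deriv_sup_norm 2 g / 2;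
             B4 = deriv_sup_norm 3 g * of_nat (CARD('d::{finite,linorder})) ^ 2 / 3;
             \<sigma> = (\<lambda>i j. \<integral>\<omega>. F \<omega> $ i * F \<omega> $ j \<partial>M);
             Z = Z_mix M S X n \<alpha> F;
             R = B4 * (\<Sum>i\<in>UNIV. \<Sum>k=1..n.
                   \<integral>\<^sup>+\<omega>. ennreal (\<bar>diff_op M S X n k (\<lambda>\<omega>. F \<omega> $ i) \<omega>\<bar> ^ 3) \<partial>M);
             bound1 = B3 * (\<Sum>i\<in>UNIV. \<Sum>j\<in>UNIV. \<integral>\<^sup>+\<omega>. ennreal \<bar>C $ i $ j - Z i j \<omega>\<bar> \<partial>M) + R;
             bound2 = B3 * (\<Sum>i\<in>UNIV. \<Sum>j\<in>UNIV. ennreal \<bar>C $ i $ j - \<sigma> i j\<bar>)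
                    + B3 * (\<Sum>i\<in>UNIV. \<Sum>j\<in>UNIV. sqrt_ennreal (nn_variance M (Z i j))) + R
         in ennreal \<bar>(\<integral>\<omega>. g (F \<omega>) \<partial>M) - (\<integral>\<omega>. g (Y \<omega>) \<partial>N)\<bar> \<le> bound1 \<and> bound1 \<le> bound2"
proof -
  interpret M: prob_space M by fact
  interpret gaussian N Y C
    using assms(4,6) by (simp add: gaussian_def gaussian_axioms_def)
  interpret seq: indep_sequence M S X n
    using assms(3,5) by (simp add: indep_sequence_def indep_sequence_axioms_def)
  \<comment> \<open>Being a measurable function of the variables, \<open>F\<close> is measurable for
    the sigma-algebra they generate; this lets the telescoping sums end in \<open>F\<close>
    itself.\<close>
  have F_sig: "(\<lambda>\<omega>. F \<omega> $ i) \<in> borel_measurable (seq.sig {1..n})" for i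
  proof -
    have "(\<lambda>\<omega>. \<lambda>k\<in>{1..n}. X k \<omega>) \<in> measurable (seq.sig {1..n}) (PiM {1..n} (\<lambda>_. S))"
      by (intro measurable_restrict seq.X_measurable_sig) auto
    from measurable_compose[OF this spec[OF assms(7)]]
    have "(\<lambda>\<omega>. f i (\<lambda>k\<in>{1..n}. X k \<omega>)) \<in> borel_measurable (seq.sig {1..n})" .
    then show ?thesis
      using assms(8) by (subst measurable_cong[where g="\<lambda>\<omega>. f i (\<lambda>k\<in>{1..n}. X k \<omega>)"]) auto
  qed
  interpret fn: indep_functional M S X n F \<alpha>
  proof unfold_locales
    show "(\<lambda>\<omega>. F \<omega> $ i) \<in> borel_measurable (seq.sig {1..n})" for i by (rule F_sig)
    show "square_integrable M (\<lambda>\<omega>. F \<omega> $ i)" for i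
      unfolding square_integrable_def
      using measurable_from_subalg[OF seq.subalgebra_sig F_sig] assms(10) by (simp add: power2_eq_square)
  qed (use assms(9,11,12) in auto)
  have fin: "deriv_sup_norm 2 g \<noteq> \<infinity>" "deriv_sup_norm 3 g \<noteq> \<infinity>"
    using assms(14) by auto
  define L2 where "L2 = enn2real (deriv_sup_norm 2 g)"
  define L3 where "L3 = enn2real (deriv_sup_norm 3 g)"
  have nonneg: "0 \<le> L2" "0 \<le> L3" by (simp_all add: L2_def L3_def)
  have e2: "deriv_sup_norm 2 g = ennreal L2" and e3: "deriv_sup_norm 3 g = ennreal L3"
    using fin by (simp_all add: L2_def L3_def ennreal_enn2real_if)
  have Ck3: "Ck (Suc (Suc (Suc 0))) g" using assms(13) by (simp only: numeral_3_eq_3)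
  have Ck2: "Ck (Suc (Suc 0)) g" by (rule Ck_Suc_imp[OF Ck3])
  have L2: "\<bar>partial_deriv i (partial_deriv j g) x\<bar> \<le> L2" for i j x
    using partial_deriv_le_deriv_sup_norm[of "[i, j]" g x] Ck2 e2 nonneg
    by (simp add: numeral_2_eq_2)
  have L3: "\<bar>partial_deriv i (partial_deriv j (partial_deriv l g)) x\<bar> \<le> L3" for i j l x
    using partial_deriv_le_deriv_sup_norm[of "[i, j, l]" g x] Ck3 e3 nonneg
    by (simp add: numeral_3_eq_3)
  let ?d = "real (CARD('d) ^ 2)"
  let ?K = "\<Sum>i\<in>UNIV. \<Sum>j\<in>UNIV. \<integral>\<omega>. \<bar>C $ i $ j - fn.Z i j \<omega>\<bar> \<partial>M"
  let ?R = "ennreal L3 * of_nat (CARD('d)) ^ 2 / 3 * fn.third_moments"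
  have K: "(\<Sum>i\<in>UNIV. \<Sum>j\<in>UNIV. \<integral>\<^sup>+\<omega>. ennreal \<bar>C $ i $ j - fn.Z i j \<omega>\<bar> \<partial>M) = ennreal ?K"
    using fn.Z_int by (simp add: nn_integral_eq_integral sum_nonneg flip: sum_ennreal)
  have R: "?R = ennreal (?d / 3) * (ennreal L3 * fn.third_moments)"
  proof -
    have "of_nat (CARD('d)) ^ 2 / 3 = ennreal (?d / 3)"
      by (simp add: divide_ennreal[symmetric] ennreal_of_nat_eq_real_of_nat[symmetric] flip: of_nat_power)
    then have "?R = ennreal L3 * ennreal (?d / 3) * fn.third_moments"
      by (simp only: ennreal_times_divide[symmetric])
    then show ?thesis by (simp only: mult_ac)
  qed
  have bound1: "ennreal \<bar>(\<integral>\<omega>. g (F \<omega>) \<partial>M) - (\<integral>\<omega>. g (Y \<omega>) \<partial>N)\<bar> \<le> ennreal L2 / 2 * ennreal ?K + ?R"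
  proof (cases "ennreal L3 * fn.third_moments = \<infinity>")
    case True
    \<comment> \<open>The factor d^2/3 is positive, so an infinite product stays infinite and the
      bound is trivial.\<close>
    have "?R = \<infinity>"
      unfolding R True by (simp add: ennreal_mult_top)
    then show ?thesis by simp
  next
    case False
    define \<tau> where "\<tau> = enn2real (ennreal L3 * fn.third_moments)"
    have \<tau>: "ennreal L3 * fn.third_moments = ennreal \<tau>" "0 \<le> \<tau>"
      using False by (simp_all add: \<tau>_def ennreal_enn2real_if)
    have "\<bar>(\<integral>\<omega>. g (F \<omega>) \<partial>M) - (\<integral>\<omega>. g (Y \<omega>) \<partial>N)\<bar> \<le> L2 / 2 * ?K + (?d * \<tau> / 2) / 3"
      by (rule interpolation[OF assms(3) fn.F_measurable fn.F_sq fn.Z_int Ck2 L2])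
         (rule fn.stein_identity[OF Ck3 L2 L3 _ \<tau>])
    also have "\<dots> \<le> L2 / 2 * ?K + ?d / 3 * \<tau>"
      using \<tau>(2) by simp
    finally have "ennreal \<bar>(\<integral>\<omega>. g (F \<omega>) \<partial>M) - (\<integral>\<omega>. g (Y \<omega>) \<partial>N)\<bar> \<le> ennreal (L2 / 2 * ?K + ?d / 3 * \<tau>)"
      by (rule ennreal_leI)
    also have "\<dots> = ennreal (L2 / 2) * ennreal ?K + ennreal (?d / 3) * ennreal \<tau>"
    proof -
      have "0 \<le> ?K" by (intro sum_nonneg Bochner_Integration.integral_nonneg) simp
      then show ?thesis
        using nonneg \<tau>(2) by (simp only: ennreal_plus ennreal_mult mult_nonneg_nonneg divide_nonneg_nonneg
            of_nat_0_le_iff zero_le_numeral)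
    qed
    also have "ennreal (L2 / 2) = ennreal L2 / 2"
      using nonneg by (simp add: divide_ennreal[symmetric])
    finally show ?thesis unfolding R \<tau>(1) .
  qed
  \<comment> \<open>The covariance inserted by the triangle inequality is the mean of
    \<open>Z\<close>, so the second part is the mean absolute deviation of \<open>Z\<close>,
    controlled by its standard deviation.\<close>
  have bound2: "(\<Sum>i\<in>UNIV. \<Sum>j\<in>UNIV. \<integral>\<^sup>+\<omega>. ennreal \<bar>C $ i $ j - fn.Z i j \<omega>\<bar> \<partial>M)
      \<le> (\<Sum>i\<in>UNIV. \<Sum>j\<in>UNIV. ennreal \<bar>C $ i $ j - (\<integral>\<omega>. F \<omega> $ i * F \<omega> $ j \<partial>M)\<bar>)
        + (\<Sum>i\<in>UNIV. \<Sum>j\<in>UNIV. sqrt_ennreal (nn_variance M (fn.Z i j)))"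
    unfolding sum.distrib[symmetric]
  proof (intro sum_mono)
    fix i j
    let ?\<sigma> = "\<integral>\<omega>. F \<omega> $ i * F \<omega> $ j \<partial>M"
    have [measurable]: "fn.Z i j \<in> borel_measurable M" using fn.Z_int by (rule borel_measurable_integrable)
    have "(\<integral>\<^sup>+\<omega>. ennreal \<bar>C $ i $ j - fn.Z i j \<omega>\<bar> \<partial>M)
        \<le> (\<integral>\<^sup>+\<omega>. ennreal \<bar>C $ i $ j - ?\<sigma>\<bar> + ennreal \<bar>fn.Z i j \<omega> - ?\<sigma>\<bar> \<partial>M)"
      by (intro nn_integral_mono) (auto simp flip: ennreal_plus intro!: ennreal_leI)
    also have "\<dots> = ennreal \<bar>C $ i $ j - ?\<sigma>\<bar> + (\<integral>\<^sup>+\<omega>. ennreal \<bar>fn.Z i j \<omega> - ?\<sigma>\<bar> \<partial>M)"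
      by (subst nn_integral_add) (auto simp: M.emeasure_space_1)
    also have "(\<integral>\<^sup>+\<omega>. ennreal \<bar>fn.Z i j \<omega> - ?\<sigma>\<bar> \<partial>M) \<le> sqrt_ennreal (nn_variance M (fn.Z i j))"
      using nn_integral_abs_le_sqrt_variance[OF assms(3) fn.Z_int] by (simp only: fn.Z_expectation)
    finally show "(\<integral>\<^sup>+\<omega>. ennreal \<bar>C $ i $ j - fn.Z i j \<omega>\<bar> \<partial>M)
        \<le> ennreal \<bar>C $ i $ j - ?\<sigma>\<bar> + sqrt_ennreal (nn_variance M (fn.Z i j))"
      by simp
  qed
  have "ennreal L2 / 2 * (\<Sum>i\<in>UNIV. \<Sum>j\<in>UNIV. \<integral>\<^sup>+\<omega>. ennreal \<bar>C $ i $ j - fn.Z i j \<omega>\<bar> \<partial>M) + ?R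
      \<le> ennreal L2 / 2 * (\<Sum>i\<in>UNIV. \<Sum>j\<in>UNIV. ennreal \<bar>C $ i $ j - (\<integral>\<omega>. F \<omega> $ i * F \<omega> $ j \<partial>M)\<bar>)
        + ennreal L2 / 2 * (\<Sum>i\<in>UNIV. \<Sum>j\<in>UNIV. sqrt_ennreal (nn_variance M (fn.Z i j))) + ?R"
    unfolding distrib_left[symmetric] by (intro add_right_mono mult_left_mono bound2) simp
  with bound1[folded K] show ?thesis
    unfolding Let_def e2 e3 fn.third_moments_def by blast
qed

end
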